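(* \textsc{Gap LS Vertex Cover} can be solved in $\mathcal{O}(k!\cdot(\Delta-1)^{\frac{k+d}{2}}\cdot n)$ time, where $\Delta$ is the maximum degree and $n$ the number of vertices of the input graph.
   Context: For sets $A,B$, $A\oplus B=(A\setminus B)\cup(B\setminus A)$. A $k$-swap for a vertex cover $S$ of $G=(V,E)$ is $W\subseteq V$ with $|W|\le k$; it is valid if $S\oplus W$ is a vertex cover of $G$; it is $d$-improving if $|W\cap S|-|W\setminus S|\ge d$. \textsc{Gap LS Vertex Cover}: given a graph $G$, a vertex cover $S$ of $G$, $k\in\mathbb{N}$ and $d\in[1,k]$, decide whether there is a valid $d$-improving $k$-swap for $S$ in $G$.
   Formalization: In the time bound, Δ−1 is read as max(1, Δ−1) and n as max(1, n), since the literal bound is 0 or undefined when Δ ≤ 1 or n = 0; for Δ ≥ 2 and n ≥ 1 the bound is as stated. *)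

theory Defs
  imports Complex_Main "HOL-Library.More_List"
begin

definition simple_graph :: "'v set \<Rightarrow> 'v set set \<Rightarrow> bool" where
  "simple_graph V E \<longleftrightarrow> finite V \<and> (\<forall>e\<in>E. e \<subseteq> V \<and> card e = 2)"

definition neighbours :: "'v set set \<Rightarrow> 'v \<Rightarrow> 'v set" where
  "neighbours E v = {u. {u, v} \<in> E}"

(* 0 is inserted only to give the empty graph maximum degree 0. *)
definition max_degree :: "'v set \<Rightarrow> 'v set set \<Rightarrow> nat" where
  "max_degree V E = Max (insert 0 ((\<lambda>v. card (neighbours E v)) ` V))"

definition vertex_cover :: "'v set \<Rightarrow> 'v set set \<Rightarrow> 'v set \<Rightarrow> bool" where
  "vertex_cover V E S \<longleftrightarrow> S \<subseteq> V \<and> (\<forall>e\<in>E. e \<inter> S \<noteq> {})"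

definition is_swap :: "'v set \<Rightarrow> nat \<Rightarrow> 'v set \<Rightarrow> bool" where
  "is_swap V k W \<longleftrightarrow> W \<subseteq> V \<and> card W \<le> k"

definition valid_swap :: "'v set \<Rightarrow> 'v set set \<Rightarrow> 'v set \<Rightarrow> 'v set \<Rightarrow> bool" where
  "valid_swap V E S W \<longleftrightarrow> vertex_cover V E (sym_diff S W)"

definition improving_swap :: "nat \<Rightarrow> 'v set \<Rightarrow> 'v set \<Rightarrow> bool" where
  "improving_swap d S W \<longleftrightarrow> int (card (W \<inter> S)) - int (card (W - S)) \<ge> int d"

definition gap_ls_vc_instance ::
    "'v set \<Rightarrow> 'v set set \<Rightarrow> 'v set \<Rightarrow> nat \<Rightarrow> nat \<Rightarrow> bool" where
  "gap_ls_vc_instance V E S k d \<longleftrightarrow>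
     simple_graph V E \<and> vertex_cover V E S \<and> 1 \<le> d \<and> d \<le> k"

definition gap_ls_vc :: "'v set \<Rightarrow> 'v set set \<Rightarrow> 'v set \<Rightarrow> nat \<Rightarrow> nat \<Rightarrow> bool" where
  "gap_ls_vc V E S k d \<longleftrightarrow>
     (\<exists>W. is_swap V k W \<and> valid_swap V E S W \<and> improving_swap d S W)"

text \<open>
  A unit-cost random access machine over the natural numbers.  It has scalar registers
  and arrays, both addressed by natural numbers; a program mentions only finitely many of
  them by name, and array cells are accessed indirectly, through an index held in a
  register.  The only arithmetic is addition and truncated subtraction, so that unit cost
  is not a way to hide expensive computations in large numbers.  Keeping finitely many
  arrays apart rather than interleaving them in one memory changes running times by a
  constant factor only.
\<close>

datatype instr =
    Const nat nat
  | Copy nat nat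
  | Add nat nat nat
  | Sub nat nat nat
  | Load nat nat nat
  | Store nat nat nat
  | Jump nat
  | JumpZero nat nat

type_synonym config = "nat \<times> (nat \<Rightarrow> nat) \<times> (nat \<Rightarrow> nat \<Rightarrow> nat)"

fun exec_instr :: "instr \<Rightarrow> config \<Rightarrow> config" where
  "exec_instr (Const r c) (pc, R, M) = (pc + 1, R(r := c), M)"
| "exec_instr (Copy r s) (pc, R, M) = (pc + 1, R(r := R s), M)"
| "exec_instr (Add r s t) (pc, R, M) = (pc + 1, R(r := R s + R t), M)"
| "exec_instr (Sub r s t) (pc, R, M) = (pc + 1, R(r := R s - R t), M)"
| "exec_instr (Load r a s) (pc, R, M) = (pc + 1, R(r := M a (R s)), M)"
| "exec_instr (Store a s t) (pc, R, M) = (pc + 1, R, M(a := (M a)(R s := R t)))"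
| "exec_instr (Jump l) (pc, R, M) = (l, R, M)"
| "exec_instr (JumpZero r l) (pc, R, M) = (if R r = 0 then l else pc + 1, R, M)"

(* A machine whose program counter has left the program has halted and stays put. *)
definition step :: "instr list \<Rightarrow> config \<Rightarrow> config" where
  "step P cf = (if fst cf < length P then exec_instr (P ! fst cf) cf else cf)"

(* Halted configurations are fixed points of step, so this says: after at most t instructions. *)
definition decides_within ::
    "instr list \<Rightarrow> (nat \<Rightarrow> nat) \<Rightarrow> (nat \<Rightarrow> nat \<Rightarrow> nat) \<Rightarrow> nat \<Rightarrow> bool \<Rightarrow> bool" where
  "decides_within P R M t b \<longleftrightarrow>
     (case (step P ^^ t) (0, R, M) of
        (pc, R', M') \<Rightarrow> length P \<le> pc \<and> R' 0 = of_bool b)"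

text \<open>
  The vertices are \<open>0, \<dots>, n - 1\<close>, and the graph is given by adjacency lists in arbitrary
  order.
\<close>
definition adjacency_lists :: "nat set \<Rightarrow> nat set set \<Rightarrow> nat list list \<Rightarrow> bool" where
  "adjacency_lists V E adj \<longleftrightarrow>
     V = {..<length adj} \<and>
     (\<forall>v\<in>V. distinct (adj ! v) \<and> set (adj ! v) = neighbours E v)"

text \<open>
  Registers \<open>0\<close>, \<open>1\<close>, \<open>2\<close> hold \<open>n\<close>, \<open>k\<close>, \<open>d\<close>.  Array \<open>1\<close> is the concatenation of the
  adjacency lists; in it, the list of \<open>v\<close> occupies the positions from \<open>M 0 v\<close> up to, but not
  including, \<open>M 0 (v + 1)\<close>.  Array \<open>2\<close> is the characteristic vector of \<open>S\<close>.  All other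
  registers and cells are \<open>0\<close>.
\<close>
definition input_registers :: "nat \<Rightarrow> nat \<Rightarrow> nat \<Rightarrow> nat \<Rightarrow> nat" where
  "input_registers n k d = nth_default 0 [n, k, d]"

definition input_arrays :: "nat list list \<Rightarrow> nat set \<Rightarrow> nat \<Rightarrow> nat \<Rightarrow> nat" where
  "input_arrays adj S a = nth_default 0 (nth_default []
     [map (\<lambda>v. length (concat (take v adj))) [0..<length adj + 1],
      concat adj,
      map (\<lambda>v. of_bool (v \<in> S)) [0..<length adj]] a)"

end

theory Submission
  imports Defs
begin

text \<open>
  Write \<open>gap J = card J - card (outer J)\<close>, where \<open>outer J\<close> is the set of neighbours of \<open>J\<close> outside
  \<open>S\<close>. With \<open>B = (k - d) div 2\<close> and \<open>A = B + d\<close>, a valid \<open>d\<close>-improving \<open>k\<close>-swap exists iff some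
  independent \<open>J \<subseteq> S\<close> with at most \<open>A\<close> vertices has gap at least \<open>d\<close>; such a \<open>J\<close> is built one
  vertex at a time by a search tree of depth \<open>A\<close>. A partial set \<open>I\<close> is extended either by a
  neighbour of a vertex of \<open>outer I\<close> (at most \<open>B \<Delta>\<close> choices), or, when \<open>I\<close> is a union of
  components of \<open>J\<close>, by the first vertex of a new component. For the latter, let \<open>g\<close> be the smallest
  gain of a remaining component and let \<open>X\<close> be a smallest set, grown connectedly, that increases the
  gap of \<open>I\<close> by \<open>g\<close>. Either \<open>J\<close> meets the closed neighbourhood of \<open>X\<close>, or a component of \<open>J\<close> can be
  exchanged for \<open>X\<close>; so the new vertex may be sought among the \<open>(g + B) (\<Delta> + 1)\<close> vertices close to
  \<open>X\<close>, and the factor \<open>n\<close> is paid only for finding \<open>X\<close>. The values \<open>g\<close> guessed along a branch add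
  up to at most \<open>d\<close>, so they contribute only a factor exponential in \<open>d\<close>. The total is
  \<open>c ^ k (B + 1) ^ A \<Delta> ^ A n\<close> up to constants, and \<open>c ^ k (B + 1) ^ A = O(k!)\<close> for every constant
  \<open>c\<close> because \<open>A + B \<le> k\<close> and \<open>B \<le> A\<close>; this also absorbs the difference between \<open>\<Delta>\<close> and
  \<open>\<Delta> - 1\<close>.
\<close>

section \<open>Structured programs with time bounds\<close>

text \<open>\<open>Cond cs r a b\<close> and \<open>While cs r a\<close> run the straight-line code \<open>cs\<close> and then test whether
  register \<open>r\<close> is nonzero.\<close>
datatype com =
    Block "instr list"
  | Seq com com (infixr ";;" 60)
  | Cond "instr list" nat com com
  | While "instr list" nat com

fun straight_line :: "instr \<Rightarrow> bool" where
  "straight_line (Jump l) = False"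
| "straight_line (JumpZero r l) = False"
| "straight_line _ = True"

fun code_size :: "com \<Rightarrow> nat" where
  "code_size (Block cs) = length cs"
| "code_size (a ;; b) = code_size a + code_size b"
| "code_size (Cond cs r a b) = length cs + code_size a + code_size b + 2"
| "code_size (While cs r a) = length cs + code_size a + 2"

fun compile :: "nat \<Rightarrow> com \<Rightarrow> instr list" where
  "compile p (Block cs) = cs"
| "compile p (a ;; b) = compile p a @ compile (p + code_size a) b"
| "compile p (Cond cs r a b) =
     cs @ JumpZero r (p + length cs + code_size a + 2) # compile (p + length cs + 1) a @
     Jump (p + length cs + code_size a + 2 + code_size b) #
     compile (p + length cs + code_size a + 2) b"
| "compile p (While cs r a) =
     cs @ JumpZero r (p + length cs + code_size a + 2) # compile (p + length cs + 1) a @ [Jump p]"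

lemma length_compile [simp]: "length (compile p c) = code_size c"
  by (induction c arbitrary: p) auto

subsection \<open>Execution of compiled code\<close>

definition code_at :: "instr list \<Rightarrow> nat \<Rightarrow> instr list \<Rightarrow> bool" where
  "code_at P p cs \<longleftrightarrow> (\<exists>us vs. P = us @ cs @ vs \<and> length us = p)"

lemma code_at_self: "code_at P 0 P"
  by (auto simp: code_at_def)

lemma code_at_append:
  "code_at P p (as @ bs) \<longleftrightarrow> code_at P p as \<and> code_at P (p + length as) bs"
proof
  assume "code_at P p (as @ bs)"
  then obtain us vs where "P = us @ as @ bs @ vs" "length us = p"
    by (auto simp: code_at_def)
  then have "P = us @ as @ (bs @ vs)" "P = (us @ as) @ bs @ vs" "length (us @ as) = p + length as"
    by auto
  with \<open>length us = p\<close> show "code_at P p as \<and> code_at P (p + length as) bs"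
    unfolding code_at_def by blast
next
  assume both: "code_at P p as \<and> code_at P (p + length as) bs"
  then obtain us vs where us: "P = us @ as @ vs" "length us = p"
    by (auto simp: code_at_def)
  from both obtain us' vs' where us': "P = us' @ bs @ vs'" "length us' = p + length as"
    by (auto simp: code_at_def)
  have "us' = us @ as"
    using us us' by (metis append_eq_append_conv_if append_eq_conv_conj length_append append.assoc)
  with us us' show "code_at P p (as @ bs)"
    unfolding code_at_def by auto
qed

lemma code_at_Cons:
  "code_at P p (i # cs) \<longleftrightarrow> code_at P p [i] \<and> code_at P (p + 1) cs"
  using code_at_append[of P p "[i]" cs] by simp

lemma step_code_at: "code_at P p [i] \<Longrightarrow> step P (p, s) = exec_instr i (p, s)"
  by (auto simp: code_at_def step_def nth_append)

type_synonym regs = "nat \<Rightarrow> nat"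
type_synonym arrays = "nat \<Rightarrow> nat \<Rightarrow> nat"
type_synonym state = "regs \<times> arrays"
type_synonym assertion = "regs \<Rightarrow> arrays \<Rightarrow> bool"

fun exec_block :: "instr list \<Rightarrow> state \<Rightarrow> state" where
  "exec_block [] s = s"
| "exec_block (i # cs) s = exec_block cs (snd (exec_instr i (0, s)))"

lemma exec_straight_line:
  "straight_line i \<Longrightarrow> exec_instr i (p, s) = (p + 1, snd (exec_instr i (0, s)))"
  by (cases i; cases s) auto

lemma step_block:
  "code_at P p cs \<Longrightarrow> list_all straight_line cs \<Longrightarrow>
     (step P ^^ length cs) (p, s) = (p + length cs, exec_block cs s)"
proof (induction cs arbitrary: p s)
  case (Cons i cs)
  then have i: "code_at P p [i]" "straight_line i"
    and cs: "code_at P (p + 1) cs" "list_all straight_line cs"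
    using code_at_Cons[of P p i cs] by auto
  from i have "step P (p, s) = (p + 1, snd (exec_instr i (0, s)))"
    by (metis step_code_at exec_straight_line)
  then show ?case
    using Cons.IH[OF cs] by (simp del: funpow.simps add: funpow_Suc_right)
qed simp

definition runs :: "com \<Rightarrow> state \<Rightarrow> nat \<Rightarrow> state \<Rightarrow> bool" where
  "runs c s t s' \<longleftrightarrow>
     (\<forall>P p. code_at P p (compile p c) \<longrightarrow> (step P ^^ t) (p, s) = (p + code_size c, s'))"

lemma runs_Block: "list_all straight_line cs \<Longrightarrow> runs (Block cs) s (length cs) (exec_block cs s)"
  by (simp add: runs_def step_block)

lemma runs_Seq: "runs a s t s' \<Longrightarrow> runs b s' u s'' \<Longrightarrow> runs (a ;; b) s (t + u) s''"
  by (subst add.commute) (simp add: runs_def code_at_append funpow_add add.assoc)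

lemma code_at_CondD:
  assumes "code_at P p (compile p (Cond cs r a b))"
  shows "code_at P p cs"
    and "code_at P (p + length cs) [JumpZero r (p + length cs + code_size a + 2)]"
    and "code_at P (p + length cs + 1) (compile (p + length cs + 1) a)"
    and "code_at P (p + length cs + 1 + code_size a)
      [Jump (p + length cs + code_size a + 2 + code_size b)]"
    and "code_at P (p + length cs + code_size a + 2) (compile (p + length cs + code_size a + 2) b)"
proof -
  have "p + length cs + code_size a + 2 = p + length cs + 1 + code_size a + 1"
    by simp
  with assms show "code_at P p cs"
    "code_at P (p + length cs) [JumpZero r (p + length cs + code_size a + 2)]"
    "code_at P (p + length cs + 1) (compile (p + length cs + 1) a)"
    "code_at P (p + length cs + 1 + code_size a)
      [Jump (p + length cs + code_size a + 2 + code_size b)]"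
    "code_at P (p + length cs + code_size a + 2) (compile (p + length cs + code_size a + 2) b)"
    by (simp_all only: compile.simps code_at_append code_at_Cons[of _ _ _ "_ @ _"]
        code_at_Cons[of _ _ _ "compile _ _"] length_compile)
qed

lemma code_at_WhileD:
  assumes "code_at P p (compile p (While cs r a))"
  shows "code_at P p cs"
    and "code_at P (p + length cs) [JumpZero r (p + length cs + code_size a + 2)]"
    and "code_at P (p + length cs + 1) (compile (p + length cs + 1) a)"
    and "code_at P (p + length cs + 1 + code_size a) [Jump p]"
  using assms
  by (simp_all only: compile.simps code_at_append code_at_Cons[of _ _ _ "_ @ _"] length_compile)

lemma step_JumpZero:
  "code_at P p [JumpZero r l] \<Longrightarrow> step P (p, s) = (if fst s r = 0 then l else p + 1, s)"
  by (cases s) (simp add: step_code_at)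

lemma step_Jump: "code_at P p [Jump l] \<Longrightarrow> step P (p, s) = (l, s)"
  by (cases s) (simp add: step_code_at)

lemma runs_Cond_True:
  assumes "list_all straight_line cs" "fst (exec_block cs s) r \<noteq> 0" "runs a (exec_block cs s) t s'"
  shows "runs (Cond cs r a b) s (length cs + t + 2) s'"
  unfolding runs_def
proof (intro allI impI)
  fix P p
  assume "code_at P p (compile p (Cond cs r a b))"
  note code = code_at_CondD[OF this]
  have body: "(step P ^^ t) (p + length cs + 1, exec_block cs s) =
    (p + length cs + 1 + code_size a, s')"
    using assms(3) code(3) unfolding runs_def by blast
  have "(step P ^^ (length cs + t + 2)) (p, s) = (step P ^^ Suc (t + Suc (length cs))) (p, s)"
    by (simp add: ac_simps)
  also have "\<dots> = (p + length cs + code_size a + 2 + code_size b, s')"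
    using assms(2)
    by (simp only: funpow_add funpow.simps o_apply step_block[OF code(1) assms(1)]
        step_JumpZero[OF code(2)] body step_Jump[OF code(4)] if_False)
  finally show "(step P ^^ (length cs + t + 2)) (p, s) = (p + code_size (Cond cs r a b), s')"
    by (simp add: ac_simps)
qed

lemma runs_Cond_False:
  assumes "list_all straight_line cs" "fst (exec_block cs s) r = 0" "runs b (exec_block cs s) t s'"
  shows "runs (Cond cs r a b) s (length cs + t + 1) s'"
  unfolding runs_def
proof (intro allI impI)
  fix P p
  assume "code_at P p (compile p (Cond cs r a b))"
  note code = code_at_CondD[OF this]
  have body: "(step P ^^ t) (p + length cs + code_size a + 2, exec_block cs s)
      = (p + length cs + code_size a + 2 + code_size b, s')"
    using assms(3) code(5) unfolding runs_def by blast
  have "(step P ^^ (length cs + t + 1)) (p, s) = (step P ^^ (t + Suc (length cs))) (p, s)"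
    by (simp add: ac_simps)
  also have "\<dots> = (p + length cs + code_size a + 2 + code_size b, s')"
    using assms(2)
    by (simp only: funpow_add funpow.simps o_apply step_block[OF code(1) assms(1)]
        step_JumpZero[OF code(2)] body refl if_True)
  finally show "(step P ^^ (length cs + t + 1)) (p, s) = (p + code_size (Cond cs r a b), s')"
    by (simp add: ac_simps)
qed

lemma runs_While_exit:
  assumes "list_all straight_line cs" "fst (exec_block cs s) r = 0"
  shows "runs (While cs r a) s (length cs + 1) (exec_block cs s)"
  unfolding runs_def
proof (intro allI impI)
  fix P p
  assume "code_at P p (compile p (While cs r a))"
  note code = code_at_WhileD[OF this]
  show "(step P ^^ (length cs + 1)) (p, s) = (p + code_size (While cs r a), exec_block cs s)"
    using assms(2) by (simp add: step_block[OF code(1) assms(1)] step_JumpZero[OF code(2)])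
qed

lemma runs_While_step:
  assumes "list_all straight_line cs" "fst (exec_block cs s) r \<noteq> 0" "runs a (exec_block cs s) t s'"
    and "runs (While cs r a) s' u s''"
  shows "runs (While cs r a) s (length cs + 2 + t + u) s''"
  unfolding runs_def
proof (intro allI impI)
  fix P p
  assume while: "code_at P p (compile p (While cs r a))"
  note code = code_at_WhileD[OF this]
  have body: "(step P ^^ t) (p + length cs + 1, exec_block cs s) =
    (p + length cs + 1 + code_size a, s')"
    using assms(3) code(3) unfolding runs_def by blast
  have rest: "(step P ^^ u) (p, s') = (p + code_size (While cs r a), s'')"
    using assms(4) while unfolding runs_def by blast
  have "(step P ^^ (length cs + 2 + t + u)) (p, s)
      = (step P ^^ (u + Suc (t + Suc (length cs)))) (p, s)"
    by (simp add: ac_simps)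
  also have "\<dots> = (p + code_size (While cs r a), s'')"
    using assms(2)
    by (simp only: funpow_add funpow.simps o_apply step_block[OF code(1) assms(1)]
        step_JumpZero[OF code(2)] body step_Jump[OF code(4)] rest if_False)
  finally show "(step P ^^ (length cs + 2 + t + u)) (p, s) = (p + code_size (While cs r a), s'')" .
qed

subsection \<open>Written registers and arrays\<close>

fun instr_regs :: "instr \<Rightarrow> nat set" where
  "instr_regs (Const r _) = {r}"
| "instr_regs (Copy r _) = {r}"
| "instr_regs (Add r _ _) = {r}"
| "instr_regs (Sub r _ _) = {r}"
| "instr_regs (Load r _ _) = {r}"
| "instr_regs _ = {}"

fun instr_arrays :: "instr \<Rightarrow> nat set" where
  "instr_arrays (Store a _ _) = {a}"
| "instr_arrays _ = {}"

fun written_by :: "(instr \<Rightarrow> nat set) \<Rightarrow> com \<Rightarrow> nat set" where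
  "written_by w (Block cs) = (\<Union>i\<in>set cs. w i)"
| "written_by w (a ;; b) = written_by w a \<union> written_by w b"
| "written_by w (Cond cs r a b) = (\<Union>i\<in>set cs. w i) \<union> written_by w a \<union> written_by w b"
| "written_by w (While cs r a) = (\<Union>i\<in>set cs. w i) \<union> written_by w a"

abbreviation written_regs :: "com \<Rightarrow> nat set" where
  "written_regs \<equiv> written_by instr_regs"

abbreviation written_arrays :: "com \<Rightarrow> nat set" where
  "written_arrays \<equiv> written_by instr_arrays"

definition frame :: "com \<Rightarrow> regs \<Rightarrow> arrays \<Rightarrow> assertion" where
  "frame c R M R' M' \<longleftrightarrow>
     (\<forall>r. r \<notin> written_regs c \<longrightarrow> R' r = R r) \<and> (\<forall>a. a \<notin> written_arrays c \<longrightarrow> M' a = M a)"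

lemma frame_refl: "frame c R M R M"
  by (simp add: frame_def)

lemma written_by_compile:
  "(\<And>l. w (Jump l) = {}) \<Longrightarrow> (\<And>r l. w (JumpZero r l) = {}) \<Longrightarrow>
     (\<Union>i\<in>set (compile p c). w i) = written_by w c"
  by (induction c arbitrary: p) auto

lemma exec_instr_frame:
  "exec_instr i (p, R, M) = (p', R', M') \<Longrightarrow>
     (\<forall>r. r \<notin> instr_regs i \<longrightarrow> R' r = R r) \<and> (\<forall>a. a \<notin> instr_arrays i \<longrightarrow> M' a = M a)"
  by (cases i) auto

lemma step_frame:
  assumes "step P (p, R, M) = (p', R', M')"
  shows "(\<forall>r. r \<notin> (\<Union>i\<in>set P. instr_regs i) \<longrightarrow> R' r = R r) \<and>
    (\<forall>a. a \<notin> (\<Union>i\<in>set P. instr_arrays i) \<longrightarrow> M' a = M a)"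
  using assms exec_instr_frame[of "P ! p" p R M p' R' M']
  by (fastforce simp: step_def split: if_splits)

lemma steps_frame:
  assumes "(step P ^^ t) (p, R, M) = (p', R', M')"
  shows "(\<forall>r. r \<notin> (\<Union>i\<in>set P. instr_regs i) \<longrightarrow> R' r = R r) \<and>
    (\<forall>a. a \<notin> (\<Union>i\<in>set P. instr_arrays i) \<longrightarrow> M' a = M a)"
  using assms
proof (induction t arbitrary: p' R' M')
  case (Suc t)
  obtain q S N where "(step P ^^ t) (p, R, M) = (q, S, N)"
    by (metis prod_cases3)
  with Suc step_frame[of P q S N p' R' M'] show ?case
    by simp
qed simp

lemma runs_frame:
  assumes "runs c (R, M) t (R', M')"
  shows "frame c R M R' M'"
proof -
  have "(step (compile 0 c) ^^ t) (0, R, M) = (0 + code_size c, R', M')"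
    using assms code_at_self unfolding runs_def by blast
  from steps_frame[OF this] show ?thesis
    by (simp only: frame_def written_by_compile instr_regs.simps instr_arrays.simps)
qed

subsection \<open>Weakest preconditions\<close>

definition wp :: "com \<Rightarrow> nat \<Rightarrow> assertion \<Rightarrow> assertion" where
  "wp c T Q R M \<longleftrightarrow> (\<exists>t R' M'. runs c (R, M) t (R', M') \<and> t \<le> T \<and> Q R' M')"

lemma wp_mono:
  "wp c T Q R M \<Longrightarrow> T \<le> T' \<Longrightarrow> (\<And>R' M'. Q R' M' \<Longrightarrow> frame c R M R' M' \<Longrightarrow> Q' R' M') \<Longrightarrow>
     wp c T' Q' R M"
  unfolding wp_def by (meson order_trans runs_frame)

lemma wp_Block:
  assumes "list_all straight_line cs" "length cs \<le> T" "case_prod Q (exec_block cs (R, M))"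
  shows "wp (Block cs) T Q R M"
  unfolding wp_def using runs_Block[OF assms(1)] assms(2,3) by (metis case_prod_beta prod.collapse)

lemma wp_Seq:
  assumes "wp a T Q R M" "T + T' \<le> T''"
    and "\<And>R' M'. Q R' M' \<Longrightarrow> frame a R M R' M' \<Longrightarrow> wp b T' Q' R' M'"
  shows "wp (a ;; b) T'' Q' R M"
proof -
  obtain t R' M' where a: "runs a (R, M) t (R', M')" "t \<le> T" "Q R' M'"
    using assms(1) by (auto simp: wp_def)
  then obtain u R'' M'' where "runs b (R', M') u (R'', M'')" "u \<le> T'" "Q' R'' M''"
    using assms(3)[OF a(3) runs_frame[OF a(1)]] by (auto simp: wp_def)
  with a runs_Seq assms(2) show ?thesis
    unfolding wp_def by (meson add_mono order_trans)
qed

lemma wp_Block_Seq: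
  assumes "list_all straight_line cs" "length cs + T \<le> T'"
    "case_prod (wp b T Q) (exec_block cs (R, M))"
  shows "wp (Block cs ;; b) T' Q R M"
  by (rule wp_Seq[where Q = "\<lambda>R' M'. exec_block cs (R, M) = (R', M')" and T = "length cs"])
    (use assms in \<open>auto intro!: wp_Block\<close>)

lemma wp_Cond:
  assumes "list_all straight_line cs" "length cs + 2 \<le> T"
    and "case exec_block cs (R, M) of (R', M') \<Rightarrow>
      (R' r \<noteq> 0 \<longrightarrow> wp a (T - (length cs + 2)) Q R' M') \<and>
      (R' r = 0 \<longrightarrow> wp b (T - (length cs + 2)) Q R' M')"
  shows "wp (Cond cs r a b) T Q R M"
proof -
  obtain R' M' where test: "exec_block cs (R, M) = (R', M')"
    by (cases "exec_block cs (R, M)")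
  show ?thesis
  proof (cases "R' r = 0")
    case True
    then obtain t R'' M'' where "runs b (R', M') t (R'', M'')" "t \<le> T - (length cs + 2)" "Q R'' M''"
      using assms(3) by (auto simp: test wp_def)
    with runs_Cond_False[OF assms(1), of "(R, M)" r b t "(R'', M'')" a] True assms(2)
    show ?thesis
      unfolding wp_def
      by (intro exI[of _ "length cs + t + 1"] exI[of _ R''] exI[of _ M'']) (simp add: test)
  next
    case False
    then obtain t R'' M'' where "runs a (R', M') t (R'', M'')" "t \<le> T - (length cs + 2)" "Q R'' M''"
      using assms(3) by (auto simp: test wp_def)
    with runs_Cond_True[OF assms(1), of "(R, M)" r a t "(R'', M'')" b] False assms(2)
    show ?thesis
      unfolding wp_def
      by (intro exI[of _ "length cs + t + 2"] exI[of _ R''] exI[of _ M'']) (simp add: test)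
  qed
qed

text \<open>The index of the invariant bounds the number of instructions still to be executed before the
  final test.\<close>
lemma wp_While:
  assumes straight: "list_all straight_line cs"
    and inv: "Inv m R M" and time: "m + length cs + 1 \<le> T"
    and body: "\<And>m R' M'. Inv m R' M' \<Longrightarrow> frame (While cs r b) R M R' M' \<Longrightarrow>
      case exec_block cs (R', M') of (R'', M'') \<Rightarrow>
        (R'' r = 0 \<longrightarrow> Q R'' M'') \<and>
        (R'' r \<noteq> 0 \<longrightarrow> (\<exists>T m'. length cs + 2 + T + m' \<le> m \<and> wp b T (Inv m') R'' M''))"
  shows "wp (While cs r b) T Q R M"
proof -
  have "wp (While cs r b) (m + length cs + 1) Q R' M'"
    if "Inv m R' M'" "frame (While cs r b) R M R' M'" for R' M'
    using that
  proof (induction m arbitrary: R' M' rule: less_induct)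
    case (less m)
    obtain R1 M1 where test: "exec_block cs (R', M') = (R1, M1)"
      by (cases "exec_block cs (R', M')")
    show ?case
    proof (cases "R1 r = 0")
      case True
      then have "runs (While cs r b) (R', M') (length cs + 1) (R1, M1)" "Q R1 M1"
        using runs_While_exit[OF straight, of "(R', M')"] body[OF less.prems] by (auto simp: test)
      then show ?thesis
        unfolding wp_def by (intro exI[of _ "length cs + 1"]) auto
    next
      case False
      then obtain T m' where T: "length cs + 2 + T + m' \<le> m" "wp b T (Inv m') R1 M1"
        using body[OF less.prems] by (auto simp: test)
      then obtain t R2 M2 where t: "runs b (R1, M1) t (R2, M2)" "t \<le> T" "Inv m' R2 M2"
        by (auto simp: wp_def)
      have "frame (Block cs) R' M' R1 M1" "frame b R1 M1 R2 M2"
        using runs_frame runs_Block[OF straight] t(1) unfolding test[symmetric] by (metis test)+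
      then have "frame (While cs r b) R M R2 M2"
        using less.prems(2) by (auto simp: frame_def)
      with less.IH[of m'] T(1) t(3) have "wp (While cs r b) (m' + length cs + 1) Q R2 M2"
        by simp
      then obtain u R3 M3 where u: "runs (While cs r b) (R2, M2) u (R3, M3)"
          "u \<le> m' + length cs + 1" "Q R3 M3"
        by (auto simp: wp_def)
      have "runs (While cs r b) (R', M') (length cs + 2 + t + u) (R3, M3)"
        using runs_While_step[OF straight _ _ u(1), of "(R', M')" t] False t(1) by (simp add: test)
      with T(1) t(2) u(2,3) show ?thesis
        unfolding wp_def by (intro exI[of _ "length cs + 2 + t + u"]) auto
    qed
  qed
  from wp_mono[OF this[OF inv frame_refl] time] show ?thesis
    by blast
qed

lemma wp_foreach:
  assumes straight: "list_all straight_line cs"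
    and init: "Inv [] R M"
    and time: "(\<Sum>x\<leftarrow>xs. c x + length cs + 2) + length cs + 1 \<le> T"
    and body: "\<And>zs y ys R' M'. xs = zs @ y # ys \<Longrightarrow> Inv zs R' M' \<Longrightarrow>
      frame (While cs r b) R M R' M' \<Longrightarrow>
      case exec_block cs (R', M') of (R'', M'') \<Rightarrow> R'' r \<noteq> 0 \<and> wp b (c y) (Inv (zs @ [y])) R'' M''"
    and exit: "\<And>R' M'. Inv xs R' M' \<Longrightarrow> frame (While cs r b) R M R' M' \<Longrightarrow>
      case exec_block cs (R', M') of (R'', M'') \<Rightarrow> R'' r = 0 \<and> Q R'' M''"
  shows "wp (While cs r b) T Q R M"
proof (rule wp_While[where Inv = "\<lambda>m R' M'. \<exists>zs ys. xs = zs @ ys \<and> Inv zs R' M' \<and>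
      m = (\<Sum>x\<leftarrow>ys. c x + length cs + 2)"])
  show "\<exists>zs ys. xs = zs @ ys \<and> Inv zs R M \<and>
      (\<Sum>x\<leftarrow>xs. c x + length cs + 2) = (\<Sum>x\<leftarrow>ys. c x + length cs + 2)"
    using init by (intro exI[of _ "[]"] exI[of _ xs]) simp
next
  let ?rest = "\<lambda>ys. \<Sum>x\<leftarrow>ys. c x + length cs + 2"
  fix m R' M'
  assume "\<exists>zs ys. xs = zs @ ys \<and> Inv zs R' M' \<and> m = ?rest ys"
    and frame: "frame (While cs r b) R M R' M'"
  then obtain zs ys where xs: "xs = zs @ ys" and inv: "Inv zs R' M'" and m: "m = ?rest ys"
    by blast
  show "case exec_block cs (R', M') of (R'', M'') \<Rightarrow>
      (R'' r = 0 \<longrightarrow> Q R'' M'') \<and>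
      (R'' r \<noteq> 0 \<longrightarrow> (\<exists>T m'. length cs + 2 + T + m' \<le> m \<and>
        wp b T (\<lambda>R' M'. \<exists>zs ys. xs = zs @ ys \<and> Inv zs R' M' \<and> m' = ?rest ys) R'' M''))"
  proof (cases ys)
    case Nil
    then show ?thesis
      using exit[of R' M'] inv frame xs by auto
  next
    case (Cons y ys')
    obtain R1 M1 where test: "exec_block cs (R', M') = (R1, M1)"
      by (cases "exec_block cs (R', M')")
    have "R1 r \<noteq> 0" "wp b (c y) (Inv (zs @ [y])) R1 M1"
      using body[OF _ inv frame, of y ys'] xs Cons by (auto simp: test)
    moreover from this(2) have "wp b (c y) (\<lambda>R' M'. \<exists>us vs. xs = us @ vs \<and> Inv us R' M' \<and>
        ?rest ys' = ?rest vs) R1 M1"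
      by (rule wp_mono, simp) (intro exI[of _ "zs @ [y]"] exI[of _ ys'], simp add: xs Cons)
    ultimately show ?thesis
      unfolding test m Cons prod.case
      by (intro conjI impI exI[of _ "c y"] exI[of _ "?rest ys'"]) simp_all
  qed
qed (use straight time in auto)

lemma wp_decides:
  assumes "wp c T Q R M" "\<And>R' M'. Q R' M' \<Longrightarrow> R' 0 = of_bool b"
  shows "\<exists>t\<le>T. decides_within (compile 0 c) R M t b"
proof -
  obtain t R' M' where t: "runs c (R, M) t (R', M')" "t \<le> T" "Q R' M'"
    using assms(1) by (auto simp: wp_def)
  then have "(step (compile 0 c) ^^ t) (0, R, M) = (code_size c, R', M')"
    using code_at_self unfolding runs_def by fastforce
  with t assms(2) show ?thesis
    by (intro exI[of _ t]) (simp add: decides_within_def)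
qed

section \<open>Improving swaps as independent sets\<close>

lemma card_neighbours_le_max_degree:
  assumes "finite V" "v \<in> V"
  shows "card (neighbours E v) \<le> max_degree V E"
  unfolding max_degree_def using assms by (intro Max_ge) auto

locale covered_graph =
  fixes V :: "'v set" and E :: "'v set set" and S :: "'v set"
  assumes simple: "simple_graph V E" and cover: "vertex_cover V E S"
begin

abbreviation nb :: "'v \<Rightarrow> 'v set" where "nb \<equiv> neighbours E"

definition outer :: "'v set \<Rightarrow> 'v set" where
  "outer X = (\<Union>x\<in>X. nb x) - S"

definition closed_nbhd :: "'v set \<Rightarrow> 'v set" where
  "closed_nbhd X = X \<union> (\<Union>x\<in>X. nb x)"

definition independent :: "'v set \<Rightarrow> bool" where
  "independent X \<longleftrightarrow> (\<forall>x\<in>X. nb x \<inter> X = {})"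

definition gap :: "'v set \<Rightarrow> int" where
  "gap X = int (card X) - int (card (outer X))"

definition gain :: "'v set \<Rightarrow> 'v set \<Rightarrow> int" where
  "gain I X = int (card X) - int (card (outer X - outer I))"

lemma finite_V: "finite V"
  using simple by (simp add: simple_graph_def)

lemma S_subset: "S \<subseteq> V"
  using cover by (simp add: vertex_cover_def)

lemma finite_subset_S: "X \<subseteq> S \<Longrightarrow> finite X"
  using S_subset finite_V by (meson finite_subset)

lemma nb_sym: "u \<in> nb v \<longleftrightarrow> v \<in> nb u"
  by (simp add: neighbours_def insert_commute)

lemma nb_in_V:
  assumes "u \<in> nb v"
  shows "u \<in> V"
  using assms simple unfolding simple_graph_def neighbours_def by blast

lemma not_nb_self: "v \<notin> nb v"
  using simple unfolding simple_graph_def neighbours_def by fastforce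

lemma nb_cover: "u \<in> nb v \<Longrightarrow> u \<in> S \<or> v \<in> S"
  using cover unfolding vertex_cover_def neighbours_def by fastforce

lemma edge_cases:
  assumes "e \<in> E"
  obtains u v where "e = {u, v}" "u \<in> nb v" "v \<in> nb u"
proof -
  have "card e = 2"
    using assms simple by (simp add: simple_graph_def)
  then obtain u v where "e = {u, v}"
    by (meson card_2_iff)
  with assms show thesis
    by (intro that[of u v]) (simp_all add: neighbours_def insert_commute)
qed

lemma max_degree_less_card: "V \<noteq> {} \<Longrightarrow> max_degree V E < card V"
proof -
  assume "V \<noteq> {}"
  have "card (nb v) < card V" if "v \<in> V" for v
    using that nb_in_V not_nb_self finite_V by (intro psubset_card_mono) auto
  then show ?thesis
    unfolding max_degree_def using finite_V \<open>V \<noteq> {}\<close> by (auto simp: Max_less_iff card_gt_0_iff)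
qed

lemma outer_empty: "outer {} = {}"
  by (simp add: outer_def)

lemma outer_Un: "outer (X \<union> Y) = outer X \<union> outer Y"
  by (auto simp: outer_def)

lemma outer_insert: "outer (insert v X) = outer X \<union> (nb v - S)"
  by (auto simp: outer_def)

lemma outer_mono: "X \<subseteq> Y \<Longrightarrow> outer X \<subseteq> outer Y"
  by (auto simp: outer_def)

lemma outer_subset_V: "outer X \<subseteq> V"
  using nb_in_V by (auto simp: outer_def)

lemma finite_outer: "finite (outer X)"
  using outer_subset_V finite_V finite_subset by blast

lemma card_outer_mono: "X \<subseteq> Y \<Longrightarrow> card (outer X) \<le> card (outer Y)"
  by (intro card_mono finite_outer outer_mono)

lemma closed_nbhd_subset_V: "X \<subseteq> V \<Longrightarrow> closed_nbhd X \<subseteq> V"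
  using nb_in_V by (auto simp: closed_nbhd_def)

lemma independent_subset: "independent X \<Longrightarrow> Y \<subseteq> X \<Longrightarrow> independent Y"
  unfolding independent_def by blast

lemma independent_Un:
  assumes "independent X" "independent Y" "X \<inter> closed_nbhd Y = {}"
  shows "independent (X \<union> Y)"
  using assms nb_sym unfolding independent_def closed_nbhd_def by blast

lemma independent_exchange:
  assumes "independent J" "I \<subseteq> J" "independent (I \<union> X)" "closed_nbhd X \<inter> (J - I) = {}"
  shows "independent (J \<union> X)"
proof -
  have "closed_nbhd I \<inter> (J - I) = {}"
    using assms(1,2) unfolding independent_def closed_nbhd_def by blast
  then have "(J - I) \<inter> closed_nbhd (I \<union> X) = {}"
    using assms(4) by (auto simp: closed_nbhd_def)
  then have "independent ((J - I) \<union> (I \<union> X))"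
    by (rule independent_Un[OF independent_subset[OF assms(1) Diff_subset] assms(3)])
  moreover have "(J - I) \<union> (I \<union> X) = J \<union> X"
    using assms(2) by blast
  ultimately show ?thesis
    by simp
qed

lemma independent_insert: "independent (insert v X) \<longleftrightarrow> independent X \<and> nb v \<inter> X = {}"
  using nb_sym not_nb_self unfolding independent_def by auto

lemma gap_empty: "gap {} = 0"
  by (simp add: gap_def outer_empty)

lemma gap_Un:
  assumes "finite I" "finite X" "I \<inter> X = {}"
  shows "gap (I \<union> X) = gap I + gain I X"
proof -
  have "outer (I \<union> X) = outer I \<union> (outer X - outer I)"
    by (auto simp: outer_Un)
  then have "card (outer (I \<union> X)) = card (outer I) + card (outer X - outer I)"
    using card_Un_disjoint[of "outer I" "outer X - outer I"] by (simp add: finite_outer)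
  then show ?thesis
    using assms by (simp add: gap_def gain_def card_Un_disjoint)
qed

lemma gap_insert_le: "gap (insert v X) \<le> gap X + 1"
proof -
  have "card (insert v X) \<le> card X + 1"
    by (cases "finite X") (simp_all add: card_insert_if)
  then show ?thesis
    using card_outer_mono[OF subset_insertI, of X v] by (simp add: gap_def)
qed

lemma gain_antimono: "I \<subseteq> J \<Longrightarrow> gain I X \<le> gain J X"
  using card_mono[of "outer X - outer I" "outer X - outer J"] outer_mono[of I J] finite_outer[of X]
  by (auto simp: gain_def)

definition improving_set :: "nat \<Rightarrow> nat \<Rightarrow> 'v set \<Rightarrow> bool" where
  "improving_set a d J \<longleftrightarrow> J \<subseteq> S \<and> independent J \<and> card J \<le> a \<and> int d \<le> gap J"

text \<open>Dropping vertices from the swap until it is exactly \<open>d\<close>-improving bounds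
  \<open>card (W \<inter> S)\<close> by \<open>(k + d) div 2\<close>, and this bound in turn implies \<open>card W \<le> k\<close>.\<close>
lemma improving_set_of_swap:
  assumes "is_swap V k W" "valid_swap V E S W" "improving_swap d S W"
  obtains J where "improving_set ((k + d) div 2) d J"
proof -
  have W: "W \<subseteq> V" "card W \<le> k" "vertex_cover V E (sym_diff S W)"
    and improving: "d + card (W - S) \<le> card (W \<inter> S)"
    using assms by (auto simp: is_swap_def valid_swap_def improving_swap_def)
  have "finite W"
    using W(1) finite_V finite_subset by blast
  obtain J where J: "J \<subseteq> W \<inter> S" "card J = d + card (W - S)"
    using improving by (meson obtain_subset_with_card_n)
  have covered: "u \<in> sym_diff S W \<or> v \<in> sym_diff S W" if "u \<in> nb v" for u v
    using W(3) that unfolding vertex_cover_def neighbours_def by fastforce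
  have "outer J \<subseteq> W - S"
    using covered J(1) unfolding outer_def by blast
  then have "card (outer J) \<le> card (W - S)"
    using \<open>finite W\<close> by (intro card_mono) auto
  moreover have "independent J"
    unfolding independent_def using covered J(1) by blast
  moreover have "card W = card (W \<inter> S) + card (W - S)"
    using card_Un_disjoint[of "W \<inter> S" "W - S"] \<open>finite W\<close> by (auto simp: Int_Diff_Un)
  then have "card J \<le> (k + d) div 2"
    using W(2) improving J(2) by simp
  ultimately show thesis
    using J by (intro that[of J]) (auto simp: improving_set_def gap_def)
qed

lemma vertex_cover_exchange_outer:
  assumes "J \<subseteq> S" "independent J"
  shows "vertex_cover V E (sym_diff S (J \<union> outer J))"
  unfolding vertex_cover_def
proof (intro conjI ballI)
  show "sym_diff S (J \<union> outer J) \<subseteq> V"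
    using assms(1) S_subset outer_subset_V by blast
  fix e assume "e \<in> E"
  then obtain u v where e: "e = {u, v}" "u \<in> nb v" "v \<in> nb u"
    by (rule edge_cases)
  have "y \<in> sym_diff S (J \<union> outer J)" if "x \<in> J" "y \<in> nb x" for x y
    using that assms(2) unfolding independent_def outer_def by auto
  moreover have "x \<in> sym_diff S (J \<union> outer J)" if "x \<in> S" "x \<notin> J" for x
    using that by (auto simp: outer_def)
  ultimately have "u \<in> sym_diff S (J \<union> outer J) \<or> v \<in> sym_diff S (J \<union> outer J)"
    using e nb_cover[of u v] by metis
  then show "e \<inter> sym_diff S (J \<union> outer J) \<noteq> {}"
    using e(1) by auto
qed

lemma swap_of_improving_set:
  assumes "improving_set ((k + d) div 2) d J"
  shows "\<exists>W. is_swap V k W \<and> valid_swap V E S W \<and> improving_swap d S W"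
proof (intro exI conjI)
  have J: "J \<subseteq> S" "independent J" "card J \<le> (k + d) div 2" "int d \<le> gap J"
    using assms by (auto simp: improving_set_def)
  have parts: "(J \<union> outer J) \<inter> S = J" "(J \<union> outer J) - S = outer J"
    using J(1) by (auto simp: outer_def)
  have "card (J \<union> outer J) \<le> k"
    using card_Un_le[of J "outer J"] J(3,4) by (simp add: gap_def)
  then show "is_swap V k (J \<union> outer J)"
    using J(1) S_subset outer_subset_V by (auto simp: is_swap_def)
  show "valid_swap V E S (J \<union> outer J)"
    using vertex_cover_exchange_outer J(1,2) by (simp add: valid_swap_def)
  show "improving_swap d S (J \<union> outer J)"
    using J(4) by (simp add: improving_swap_def parts gap_def)
qed

lemma gap_ls_vc_iff_improving_set:
  "gap_ls_vc V E S k d \<longleftrightarrow> (\<exists>J. improving_set ((k + d) div 2) d J)"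
  using improving_set_of_swap swap_of_improving_set unfolding gap_ls_vc_def by metis

end

section \<open>The exchange argument\<close>

locale solution_search = covered_graph V E S
  for V :: "'v set" and E S +
  fixes B d :: nat
begin

definition A :: nat where "A = B + d"

abbreviation solution :: "'v set \<Rightarrow> bool" where
  "solution \<equiv> improving_set A d"

definition feasible :: "'v set \<Rightarrow> bool" where
  "feasible X \<longleftrightarrow> X \<subseteq> S \<and> independent X \<and> card (outer X) \<le> B"

lemma solutionD:
  assumes "solution J"
  shows "J \<subseteq> S" "finite J" "independent J" "card J \<le> A" "int d \<le> gap J"
  using assms finite_subset_S by (auto simp: improving_set_def)

lemma feasible_subset: "feasible Y \<Longrightarrow> X \<subseteq> Y \<Longrightarrow> feasible X"
  using independent_subset card_outer_mono[of X Y] by (auto simp: feasible_def)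

lemma solution_feasible: "solution J \<Longrightarrow> feasible J"
  by (auto simp: improving_set_def feasible_def gap_def A_def)

lemma feasible_finite: "feasible X \<Longrightarrow> finite X"
  using finite_subset_S by (auto simp: feasible_def)

inductive extends :: "'v set \<Rightarrow> 'v set \<Rightarrow> bool" where
  "v \<notin> X \<Longrightarrow> nb v \<inter> outer X \<noteq> {} \<Longrightarrow> extends X (insert v X)"

abbreviation grows :: "'v set \<Rightarrow> 'v set \<Rightarrow> bool" where
  "grows \<equiv> extends\<^sup>*\<^sup>*"

lemma grows_subset: "grows X Y \<Longrightarrow> X \<subseteq> Y"
  by (induction rule: rtranclp_induct) (auto elim: extends.cases)

text \<open>A node of the search tree is a set \<open>I\<close> labelled with the sum \<open>h\<close> of the gaps guessed so far:
  \<open>K\<close> completes the components of \<open>J\<close> that \<open>I\<close> has begun, and these must have paid for the guesses.\<close>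
definition promising :: "'v set \<Rightarrow> nat \<Rightarrow> bool" where
  "promising I h \<longleftrightarrow> (\<exists>K J. grows I K \<and> K \<subseteq> J \<and> solution J \<and> int h \<le> gap K)"

lemma promising_empty_iff: "promising {} 0 \<longleftrightarrow> (\<exists>J. solution J)"
proof
  assume "\<exists>J. solution J"
  then obtain J where "solution J" ..
  then show "promising {} 0"
    unfolding promising_def by (intro exI[of _ "{}"] exI[of _ J]) (simp add: gap_empty)
qed (auto simp: promising_def)

lemma promising_feasible: "promising I h \<Longrightarrow> feasible I"
  using grows_subset solution_feasible feasible_subset
  unfolding promising_def by (meson subset_trans)

lemma promising_card_less:
  assumes "promising I h" "gap I < int d"
  shows "card I < A"
proof -
  obtain J where J: "I \<subseteq> J" "solution J"
    using assms(1) grows_subset unfolding promising_def by blast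
  then have "I \<noteq> J"
    using assms(2) solutionD(5) by force
  then have "card I < card J"
    using J solutionD(2) by (intro psubset_card_mono) auto
  then show ?thesis
    using solutionD(4)[OF J(2)] by simp
qed

lemma promising_cases:
  assumes "promising I h"
  obtains (grow) v where "v \<notin> I" "nb v \<inter> outer I \<noteq> {}" "promising (insert v I) h"
  | (start) J where "solution J" "I \<subseteq> J" "int h \<le> gap I"
proof -
  obtain K J where K: "grows I K" "K \<subseteq> J" "solution J" "int h \<le> gap K"
    using assms by (auto simp: promising_def)
  from K(1) show thesis
  proof (cases rule: converse_rtranclpE)
    case base
    with K show ?thesis
      using start by blast
  next
    case (step Y)
    from step(1) obtain v where "Y = insert v I" "v \<notin> I" "nb v \<inter> outer I \<noteq> {}"
      by cases
    with step(2) K show ?thesis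
      using grow unfolding promising_def by blast
  qed
qed

subsection \<open>Components of a solution\<close>

definition linked :: "'v set \<Rightarrow> 'v set \<Rightarrow> 'v \<Rightarrow> 'v \<Rightarrow> bool" where
  "linked I J x y \<longleftrightarrow> x \<in> J - I \<and> y \<in> J - I \<and> nb x \<inter> nb y - S - outer I \<noteq> {}"

definition component :: "'v set \<Rightarrow> 'v set \<Rightarrow> 'v \<Rightarrow> 'v set" where
  "component I J x = {y. (linked I J)\<^sup>*\<^sup>* x y}"

lemma self_in_component: "x \<in> component I J x"
  by (simp add: component_def)

lemma component_subset:
  assumes "x \<in> J - I"
  shows "component I J x \<subseteq> J - I"
proof
  fix y assume "y \<in> component I J x"
  then have "(linked I J)\<^sup>*\<^sup>* x y"
    by (simp add: component_def)
  then show "y \<in> J - I"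
    by (cases rule: rtranclp.cases) (use assms in \<open>auto simp: linked_def\<close>)
qed

lemma outer_component:
  assumes "x \<in> J - I"
  shows "outer (component I J x) \<inter> outer (J - component I J x) \<subseteq> outer I"
proof (rule ccontr)
  assume "\<not> ?thesis"
  then obtain u where "u \<in> outer (component I J x)" "u \<in> outer (J - component I J x)"
      and u: "u \<notin> outer I" "u \<notin> S"
    by (auto simp: outer_def)
  then obtain y z where y: "y \<in> component I J x" "u \<in> nb y"
      and z: "z \<in> J - component I J x" "u \<in> nb z"
    unfolding outer_def by blast
  have "z \<notin> I"
    using u z(2) by (auto simp: outer_def)
  then have "linked I J y z"
    using u y z component_subset[OF assms] unfolding linked_def by blast
  then have "z \<in> component I J x"
    using y(1) unfolding component_def by (auto intro: rtranclp.rtrancl_into_rtrancl)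
  with z(1) show False
    by blast
qed

lemma gap_remove_component:
  assumes "finite J" "I \<subseteq> J" "x \<in> J - I"
  shows "gap J = gap (J - component I J x) + gain I (component I J x)"
proof -
  let ?C = "component I J x"
  have C: "?C \<subseteq> J - I"
    using component_subset[OF assms(3)] .
  have "outer ?C - outer (J - ?C) = outer ?C - outer I"
    using outer_component[OF assms(3)] outer_mono[of I "J - ?C"] C assms(2) by blast
  then have "gain (J - ?C) ?C = gain I ?C"
    by (simp add: gain_def)
  moreover have "gap ((J - ?C) \<union> ?C) = gap (J - ?C) + gain (J - ?C) ?C"
    by (rule gap_Un) (use assms(1) C in \<open>auto intro: finite_subset\<close>)
  moreover have "(J - ?C) \<union> ?C = J"
    using C by blast
  ultimately show ?thesis
    by simp
qed

lemma obtain_maximal_growth: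
  assumes "finite (W - X)" "X \<subseteq> W"
  obtains K where "grows X K" "K \<subseteq> W" "\<And>z. z \<in> W - K \<Longrightarrow> nb z \<inter> outer K = {}"
proof -
  let ?P = "\<lambda>K. grows X K \<and> K \<subseteq> W"
  have start: "?P X"
    using assms(2) by simp
  have "\<forall>K. ?P K \<longrightarrow> card (K - X) < Suc (card (W - X))"
    using assms(1) by (intro allI impI le_imp_less_Suc card_mono) auto
  from ex_has_greatest_nat[OF start this]
  obtain K where K: "?P K" and maximal: "\<And>L. ?P L \<Longrightarrow> card (L - X) \<le> card (K - X)"
    by metis
  have "nb z \<inter> outer K = {}" if z: "z \<in> W - K" for z
  proof (rule ccontr)
    assume "nb z \<inter> outer K \<noteq> {}"
    with z K have "?P (insert z K)"
      by (auto intro: rtranclp.rtrancl_into_rtrancl extends.intros)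
    moreover have "insert z K - X = insert z (K - X)" "finite (K - X)"
      using z K grows_subset assms(1) finite_subset[of "K - X" "W - X"] by auto
    ultimately show False
      using maximal[of "insert z K"] z by simp
  qed
  with K that show thesis
    by blast
qed

lemma grows_component:
  assumes "finite J" "x \<in> J - I"
  shows "grows (insert x I) (I \<union> component I J x)"
proof -
  let ?C = "component I J x"
  have "finite (I \<union> ?C - insert x I)"
    using component_subset[OF assms(2)] assms(1) by (auto intro: finite_subset)
  then obtain K where K: "grows (insert x I) K" "K \<subseteq> I \<union> ?C"
    and maximal: "\<And>z. z \<in> I \<union> ?C - K \<Longrightarrow> nb z \<inter> outer K = {}"
    using self_in_component by (elim obtain_maximal_growth) auto
  have "y \<in> K" if "(linked I J)\<^sup>*\<^sup>* x y" for y
    using that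
  proof (induction rule: rtranclp_induct)
    case base
    then show ?case
      using K(1) grows_subset by blast
  next
    case (step y z)
    have "nb z \<inter> outer K \<noteq> {}"
      using step.hyps(2) step.IH unfolding linked_def outer_def by blast
    moreover have "z \<in> ?C"
      using step.hyps by (auto simp: component_def)
    ultimately show ?case
      using maximal[of z] by blast
  qed
  then have "K = I \<union> ?C"
    using K grows_subset[OF K(1)] by (auto simp: component_def)
  with K(1) show ?thesis
    by simp
qed

lemma promising_component:
  assumes "solution J" "I \<subseteq> J" "v \<in> J - I" "int h \<le> gap I + gain I (component I J v)"
  shows "promising (insert v I) h"
proof -
  have C: "component I J v \<subseteq> J - I"
    by (rule component_subset[OF assms(3)])
  have "gap (I \<union> component I J v) = gap I + gain I (component I J v)"
    by (rule gap_Un) (use C assms(2) solutionD(2)[OF assms(1)] in \<open>auto intro: finite_subset\<close>)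
  with assms grows_component[OF solutionD(2)[OF assms(1)] assms(3)] C show ?thesis
    unfolding promising_def by (intro exI[of _ "I \<union> component I J v"] exI[of _ J]) auto
qed

lemma gain_component_pos:
  assumes J: "solution J" "I \<subseteq> J" "x \<in> J - I"
    and minimal: "\<And>J'. solution J' \<Longrightarrow> I \<subseteq> J' \<Longrightarrow> card J \<le> card J'"
  shows "0 < gain I (component I J x)"
proof (rule ccontr)
  let ?C = "component I J x"
  assume "\<not> ?thesis"
  then have "gap J \<le> gap (J - ?C)"
    using gap_remove_component[OF solutionD(2)] J by simp
  moreover have "card (J - ?C) < card J"
    using J self_in_component[of x I J] solutionD(2) by (intro psubset_card_mono) auto
  ultimately have "solution (J - ?C)"
    using solutionD[OF J(1)] independent_subset[of J "J - ?C"] by (auto simp: improving_set_def)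
  moreover have "I \<subseteq> J - ?C"
    using component_subset J by blast
  ultimately show False
    using minimal \<open>card (J - ?C) < card J\<close> by fastforce
qed

subsection \<open>Exchanging a component\<close>

lemma solution_exchange_component:
  assumes J: "solution J" "I \<subseteq> J" "x \<in> J - I"
    and X: "feasible (I \<union> X)" "I \<inter> X = {}" "closed_nbhd X \<inter> (J - I) = {}"
    and card: "card X \<le> card (component I J x)"
    and gain: "gain I (component I J x) \<le> gain I X"
  shows "solution (J - component I J x \<union> X)"
proof -
  let ?C = "component I J x"
  note fin = solutionD(2)[OF J(1)]
  have C: "?C \<subseteq> J - I"
    using component_subset[OF J(3)] .
  have "gap J = gap (J - ?C) + gain I ?C"
    by (rule gap_remove_component[OF fin J(2,3)])
  also have "\<dots> \<le> gap (J - ?C) + gain (J - ?C) X"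
    using gain gain_antimono[of I "J - ?C" X] C J(2) by force
  also have "\<dots> = gap (J - ?C \<union> X)"
    by (rule gap_Un[symmetric])
      (use fin X feasible_finite in \<open>auto simp: closed_nbhd_def\<close>)
  finally have "int d \<le> gap (J - ?C \<union> X)"
    using solutionD(5)[OF J(1)] by simp
  moreover have "independent (J - ?C \<union> X)"
    by (rule independent_subset[OF independent_exchange[OF solutionD(3)[OF J(1)] J(2) _ X(3)]])
      (use X(1) in \<open>auto simp: feasible_def\<close>)
  moreover have "card (J - ?C \<union> X) \<le> card J"
  proof -
    have "card (J - ?C \<union> X) \<le> card (J - ?C) + card ?C"
      using card_Un_le[of "J - ?C" X] card by simp
    also have "\<dots> = card J"
      using C fin card_mono[of J ?C] card_Diff_subset[of ?C J] finite_subset[of ?C J] by fastforce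
    finally show ?thesis .
  qed
  ultimately show ?thesis
    using solutionD[OF J(1)] X(1) by (auto simp: improving_set_def feasible_def)
qed

definition target :: "'v set \<Rightarrow> int \<Rightarrow> 'v set \<Rightarrow> bool" where
  "target I t Y \<longleftrightarrow> (\<exists>w\<in>S - I. grows (insert w I) Y) \<and> feasible Y \<and> card Y \<le> A \<and> t \<le> gap Y"

abbreviation smallest_target :: "'v set \<Rightarrow> int \<Rightarrow> 'v set \<Rightarrow> bool" where
  "smallest_target I t \<equiv> is_arg_min card (target I t)"

lemma targetD: "target I t Y \<Longrightarrow> I \<subseteq> Y"
  using grows_subset by (auto simp: target_def)

text \<open>Adding one vertex increases the gap by at most one.\<close>
lemma gap_smallest_target:
  assumes Y: "smallest_target I t Y" and t: "gap I < t"
  shows "gap Y = t"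
proof -
  obtain w where w: "w \<in> S - I" "grows (insert w I) Y"
    and target: "feasible Y" "card Y \<le> A" "t \<le> gap Y"
    using Y by (auto simp: is_arg_min_def target_def)
  from w(2) have "gap Y \<le> t"
  proof (cases rule: rtranclp.cases)
    case rtrancl_refl
    then show ?thesis
      using gap_insert_le[of w I] t by simp
  next
    case (rtrancl_into_rtrancl Z)
    then obtain v where v: "Y = insert v Z" "v \<notin> Z"
      by (auto elim: extends.cases)
    have "\<not> target I t Z"
      using Y v feasible_finite[OF target(1)] by (auto simp: is_arg_min_def)
    moreover have "feasible Z" "card Z \<le> A"
      using target(1,2) v feasible_subset[of Y Z] feasible_finite[OF target(1)] by auto
    ultimately have "gap Z < t"
      using w(1) rtrancl_into_rtrancl(1) by (auto simp: target_def)
    then show ?thesis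
      using gap_insert_le[of v Z] v(1) by simp
  qed
  with target(3) show ?thesis
    by simp
qed

lemma card_smallest_target_le:
  assumes Y: "smallest_target I (gap I + int g) Y" and "1 \<le> g"
  shows "card (Y - I) \<le> g + B"
proof -
  have target: "I \<subseteq> Y" "feasible Y"
    using Y targetD by (auto simp: is_arg_min_def target_def)
  have "gap Y = gap I + int g"
    using gap_smallest_target[OF Y] \<open>1 \<le> g\<close> by simp
  then have "card Y \<le> card I + g + card (outer Y)"
    by (simp add: gap_def)
  also have "\<dots> \<le> card I + g + B"
    using target(2) by (simp add: feasible_def)
  finally show ?thesis
    using card_Diff_subset[OF finite_subset] target feasible_finite by fastforce
qed

lemma solution_superset_of_smallest_target:
  assumes J: "solution J" "I \<subseteq> J" and x: "x \<in> J - I" and h: "int h \<le> gap I"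
    and g: "int g = min (gain I (component I J x)) (int d - int h)"
    and Y: "smallest_target I (gap I + int g) Y" "card Y \<le> card (I \<union> component I J x)"
    and disjoint: "closed_nbhd (Y - I) \<inter> (J - I) = {}"
  obtains J' where "solution J'" "Y \<subseteq> J'"
proof -
  let ?C = "component I J x"
  have target: "feasible Y" "gap I + int g \<le> gap Y" "I \<subseteq> Y"
    using Y(1) targetD by (auto simp: is_arg_min_def target_def)
  have C: "?C \<subseteq> J - I"
    by (rule component_subset[OF x])
  have fin: "finite I" "finite (Y - I)" "finite ?C"
    using target feasible_finite solutionD(2)[OF J(1)] C by (auto intro: finite_subset)
  show thesis
  proof (cases "int g = gain I ?C")
    case True
    have "card (I \<union> ?C) = card I + card ?C"
      using C fin by (intro card_Un_disjoint) auto
    then have "card (Y - I) \<le> card ?C"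
      using Y(2) card_Diff_subset[OF fin(1) target(3)] by simp
    moreover have "gap (I \<union> (Y - I)) = gap I + gain I (Y - I)"
      using fin by (intro gap_Un) auto
    ultimately have "solution (J - ?C \<union> (Y - I))"
      using J x target disjoint True
      by (intro solution_exchange_component) (auto simp: Un_absorb1)
    with C J(2) show thesis
      by (intro that[of "J - ?C \<union> (Y - I)"]) blast+
  next
    case False
    then have "int d \<le> gap Y"
      using g h target(2) by (simp add: min_def split: if_splits)
    moreover have "card Y \<le> A"
      using Y(2) C J(2) solutionD(2,4)[OF J(1)] card_mono[of J "I \<union> ?C"] by force
    ultimately have "solution Y"
      using target(1) by (auto simp: improving_set_def feasible_def)
    then show thesis
      by (rule that) simp
  qed
qed

lemma promising_of_smallest_target:
  assumes J: "solution J" "I \<subseteq> J" and x: "x \<in> J - I"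
    and least: "\<And>y. y \<in> J - I \<Longrightarrow> gain I (component I J x) \<le> gain I (component I J y)"
    and h: "int h \<le> gap I"
    and g: "int g = min (gain I (component I J x)) (int d - int h)"
    and Y: "smallest_target I (gap I + int g) Y" "card Y \<le> card (I \<union> component I J x)"
  shows "\<exists>v\<in>closed_nbhd (Y - I) - I. promising (insert v I) (h + g)"
proof (cases "closed_nbhd (Y - I) \<inter> (J - I) = {}")
  case False
  then obtain v where v: "v \<in> closed_nbhd (Y - I)" "v \<in> J - I"
    by blast
  have "int (h + g) \<le> gap I + gain I (component I J v)"
    using least[OF v(2)] h g by simp
  with v promising_component[OF J v(2)] show ?thesis
    by blast
next
  case True
  obtain w where w: "w \<in> S - I" "grows (insert w I) Y" and "gap I + int g \<le> gap Y"
    using Y(1) by (auto simp: is_arg_min_def target_def)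
  moreover obtain J' where "solution J'" "Y \<subseteq> J'"
    using solution_superset_of_smallest_target[OF J x h g Y True] .
  ultimately have "promising (insert w I) (h + g)"
    using h unfolding promising_def by (intro exI[of _ Y] exI[of _ J']) simp
  moreover have "w \<in> closed_nbhd (Y - I) - I"
    using w grows_subset[OF w(2)] by (auto simp: closed_nbhd_def)
  ultimately show ?thesis
    by blast
qed

lemma exchange:
  assumes J0: "solution J0" "I \<subseteq> J0" and h: "int h \<le> gap I" and less: "gap I < int d"
  obtains g where "1 \<le> g" "h + g \<le> d" "\<exists>Y. target I (gap I + int g) Y"
    "\<And>Y. smallest_target I (gap I + int g) Y \<Longrightarrow>
       \<exists>v\<in>closed_nbhd (Y - I) - I. promising (insert v I) (h + g)"
proof -
  obtain J where J: "solution J" "I \<subseteq> J"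
    and minimal: "\<And>J'. solution J' \<Longrightarrow> I \<subseteq> J' \<Longrightarrow> card J \<le> card J'"
    using ex_has_least_nat[of "\<lambda>J. solution J \<and> I \<subseteq> J" J0 card] J0 by blast
  have "J - I \<noteq> {}"
    using J less solutionD(5)[OF J(1)] by auto
  then obtain x where x: "x \<in> J - I"
    and least: "\<And>y. y \<in> J - I \<Longrightarrow> gain I (component I J x) \<le> gain I (component I J y)"
    using ex_is_arg_min_if_finite[of "J - I" "\<lambda>x. gain I (component I J x)"] solutionD(2)[OF J(1)]
    unfolding is_arg_min_linorder by auto
  let ?C = "component I J x"
  define g where "g = nat (min (gain I ?C) (int d - int h))"
  have pos: "0 < gain I ?C"
    using gain_component_pos[OF J x minimal] .
  then have g: "int g = min (gain I ?C) (int d - int h)" "1 \<le> g" "h + g \<le> d"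
    using h less by (auto simp: g_def)
  have C: "?C \<subseteq> J - I"
    by (rule component_subset[OF x])
  have "gap (I \<union> ?C) = gap I + gain I ?C"
    by (rule gap_Un) (use C J solutionD(2) in \<open>auto intro: finite_subset\<close>)
  moreover have "I \<union> ?C \<subseteq> J"
    using C J(2) by blast
  moreover from this have "card (I \<union> ?C) \<le> A"
    using solutionD(2,4)[OF J(1)] card_mono by (meson order_trans)
  ultimately have target: "target I (gap I + int g) (I \<union> ?C)"
    unfolding target_def
    using x grows_component[OF solutionD(2)[OF J(1)] x] solutionD(1)[OF J(1)]
      feasible_subset[OF solution_feasible[OF J(1)]] g(1)
    by auto
  show thesis
  proof (rule that[OF g(2,3)])
    show "\<exists>Y. target I (gap I + int g) Y"
      using target by blast
    show "\<exists>v\<in>closed_nbhd (Y - I) - I. promising (insert v I) (h + g)"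
      if "smallest_target I (gap I + int g) Y" for Y
      using that target
      by (intro promising_of_smallest_target[OF J x least h g(1)])
        (auto simp: is_arg_min_def not_less)
  qed
qed

end

section \<open>Breadth-first search for a smallest target\<close>

abbreviation extensions :: "'a list \<Rightarrow> 'a list \<Rightarrow> 'a list list" where
  "extensions p ws \<equiv> map (\<lambda>w. w # p) ws"

definition bfs_ordered :: "'a list list \<Rightarrow> bool" where
  "bfs_ordered ps \<longleftrightarrow> sorted (map length ps) \<and> (\<forall>p\<in>set ps. length p \<le> length (hd ps) + 1)"

lemma bfs_ordered_extensions: "bfs_ordered (extensions p ws)"
proof -
  have "sorted (map length (extensions p ws))"
    by (induction ws) auto
  moreover have "length q \<le> length (hd (extensions p ws)) + 1"
    if "q \<in> set (extensions p ws)" for q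
    using that by (cases ws) auto
  ultimately show ?thesis
    unfolding bfs_ordered_def by blast
qed

lemma bfs_ordered_tl: "bfs_ordered (p # ps) \<Longrightarrow> bfs_ordered ps"
  unfolding bfs_ordered_def by (cases ps) fastforce+

lemma bfs_ordered_append_extensions:
  assumes "bfs_ordered (p # ps)"
  shows "bfs_ordered (ps @ extensions p ws)"
proof (cases ps)
  case Nil
  then show ?thesis
    by (simp add: bfs_ordered_extensions)
next
  case (Cons q qs)
  have "sorted (map length (extensions p ws))"
    using bfs_ordered_extensions unfolding bfs_ordered_def by blast
  with assms Cons show ?thesis
    by (auto simp: bfs_ordered_def sorted_append)
qed

context solution_search
begin

definition admissible :: "'v list \<Rightarrow> bool" where
  "admissible p \<longleftrightarrow> distinct p \<and> feasible (set p)"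

definition candidate :: "'v list \<Rightarrow> 'v list \<Rightarrow> bool" where
  "candidate P p \<longleftrightarrow> (\<exists>X. p = X @ P \<and> X \<noteq> [] \<and> set X \<subseteq> V) \<and>
     (admissible p \<longrightarrow> (\<exists>w\<in>S - set P. grows (insert w (set P)) (set p)))"

definition queue :: "'v list \<Rightarrow> int \<Rightarrow> 'v list list \<Rightarrow> bool" where
  "queue P t ps \<longleftrightarrow> bfs_ordered ps \<and> (\<forall>p\<in>set ps. candidate P p \<and> length p \<le> A) \<and>
     (\<forall>Y. target (set P) t Y \<longrightarrow> (\<exists>p\<in>set ps. distinct p \<and> grows (set p) Y))"

lemma candidate_start:
  assumes "w \<in> V"
  shows "candidate P (w # P)"
proof -
  have "w \<in> S - set P \<and> grows (insert w (set P)) (set (w # P))" if "admissible (w # P)"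
    using that by (simp add: admissible_def feasible_def)
  with assms show ?thesis
    unfolding candidate_def by (intro conjI exI[of _ "[w]"]) auto
qed

lemma queue_start:
  assumes "distinct P" "length P < A" "set ws = V"
  shows "queue P t (extensions P ws)"
proof -
  have "\<exists>p\<in>set (extensions P ws). distinct p \<and> grows (set p) Y"
    if target: "target (set P) t Y" for Y
  proof -
    obtain w where "w \<in> S - set P" "grows (insert w (set P)) Y"
      using target by (auto simp: target_def)
    with assms S_subset show ?thesis
      by (intro bexI[of _ "w # P"]) auto
  qed
  with assms candidate_start show ?thesis
    by (auto simp: queue_def bfs_ordered_extensions)
qed

lemma queue_tl:
  assumes "queue P t (p # ps)" "\<And>Y. target (set P) t Y \<Longrightarrow> distinct p \<Longrightarrow> \<not> grows (set p) Y"
  shows "queue P t ps"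
  using assms bfs_ordered_tl unfolding queue_def by (metis list.set_intros(2) set_ConsD)

lemma queue_inadmissible:
  assumes "queue P t (p # ps)" "\<not> admissible p"
  shows "queue P t ps"
proof (rule queue_tl[OF assms(1)])
  fix Y assume "target (set P) t Y" "distinct p"
  then show "\<not> grows (set p) Y"
    using assms(2) grows_subset feasible_subset by (auto simp: target_def admissible_def)
qed

lemma queue_full:
  assumes "queue P t (p # ps)" "gap (set p) < t" "\<not> length p < A"
  shows "queue P t ps"
proof (rule queue_tl[OF assms(1)])
  fix Y assume Y: "target (set P) t Y" and p: "distinct p"
  show "\<not> grows (set p) Y"
  proof
    assume "grows (set p) Y"
    then have "set p \<subset> Y"
      using Y assms(2) grows_subset by (auto simp: target_def)
    then have "card (set p) < card Y"
      using Y feasible_finite by (intro psubset_card_mono) (auto simp: target_def)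
    then show False
      using Y p assms(3) by (simp add: target_def distinct_card)
  qed
qed

lemma candidate_child:
  assumes p: "candidate P p" "admissible p" and w: "w \<in> closed_nbhd (outer (set p))"
  shows "candidate P (w # p)"
proof -
  obtain X where "p = X @ P" "X \<noteq> []" "set X \<subseteq> V"
    using p(1) by (auto simp: candidate_def)
  moreover have "w \<in> V"
    using w closed_nbhd_subset_V[OF outer_subset_V] by blast
  moreover have "\<exists>v\<in>S - set P. grows (insert v (set P)) (set (w # p))"
    if child: "admissible (w # p)"
  proof -
    obtain v where v: "v \<in> S - set P" "grows (insert v (set P)) (set p)"
      using p by (auto simp: candidate_def)
    have "w \<in> S" "w \<notin> set p"
      using child by (auto simp: admissible_def feasible_def)
    moreover from this(1) obtain u where "u \<in> outer (set p)" "w \<in> nb u"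
      using w by (auto simp: closed_nbhd_def outer_def)
    ultimately have "extends (set p) (set (w # p))"
      using nb_sym extends.intros[of w "set p"] by auto
    with v show ?thesis
      by (meson rtranclp.rtrancl_into_rtrancl)
  qed
  ultimately show ?thesis
    unfolding candidate_def by (intro conjI exI[of _ "w # X"]) auto
qed

lemma queue_expand:
  assumes queue: "queue P t (p # ps)" and p: "admissible p" "gap (set p) < t" "length p < A"
    and ws: "set ws = closed_nbhd (outer (set p))"
  shows "queue P t (ps @ extensions p ws)"
proof -
  have "\<exists>q\<in>set (ps @ extensions p ws). distinct q \<and> grows (set q) Y"
    if Y: "target (set P) t Y" for Y
  proof -
    obtain q where q: "q \<in> set (p # ps)" "distinct q" "grows (set q) Y"
      using queue Y unfolding queue_def by blast
    show ?thesis
    proof (cases "q \<in> set ps")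
      case False
      then have "grows (set p) Y" "set p \<noteq> Y"
        using q Y p(2) by (auto simp: target_def)
      then obtain Z where "extends (set p) Z" "grows Z Y"
        by (auto elim: converse_rtranclpE)
      then obtain v where "v \<notin> set p" "nb v \<inter> outer (set p) \<noteq> {}" "grows (set (v # p)) Y"
        by (auto elim!: extends.cases)
      moreover from this(2) have "v \<in> set ws"
        using ws nb_sym by (auto simp: closed_nbhd_def)
      ultimately show ?thesis
        using p(1) by (intro bexI[of _ "v # p"]) (auto simp: admissible_def)
    qed (use q in auto)
  qed
  moreover have "candidate P p" "bfs_ordered (p # ps)" "\<forall>q\<in>set ps. candidate P q \<and> length q \<le> A"
    using queue by (auto simp: queue_def)
  ultimately show ?thesis
    using p ws candidate_child bfs_ordered_append_extensions by (auto simp: queue_def)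
qed

lemma queue_smallest_target:
  assumes queue: "queue P t (p # ps)" and p: "admissible p" "t \<le> gap (set p)"
  shows "smallest_target (set P) t (set p)"
proof -
  have "card (set p) \<le> card Y" if Y: "target (set P) t Y" for Y
  proof -
    obtain q where q: "q \<in> set (p # ps)" "distinct q" "grows (set q) Y"
      using queue Y unfolding queue_def by blast
    have "card (set p) \<le> length p"
      by (rule card_length)
    also have "\<dots> \<le> length q"
      using queue q(1) by (auto simp: queue_def bfs_ordered_def)
    also have "\<dots> = card (set q)"
      using q(2) by (simp add: distinct_card)
    also have "\<dots> \<le> card Y"
      using q(3) Y grows_subset feasible_finite by (auto simp: target_def intro!: card_mono)
    finally show ?thesis .
  qed
  moreover have "target (set P) t (set p)"
    using queue p by (auto simp: queue_def candidate_def target_def admissible_def distinct_card)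
  ultimately show ?thesis
    by (auto simp: is_arg_min_linorder)
qed

lemma queue_Nil: "queue P t [] \<Longrightarrow> \<not> target (set P) t Y"
  by (auto simp: queue_def)

end

section \<open>The search tree\<close>

lemma sum_weighted_powers: "9 * (\<Sum>g = 1..q. g * 4 ^ (q - g)) + 3 * q + 4 = 4 * 4 ^ (q :: nat)"
proof (induction q)
  case (Suc q)
  have "(\<Sum>g = 1..q. g * 4 ^ (Suc q - g)) = 4 * (\<Sum>g = 1..q. g * 4 ^ (q - g))"
    unfolding sum_distrib_left by (intro sum.cong) (auto simp: Suc_diff_le)
  then show ?case
    using Suc.IH by simp
qed simp

type_synonym node = "nat list \<times> nat"

locale search_instance = solution_search V E S B d
  for V :: "nat set" and E S B d +
  fixes adj :: "nat list list"
  assumes adjacency: "adjacency_lists V E adj"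
begin

abbreviation n :: nat where "n \<equiv> length adj"

definition D :: nat where "D = max_degree V E + 1"

lemma V_eq: "V = {..<n}"
  using adjacency by (simp add: adjacency_lists_def)

lemma card_V: "card V = n"
  by (simp add: V_eq)

lemma set_adj: "v \<in> V \<Longrightarrow> set (adj ! v) = nb v"
  using adjacency by (simp add: adjacency_lists_def)

lemma adj_subset_V: "v \<in> V \<Longrightarrow> set (adj ! v) \<subseteq> V"
  using set_adj nb_in_V by blast

lemma length_adj_less:
  assumes "v \<in> V"
  shows "length (adj ! v) < D"
proof -
  have "length (adj ! v) = card (nb v)"
    using assms adjacency by (metis adjacency_lists_def distinct_card)
  also have "\<dots> \<le> max_degree V E"
    using card_neighbours_le_max_degree[OF finite_V assms] .
  finally show ?thesis
    by (simp add: D_def)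
qed

lemma D_pos: "1 \<le> D"
  by (simp add: D_def)

lemma D_le_card: "D \<le> max 1 n"
proof (cases "V = {}")
  case True
  then show ?thesis
    unfolding D_def max_degree_def by simp
next
  case False
  then show ?thesis
    using max_degree_less_card by (simp add: D_def card_V)
qed

definition closed_nbs :: "nat list \<Rightarrow> nat list" where
  "closed_nbs L = concat (map (\<lambda>u. u # adj ! u) L)"

lemma closed_nbs_Nil: "closed_nbs [] = []"
  by (simp add: closed_nbs_def)

lemma closed_nbs_snoc: "closed_nbs (L @ [u]) = closed_nbs L @ u # adj ! u"
  by (simp add: closed_nbs_def)

lemma set_closed_nbs: "set L \<subseteq> V \<Longrightarrow> set (closed_nbs L) = closed_nbhd (set L)"
  using set_adj by (auto simp: closed_nbs_def closed_nbhd_def)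

lemma closed_nbs_subset_V: "set L \<subseteq> V \<Longrightarrow> set (closed_nbs L) \<subseteq> V"
  using closed_nbhd_subset_V by (simp add: set_closed_nbs)

lemma length_closed_nbs: "set L \<subseteq> V \<Longrightarrow> length (closed_nbs L) \<le> length L * D"
proof (induction L)
  case (Cons u L)
  then show ?case
    using length_adj_less[of u] by (simp add: closed_nbs_def)
qed (simp add: closed_nbs_def)

subsection \<open>Nodes\<close>

abbreviation children :: "nat list \<Rightarrow> nat \<Rightarrow> nat list \<Rightarrow> node list" where
  "children P h ws \<equiv> map (\<lambda>w. (w # P, h)) ws"

definition promising_node :: "node \<Rightarrow> bool" where
  "promising_node = (\<lambda>(P, h). distinct P \<and> promising (set P) h)"

definition valid_node :: "node \<Rightarrow> bool" where
  "valid_node = (\<lambda>(P, h). set P \<subseteq> V \<and> length P \<le> A \<and> h \<le> d)"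

definition outer_list :: "nat list \<Rightarrow> nat list \<Rightarrow> bool" where
  "outer_list P L \<longleftrightarrow> distinct L \<and> set L = outer (set P)"

lemma outer_list_subset_V: "outer_list P L \<Longrightarrow> set L \<subseteq> V"
  using outer_subset_V by (simp add: outer_list_def)

lemma length_outer_list: "outer_list P L \<Longrightarrow> length L = card (outer (set P))"
  by (metis outer_list_def distinct_card)

lemma length_outer_list_le: "admissible P \<Longrightarrow> outer_list P L \<Longrightarrow> length L \<le> B"
  by (simp add: length_outer_list admissible_def feasible_def)

lemma length_closed_nbs_outer_list:
  assumes "admissible P" "outer_list P L"
  shows "length (closed_nbs L) \<le> (B + 1) * D"
proof -
  have "length (closed_nbs L) \<le> length L * D"
    using length_closed_nbs outer_list_subset_V[OF assms(2)] .
  also have "\<dots> \<le> (B + 1) * D"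
    using length_outer_list_le[OF assms] by (intro mult_le_mono1) simp
  finally show ?thesis .
qed

lemma admissible_gap: "admissible P \<Longrightarrow> gap (set P) = int (length P) - int (card (outer (set P)))"
  by (simp add: admissible_def gap_def distinct_card)

lemma gap_less_iff:
  assumes "admissible p" "admissible P"
  shows "gap (set p) < gap (set P) + int g \<longleftrightarrow>
    length p + card (outer (set P)) < length P + card (outer (set p)) + g"
  using admissible_gap[OF assms(1)] admissible_gap[OF assms(2)] by auto

definition search_result :: "nat list \<Rightarrow> int \<Rightarrow> nat list \<Rightarrow> bool" where
  "search_result P t X \<longleftrightarrow> distinct (X @ P) \<and>
     (if \<exists>Y. target (set P) t Y then smallest_target (set P) t (set (X @ P)) else X = [])"

lemma search_result_cases:
  assumes "search_result P t X"
  obtains (none) "X = []"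
    | (smallest) "smallest_target (set P) t (set (X @ P))" "feasible (set (X @ P))"
      "length (X @ P) \<le> A"
proof (cases "\<exists>Y. target (set P) t Y")
  case True
  then have "smallest_target (set P) t (set (X @ P))" "distinct (X @ P)"
    using assms by (auto simp: search_result_def)
  then show ?thesis
    using smallest unfolding is_arg_min_def target_def by (metis distinct_card)
qed (use assms none in \<open>simp add: search_result_def\<close>)

lemma search_result_subset_S: "search_result P t X \<Longrightarrow> set X \<subseteq> S"
  by (erule search_result_cases) (auto simp: feasible_def)

lemma search_result_subset_V: "search_result P t X \<Longrightarrow> set X \<subseteq> V"
  using search_result_subset_S S_subset by blast

lemma length_search_result_le_A: "search_result P t X \<Longrightarrow> length X \<le> A"
  by (erule search_result_cases) auto

lemma length_search_result_le:
  assumes X: "search_result P (gap (set P) + int g) X" and "1 \<le> g"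
  shows "length X \<le> g + B"
  using X
proof (cases rule: search_result_cases)
  case smallest
  have "distinct (X @ P)"
    using X by (simp add: search_result_def)
  then have "set (X @ P) - set P = set X" "card (set X) = length X"
    by (auto simp: distinct_card)
  then show ?thesis
    using card_smallest_target_le[OF smallest(1) \<open>1 \<le> g\<close>] by simp
qed simp

definition gap_tried :: "nat list \<Rightarrow> nat \<Rightarrow> nat \<Rightarrow> node set \<Rightarrow> bool" where
  "gap_tried P h g Z \<longleftrightarrow> (\<exists>X. search_result P (gap (set P) + int g) X \<and>
     set (children P (h + g) (closed_nbs X)) \<subseteq> Z)"

lemma gap_tried_mono: "gap_tried P h g Z \<Longrightarrow> Z \<subseteq> Z' \<Longrightarrow> gap_tried P h g Z'"
  unfolding gap_tried_def by blast

lemma promising_child: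
  assumes node: "promising_node (P, h)" and gap: "gap (set P) < int d" and L: "outer_list P L"
    and grown: "set (children P h (closed_nbs L)) \<subseteq> Z"
    and tried: "\<And>g. 1 \<le> g \<Longrightarrow> h + g \<le> d \<Longrightarrow> gap_tried P h g Z"
  shows "\<exists>z\<in>Z. promising_node z"
proof -
  have P: "distinct P" "promising (set P) h"
    using node by (auto simp: promising_node_def)
  from P(2) show ?thesis
  proof (cases rule: promising_cases)
    case (grow v)
    then have "v \<in> set (closed_nbs L)"
      using set_closed_nbs[OF outer_list_subset_V[OF L]] L nb_sym
      by (auto simp: outer_list_def closed_nbhd_def)
    with grow P(1) grown show ?thesis
      by (intro bexI[of _ "(v # P, h)"]) (auto simp: promising_node_def)
  next
    case (start J)
    then obtain g where g: "1 \<le> g" "h + g \<le> d" "\<exists>Y. target (set P) (gap (set P) + int g) Y"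
      and smallest: "\<And>Y. smallest_target (set P) (gap (set P) + int g) Y \<Longrightarrow>
        \<exists>v\<in>closed_nbhd (Y - set P) - set P. promising (insert v (set P)) (h + g)"
      using exchange gap by blast
    obtain X where X: "search_result P (gap (set P) + int g) X"
        "set (children P (h + g) (closed_nbs X)) \<subseteq> Z"
      using tried[OF g(1,2)] unfolding gap_tried_def by blast
    then have "smallest_target (set P) (gap (set P) + int g) (set (X @ P))"
      using g(3) by (simp add: search_result_def)
    moreover have "set (X @ P) - set P = set X"
      using X(1) by (auto simp: search_result_def)
    ultimately obtain v where "v \<in> closed_nbhd (set X)" "v \<notin> set P"
      "promising (insert v (set P)) (h + g)"
      using smallest by force
    with X P(1) set_closed_nbs[OF search_result_subset_V] show ?thesis
      by (intro bexI[of _ "(v # P, h + g)"]) (auto simp: promising_node_def)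
  qed
qed

lemma promising_node_admissible: "promising_node (P, h) \<Longrightarrow> admissible P"
  using promising_feasible by (auto simp: promising_node_def admissible_def)

lemma promising_node_length_less:
  "promising_node (P, h) \<Longrightarrow> gap (set P) < int d \<Longrightarrow> length P < A"
  using promising_card_less[of "set P" h] by (simp add: promising_node_def distinct_card)

lemma solution_of_admissible:
  "admissible P \<Longrightarrow> length P \<le> A \<Longrightarrow> int d \<le> gap (set P) \<Longrightarrow> solution (set P)"
  by (simp add: admissible_def feasible_def improving_set_def distinct_card)

subsection \<open>Potentials\<close>

text \<open>\<open>node_bound\<close> bounds the work on a single node apart from the searches it starts, \<open>bfs_bound r\<close>
  the work of a breadth-first search below a node that may still be extended by \<open>r\<close> vertices, and
  \<open>tree_bound m q\<close> the total work below a node of the search tree that may still be extended by \<open>m\<close>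
  vertices and whose label is \<open>d - q\<close>.\<close>
definition node_bound :: nat where "node_bound = 60 * ((A + 1) * D)"

definition branching :: nat where "branching = (B + 1) * D"

definition bfs_bound :: "nat \<Rightarrow> nat" where
  "bfs_bound r = node_bound * (r + 1) * branching ^ r"

definition search_bound :: "nat \<Rightarrow> nat" where
  "search_bound m = 8 * n + n * bfs_bound m + node_bound"

definition scale :: nat where "scale = 134 * (max 1 n * (A + 1)\<^sup>2)"

definition tree_bound :: "nat \<Rightarrow> nat \<Rightarrow> nat" where
  "tree_bound m q = 4 * scale * (2 * branching) ^ m * 4 ^ q"

definition bfs_potential :: "nat list list \<Rightarrow> nat" where
  "bfs_potential ps = (\<Sum>p\<leftarrow>ps. bfs_bound (A - length p))"

definition tree_potential :: "node list \<Rightarrow> nat" where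
  "tree_potential ns = (\<Sum>(P, h)\<leftarrow>ns. tree_bound (A - length P) (d - h))"

lemma branching_ge: "1 \<le> branching" "D \<le> branching"
  using D_pos by (auto simp: branching_def)

lemma le_mult_branching_power: "x \<le> x * branching ^ r"
  using branching_ge(1) by (simp add: Suc_leI)

lemma node_bound_le_bfs_bound: "node_bound \<le> bfs_bound r"
proof -
  have "node_bound \<le> node_bound * (r + 1)"
    by simp
  then show ?thesis
    unfolding bfs_bound_def using le_mult_branching_power le_trans by blast
qed

lemma bfs_bound_Suc: "node_bound + branching * bfs_bound r \<le> bfs_bound (Suc r)"
  using le_mult_branching_power[of node_bound "Suc r"] by (simp add: bfs_bound_def algebra_simps)

lemma bfs_potential_append: "bfs_potential (ps @ qs) = bfs_potential ps + bfs_potential qs"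
  by (simp add: bfs_potential_def)

lemma bfs_potential_Cons: "bfs_potential (p # ps) = bfs_bound (A - length p) + bfs_potential ps"
  by (simp add: bfs_potential_def)

lemma bfs_potential_extensions:
  "bfs_potential (extensions p ws) = length ws * bfs_bound (A - Suc (length p))"
  by (simp add: bfs_potential_def o_def sum_list_triv)

lemma bfs_potential_tl: "node_bound + bfs_potential ps \<le> bfs_potential (p # ps)"
  using node_bound_le_bfs_bound by (simp add: bfs_potential_Cons)

lemma bfs_potential_expand:
  assumes "length p < A" "length ws \<le> branching"
  shows "node_bound + bfs_potential (ps @ extensions p ws) \<le> bfs_potential (p # ps)"
proof -
  have "bfs_potential (extensions p ws) \<le> branching * bfs_bound (A - Suc (length p))"
    unfolding bfs_potential_extensions using assms(2) by (rule mult_le_mono1)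
  moreover have "A - length p = Suc (A - Suc (length p))"
    using assms(1) by simp
  ultimately show ?thesis
    using bfs_bound_Suc[of "A - Suc (length p)"]
    by (simp add: bfs_potential_append bfs_potential_Cons)
qed

lemma node_bound_le: "node_bound \<le> 60 * (max 1 n * (A + 1)\<^sup>2)"
proof -
  have "(A + 1) * D \<le> (A + 1) * max 1 n"
    using D_le_card by (rule mult_le_mono2)
  also have "\<dots> \<le> max 1 n * (A + 1)\<^sup>2"
    by (simp add: power2_eq_square)
  finally show ?thesis
    unfolding node_bound_def by (rule mult_le_mono2)
qed

lemma search_bound_le:
  assumes "m < A"
  shows "search_bound m + 6 \<le> scale * branching ^ (m + 1)"
proof -
  let ?H = "max 1 n * (A + 1)\<^sup>2"
  have "max 1 n * 1 \<le> ?H"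
    by (rule mult_le_mono2) (simp add: Suc_leI)
  then have H: "1 \<le> ?H" "n \<le> ?H"
    by auto
  have "n * bfs_bound m = 60 * (n * ((A + 1) * (m + 1)) * (D * branching ^ m))"
    by (simp only: bfs_bound_def node_bound_def ac_simps)
  also have "\<dots> \<le> 60 * (max 1 n * ((A + 1) * (A + 1)) * (branching * branching ^ m))"
    using assms branching_ge(2) by (intro mult_le_mono) auto
  also have "\<dots> = 60 * (?H * branching ^ (m + 1))"
    by (simp add: power2_eq_square)
  finally have bfs: "n * bfs_bound m \<le> 60 * (?H * branching ^ (m + 1))" .
  have "8 * n + node_bound + 6 \<le> 74 * ?H"
    using H node_bound_le by linarith
  also have "\<dots> \<le> 74 * (?H * branching ^ (m + 1))"
    by (intro mult_le_mono2 le_mult_branching_power)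
  finally have "search_bound m + 6 \<le> 134 * (?H * branching ^ (m + 1))"
    using bfs by (simp only: search_bound_def)
  then show ?thesis
    by (simp only: scale_def mult.assoc)
qed

lemma node_bound_le_scale: "node_bound \<le> scale"
  using node_bound_le by (simp add: scale_def)

lemma node_bound_le_tree_bound: "node_bound \<le> tree_bound m q"
proof -
  have "scale * 1 \<le> scale * (4 * 2 ^ m * 4 ^ q)"
    by (intro mult_le_mono2) (simp add: Suc_leI)
  also have "\<dots> \<le> scale * (4 * 2 ^ m * 4 ^ q) * branching ^ m"
    by (rule le_mult_branching_power)
  also have "\<dots> = tree_bound m q"
    by (simp add: tree_bound_def power_mult_distrib)
  finally show ?thesis
    using node_bound_le_scale by simp
qed

lemma sum_tree_bound_le:
  "2 * (\<Sum>g = 1..q. (g + B) * D * tree_bound m (q - g)) \<le> branching * tree_bound m q"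
proof -
  let ?c = "4 * scale * (2 * branching) ^ m"
  have "(\<Sum>g = 1..q. (g + B) * D * tree_bound m (q - g)) \<le>
    (\<Sum>g = 1..q. branching * ?c * (g * 4 ^ (q - g)))"
  proof (rule sum_mono)
    fix g assume "g \<in> {1..q}"
    then have "g + B \<le> g * (B + 1)"
      by (cases g) auto
    then have "(g + B) * D * tree_bound m (q - g) \<le> g * (B + 1) * D * tree_bound m (q - g)"
      by (intro mult_le_mono) auto
    then show "(g + B) * D * tree_bound m (q - g) \<le> branching * ?c * (g * 4 ^ (q - g))"
      by (simp only: branching_def tree_bound_def ac_simps)
  qed
  also have "\<dots> = branching * ?c * (\<Sum>g = 1..q. g * 4 ^ (q - g))"
    by (simp only: sum_distrib_left)
  finally have "2 * (\<Sum>g = 1..q. (g + B) * D * tree_bound m (q - g))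
      \<le> branching * ?c * (2 * (\<Sum>g = 1..q. g * 4 ^ (q - g)))"
    by simp
  also have "\<dots> \<le> branching * ?c * 4 ^ q"
    using sum_weighted_powers[of q] by (intro mult_le_mono2) simp
  finally show ?thesis
    by (simp only: tree_bound_def ac_simps)
qed

lemma search_cost_le_tree_bound:
  assumes "m < A"
  shows "2 * (node_bound + q * (search_bound m + 6)) \<le> branching * tree_bound m q"
proof -
  have "node_bound \<le> scale * branching ^ (m + 1)"
    using node_bound_le_scale le_mult_branching_power le_trans by blast
  moreover have "q * (search_bound m + 6) \<le> q * (scale * branching ^ (m + 1))"
    using search_bound_le[OF assms] by (rule mult_le_mono2)
  ultimately have "node_bound + q * (search_bound m + 6) \<le>
      scale * branching ^ (m + 1) + q * (scale * branching ^ (m + 1))"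
    by (rule add_mono)
  also have "\<dots> = Suc q * (scale * branching ^ (m + 1))"
    by simp
  also have "\<dots> \<le> 4 ^ q * (scale * branching ^ (m + 1))"
    using power_gt_expt[of 4 q] by (intro mult_le_mono1) simp
  finally have "2 * (node_bound + q * (search_bound m + 6)) \<le>
    2 * (4 ^ q * (scale * branching ^ (m + 1)))"
    by simp
  also have "\<dots> \<le> 4 * 2 ^ m * (4 ^ q * (scale * branching ^ (m + 1)))"
    by (intro mult_le_mono1) (simp add: Suc_leI)
  finally show ?thesis
    by (simp add: tree_bound_def power_mult_distrib ac_simps)
qed

lemma tree_bound_Suc:
  assumes "m < A"
  shows "node_bound + q * (search_bound m + 6) + branching * tree_bound m q +
    (\<Sum>g = 1..q. (g + B) * D * tree_bound m (q - g)) \<le> tree_bound (Suc m) q"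
proof -
  have double: "tree_bound (Suc m) q = 2 * (branching * tree_bound m q)"
    by (simp add: tree_bound_def)
  have halves: "a + x + b \<le> 2 * x" if "2 * a \<le> x" "2 * b \<le> x" for a b x :: nat
    using that by simp
  show ?thesis
    unfolding double by (rule halves[OF search_cost_le_tree_bound[OF assms] sum_tree_bound_le])
qed

lemma tree_potential_append: "tree_potential (xs @ ys) = tree_potential xs + tree_potential ys"
  by (simp add: tree_potential_def)

lemma tree_potential_children:
  "tree_potential (children P h ws) = length ws * tree_bound (A - Suc (length P)) (d - h)"
  by (simp add: tree_potential_def o_def sum_list_triv)

lemma tree_potential_expand:
  fixes P :: "nat list"
  defines "m \<equiv> A - Suc (length P)"
  assumes P: "length P < A" and ws: "length ws \<le> branching"
    and zs: "tree_potential zs \<le> (\<Sum>g\<leftarrow>[1..<d - h + 1]. (g + B) * D * tree_bound m (d - h - g))"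
  shows "node_bound + (d - h) * (search_bound m + 6) + tree_potential (children P h ws @ zs) \<le>
    tree_bound (A - length P) (d - h)"
proof -
  have "tree_potential (children P h ws) \<le> branching * tree_bound m (d - h)"
    using ws unfolding tree_potential_children m_def by (rule mult_le_mono1)
  moreover have "tree_potential zs \<le> (\<Sum>g = 1..d - h. (g + B) * D * tree_bound m (d - h - g))"
    using zs unfolding interv_sum_list_conv_sum_set_nat
    by (simp add: atLeastLessThanSuc_atLeastAtMost del: upt_Suc)
  moreover have "A - length P = Suc m" "m < A"
    using P by (auto simp: m_def)
  ultimately show ?thesis
    using tree_bound_Suc[of m "d - h"] by (simp add: tree_potential_append)
qed

end

section \<open>Evaluating a node\<close>

text \<open>
  The registers from \<open>r_base\<close> to \<open>r_base_outer\<close> describe the node of the search tree that is being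
  processed, \<open>r_parent\<close> and \<open>r_label\<close> the nodes to be pushed, and those from \<open>r_len\<close> to \<open>r_bad\<close> the
  node \<open>r_node\<close> last evaluated; \<open>r_bad\<close> is positive iff that node is not admissible. A vertex is
  marked iff its entry in \<open>a_mark\<close> equals \<open>r_stamp\<close>, so that increasing \<open>r_stamp\<close> erases all marks
  in constant time.
\<close>

abbreviation (input) r_n :: nat where "r_n \<equiv> 0"
abbreviation (input) r_k :: nat where "r_k \<equiv> 1"
abbreviation (input) r_d :: nat where "r_d \<equiv> 2"
abbreviation (input) r_one :: nat where "r_one \<equiv> 3"
abbreviation (input) r_A :: nat where "r_A \<equiv> 4"
abbreviation (input) r_B :: nat where "r_B \<equiv> 5"
abbreviation (input) r_limit :: nat where "r_limit \<equiv> 6"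
abbreviation (input) r_result :: nat where "r_result \<equiv> 7"
abbreviation (input) r_stamp :: nat where "r_stamp \<equiv> 8"
abbreviation (input) r_count :: nat where "r_count \<equiv> 9"
abbreviation (input) r_current :: nat where "r_current \<equiv> 10"
abbreviation (input) r_base :: nat where "r_base \<equiv> 11"
abbreviation (input) r_base_label :: nat where "r_base_label \<equiv> 12"
abbreviation (input) r_base_len :: nat where "r_base_len \<equiv> 13"
abbreviation (input) r_base_outer :: nat where "r_base_outer \<equiv> 14"
abbreviation (input) r_goal :: nat where "r_goal \<equiv> 15"
abbreviation (input) r_saved :: nat where "r_saved \<equiv> 16"
abbreviation (input) r_head :: nat where "r_head \<equiv> 17"
abbreviation (input) r_found :: nat where "r_found \<equiv> 18"
abbreviation (input) r_size :: nat where "r_size \<equiv> 19"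
abbreviation (input) r_parent :: nat where "r_parent \<equiv> 20"
abbreviation (input) r_label :: nat where "r_label \<equiv> 21"
abbreviation (input) r_node :: nat where "r_node \<equiv> 22"
abbreviation (input) r_len :: nat where "r_len \<equiv> 23"
abbreviation (input) r_list :: nat where "r_list \<equiv> 24"
abbreviation (input) r_bad :: nat where "r_bad \<equiv> 25"
abbreviation (input) r_path :: nat where "r_path \<equiv> 26"
abbreviation (input) r_index :: nat where "r_index \<equiv> 27"
abbreviation (input) r_pos :: nat where "r_pos \<equiv> 28"
abbreviation (input) r_stop :: nat where "r_stop \<equiv> 29"
abbreviation (input) r_vertex :: nat where "r_vertex \<equiv> 30"
abbreviation (input) r_fresh :: nat where "r_fresh \<equiv> 31"
abbreviation (input) r_cover :: nat where "r_cover \<equiv> 32"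
abbreviation (input) r_test :: nat where "r_test \<equiv> 33"

abbreviation (input) a_offset :: nat where "a_offset \<equiv> 0"
abbreviation (input) a_adj :: nat where "a_adj \<equiv> 1"
abbreviation (input) a_cover :: nat where "a_cover \<equiv> 2"
abbreviation (input) a_parent :: nat where "a_parent \<equiv> 3"
abbreviation (input) a_vertex :: nat where "a_vertex \<equiv> 4"
abbreviation (input) a_label :: nat where "a_label \<equiv> 5"
abbreviation (input) a_mark :: nat where "a_mark \<equiv> 6"
abbreviation (input) a_list :: nat where "a_list \<equiv> 7"

definition scan_vertex_com :: com where
  "scan_vertex_com =
     Cond [Load r_vertex a_adj r_pos, Add r_pos r_pos r_one,
           Load r_fresh a_mark r_vertex, Sub r_fresh r_stamp r_fresh, Load r_cover a_cover r_vertex,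
           Sub r_test r_cover r_fresh, Add r_bad r_bad r_test,
           Sub r_test r_one r_fresh, Add r_test r_test r_cover] r_test
       (Block [])
       (Block [Store a_mark r_vertex r_stamp, Store a_list r_list r_vertex,
         Add r_list r_list r_one])"

definition scan_com :: com where
  "scan_com = While [Sub r_test r_stop r_pos] r_test scan_vertex_com"

definition load_adj :: "instr list" where
  "load_adj = [Load r_pos a_offset r_vertex, Add r_stop r_vertex r_one,
    Load r_stop a_offset r_stop]"

definition visit_code :: "instr list" where
  "visit_code =
     [Load r_vertex a_vertex r_path,
      Load r_fresh a_mark r_vertex, Sub r_fresh r_stamp r_fresh,
      Sub r_test r_one r_fresh, Add r_bad r_bad r_test,
      Load r_cover a_cover r_vertex, Sub r_test r_one r_cover, Add r_bad r_bad r_test,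
      Store a_mark r_vertex r_stamp, Add r_len r_len r_one, Load r_path a_parent r_path] @ load_adj"

definition visit_com :: com where
  "visit_com = Block visit_code ;; scan_com"

definition eval_com :: com where
  "eval_com =
     Block [Add r_stamp r_stamp r_one, Const r_len 0, Const r_list 0, Const r_bad 0,
            Copy r_path r_node] ;;
     While [] r_path visit_com ;;
     Block [Sub r_test r_list r_B, Add r_bad r_bad r_test]"

lemma written_scan_com [simp]:
  "written_regs scan_com = {r_list, r_bad, r_pos, r_vertex, r_fresh, r_cover, r_test}"
  "written_arrays scan_com = {a_mark, a_list}"
  by (auto simp: scan_com_def scan_vertex_com_def)

lemma written_eval_com [simp]:
  "written_regs eval_com = {r_stamp, r_len, r_list, r_bad, r_path, r_pos, r_stop, r_vertex, r_fresh,
     r_cover, r_test}"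
  "written_arrays eval_com = {a_mark, a_list}"
  by (auto simp: eval_com_def visit_com_def visit_code_def load_adj_def)

definition segment :: "(nat \<Rightarrow> nat) \<Rightarrow> nat \<Rightarrow> nat list \<Rightarrow> bool" where
  "segment f i xs \<longleftrightarrow> (\<forall>j<length xs. f (i + j) = xs ! j)"

lemma segment_nth: "segment f i (zs @ y # ys) \<Longrightarrow> f (i + length zs) = y"
  by (simp add: segment_def)

lemma segment_snoc: "segment f 0 xs \<Longrightarrow> segment (f(length xs := x)) 0 (xs @ [x])"
  by (simp add: segment_def nth_append less_Suc_eq)

primrec path :: "(nat \<Rightarrow> nat) \<Rightarrow> (nat \<Rightarrow> nat) \<Rightarrow> nat \<Rightarrow> nat list \<Rightarrow> bool" where
  "path par vert x [] \<longleftrightarrow> x = 0"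
| "path par vert x (v # P) \<longleftrightarrow> x \<noteq> 0 \<and> vert x = v \<and> par x < x \<and> path par vert (par x) P"

lemma path_cong:
  "path par vert x P \<Longrightarrow> (\<And>y. y \<le> x \<Longrightarrow> par' y = par y \<and> vert' y = vert y) \<Longrightarrow> path par' vert' x P"
  by (induction P arbitrary: x) auto

context search_instance
begin

definition represents_instance :: "(nat \<Rightarrow> nat) \<Rightarrow> (nat \<Rightarrow> nat) \<Rightarrow> (nat \<Rightarrow> nat) \<Rightarrow> bool" where
  "represents_instance offset nbs cov \<longleftrightarrow> (\<forall>v\<in>V. segment nbs (offset v) (adj ! v) \<and>
     offset (Suc v) = offset v + length (adj ! v) \<and> cov v = of_bool (v \<in> S))"

abbreviation stores_instance :: "arrays \<Rightarrow> bool" where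
  "stores_instance M \<equiv> represents_instance (M a_offset) (M a_adj) (M a_cover)"

lemma in_V_iff: "v \<in> V \<longleftrightarrow> v < n"
  by (simp add: V_eq)

lemma stores_instance_input_arrays: "stores_instance (input_arrays adj S)"
proof -
  have offset: "input_arrays adj S a_offset v = length (concat (take v adj))" if "v \<le> n" for v
    using that by (auto simp: input_arrays_def nth_default_def nth_append le_less)
  have "segment (input_arrays adj S a_adj) (length (concat (take v adj))) (adj ! v)"
    if "v < n" for v
  proof -
    have "concat adj = concat (take v adj) @ adj ! v @ concat (drop (Suc v) adj)"
      using that by (metis concat.simps(2) concat_append id_take_nth_drop)
    then show ?thesis
      by (simp add: segment_def input_arrays_def nth_default_def nth_append)
  qed
  with offset show ?thesis
    by (simp add: represents_instance_def in_V_iff take_Suc_conv_app_nth)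
      (simp add: input_arrays_def nth_default_def in_V_iff)
qed

definition globals :: assertion where
  "globals R M \<longleftrightarrow> stores_instance M \<and>
     (\<forall>u. M a_mark u \<le> R r_stamp) \<and>
     R r_n = n \<and> R r_one = 1 \<and> R r_A = A \<and> R r_B = B \<and> R r_d = d \<and> R r_limit = d + 1"

definition scan_state :: "nat set \<Rightarrow> nat list \<Rightarrow> assertion" where
  "scan_state K L R M \<longleftrightarrow> (\<forall>u\<in>V. M a_mark u = R r_stamp \<longleftrightarrow> u \<in> K) \<and> (\<forall>u. M a_mark u \<le> R r_stamp) \<and>
     R r_list = length L \<and> segment (M a_list) 0 L"

definition scanned :: "nat list \<Rightarrow> nat set \<Rightarrow> nat list \<Rightarrow> nat \<Rightarrow> assertion" where
  "scanned us K L b R M \<longleftrightarrow> (\<exists>L'. scan_state (K \<union> (set us - S)) (L @ L') R M \<and>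
     distinct L' \<and> set L' = set us - S - K \<and>
     (R r_bad = 0 \<longleftrightarrow> b = 0 \<and> set us \<inter> S \<inter> K = {}))"

lemma wp_scan_vertex:
  assumes scanned: "scanned us K L b R M"
    and u: "M a_adj (R r_pos) = u" "u \<in> V" "M a_cover u = of_bool (u \<in> S)" and one: "R r_one = 1"
  shows "wp scan_vertex_com 14
    (\<lambda>R' M'. scanned (us @ [u]) K L b R' M' \<and> R' r_pos = R r_pos + 1) R M"
proof -
  let ?K = "K \<union> (set us - S)" and ?fresh = "R r_stamp - M a_mark u"
  from scanned obtain L' where state: "scan_state ?K (L @ L') R M"
      and L': "distinct L'" "set L' = set us - S - K"
      and bad: "R r_bad = 0 \<longleftrightarrow> b = 0 \<and> set us \<inter> S \<inter> K = {}"
    unfolding scanned_def by metis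
  have fresh: "?fresh = 0 \<longleftrightarrow> u \<in> ?K"
    using state u(2) unfolding scan_state_def by (metis diff_is_0_eq le_antisym order_refl)
  show ?thesis
  proof (cases "u \<in> ?K \<or> u \<in> S")
    case True
    have "scanned (us @ [u]) K L b R' M"
      if "R' r_bad = R r_bad + (M a_cover u - ?fresh)" "R' r_stamp = R r_stamp"
        "R' r_list = R r_list" for R'
      unfolding scanned_def
      using that state L' bad fresh True u(3) by (intro exI[of _ L']) (auto simp: scan_state_def)
    then show ?thesis
      unfolding scan_vertex_com_def using fresh True u one
      by (intro wp_Cond) (auto intro!: wp_Block)
  next
    case False
    let ?M = "M(a_mark := (M a_mark)(u := R r_stamp), a_list := (M a_list)(R r_list := u))"
    have "scanned (us @ [u]) K L b R' ?M"
      if "R' r_bad = R r_bad" "R' r_stamp = R r_stamp" "R' r_list = Suc (R r_list)" for R'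
    proof -
      have "segment ((M a_list)(length (L @ L') := u)) 0 ((L @ L') @ [u])"
        using state by (intro segment_snoc) (simp add: scan_state_def)
      then have "scan_state (K \<union> (set (us @ [u]) - S)) (L @ (L' @ [u])) R' ?M"
        using that state False by (auto simp: scan_state_def)
      with that L' bad False show ?thesis
        unfolding scanned_def by (intro exI[of _ "L' @ [u]"]) auto
    qed
    then show ?thesis
      unfolding scan_vertex_com_def using fresh False u one
      by (intro wp_Cond) (auto intro!: wp_Block)
  qed
qed

lemma wp_scan:
  assumes input: "stores_instance M" and one: "R r_one = 1"
    and state: "scan_state K L R M"
    and us: "R r_stop = R r_pos + length us" "segment (M a_adj) (R r_pos) us" "set us \<subseteq> V"
  shows "wp scan_com (17 * length us + 2) (scanned us K L (R r_bad)) R M"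
  unfolding scan_com_def
proof (rule wp_foreach[where xs = us and c = "\<lambda>_. 14" and
      Inv = "\<lambda>vs R' M'. scanned vs K L (R r_bad) R' M' \<and> R' r_pos = R r_pos + length vs"])
  show "scanned [] K L (R r_bad) R M \<and> R r_pos = R r_pos + length []"
    using state by (simp add: scanned_def)
next
  fix vs u ws R' M'
  assume us_eq: "us = vs @ u # ws"
    and inv: "scanned vs K L (R r_bad) R' M' \<and> R' r_pos = R r_pos + length vs"
    and frame: "frame (While [Sub r_test r_stop r_pos] r_test scan_vertex_com) R M R' M'"
  have same: "R' r_one = 1" "R' r_stop = R r_stop" "M' a_adj = M a_adj" "M' a_cover = M a_cover"
    using frame one by (simp_all add: frame_def scan_vertex_com_def)
  let ?R = "R'(r_test := R' r_stop - R' r_pos)"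
  have u: "u \<in> V" "M' a_adj (R' r_pos) = u" "M' a_cover u = of_bool (u \<in> S)"
    using us us_eq inv same input segment_nth by (auto simp: represents_instance_def)
  have "wp scan_vertex_com 14
      (\<lambda>S' M'. scanned (vs @ [u]) K L (R r_bad) S' M' \<and> S' r_pos = ?R r_pos + 1) ?R M'"
    by (rule wp_scan_vertex) (use inv same u in \<open>simp_all add: scanned_def scan_state_def\<close>)
  then show "case exec_block [Sub r_test r_stop r_pos] (R', M') of (R'', M'') \<Rightarrow> R'' r_test \<noteq> 0 \<and>
      wp scan_vertex_com 14
        (\<lambda>R' M'. scanned (vs @ [u]) K L (R r_bad) R' M' \<and>
          R' r_pos = R r_pos + length (vs @ [u])) R'' M''"
    using us(1) us_eq inv same by simp
next
  fix R' M'
  assume "scanned us K L (R r_bad) R' M' \<and> R' r_pos = R r_pos + length us"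
    and frame: "frame (While [Sub r_test r_stop r_pos] r_test scan_vertex_com) R M R' M'"
  then show "case exec_block [Sub r_test r_stop r_pos] (R', M') of (R'', M'') \<Rightarrow> R'' r_test = 0 \<and>
      scanned us K L (R r_bad) R'' M''"
    using us(1) by (simp add: frame_def scan_vertex_com_def scanned_def scan_state_def)
qed (auto simp: sum_list_triv)

definition visited :: "nat list \<Rightarrow> assertion" where
  "visited P R M \<longleftrightarrow> (\<exists>L. scan_state (set P \<union> outer (set P)) L R M \<and> R r_len = length P \<and>
     (R r_bad = 0 \<longleftrightarrow> distinct P \<and> set P \<subseteq> S \<and> independent (set P)) \<and>
     (R r_bad = 0 \<longrightarrow> outer_list P L))"

lemma independent_snoc_iff:
  assumes "set P \<subseteq> S" "v \<in> S"
  shows "distinct (P @ [v]) \<and> independent (set (P @ [v])) \<longleftrightarrow>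
    distinct P \<and> independent (set P) \<and> v \<notin> set P \<union> outer (set P) \<and>
    nb v \<inter> S \<inter> insert v (set P \<union> outer (set P)) = {}"
  using assms not_nb_self[of v] by (auto simp: independent_insert outer_def)

lemma visited_snoc:
  assumes L: "independent (set P) \<Longrightarrow> distinct P \<Longrightarrow> set P \<subseteq> S \<Longrightarrow> outer_list P L" and v: "v \<in> V"
    and scanned: "scanned (adj ! v) (insert v (set P \<union> outer (set P))) L b R M"
    and b: "b = 0 \<longleftrightarrow> distinct P \<and> set P \<subseteq> S \<and> independent (set P) \<and>
      v \<notin> set P \<union> outer (set P) \<and> v \<in> S"
    and len: "R r_len = length P + 1"
  shows "visited (P @ [v]) R M"
proof -
  let ?K = "insert v (set P \<union> outer (set P))"
  from scanned obtain L' where state: "scan_state (?K \<union> (nb v - S)) (L @ L') R M"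
      and L': "distinct L'" "set L' = nb v - S - ?K"
      and bad: "R r_bad = 0 \<longleftrightarrow> b = 0 \<and> nb v \<inter> S \<inter> ?K = {}"
    unfolding scanned_def set_adj[OF v] by metis
  have bad_iff: "R r_bad = 0 \<longleftrightarrow> distinct (P @ [v]) \<and> set (P @ [v]) \<subseteq> S \<and> independent (set (P @ [v]))"
    using independent_snoc_iff[of P v] unfolding bad b by (cases "set P \<subseteq> S \<and> v \<in> S") auto
  have "outer_list (P @ [v]) (L @ L')" if "R r_bad = 0"
  proof -
    have "outer_list P L" "v \<in> S"
      using that L bad b by auto
    with L' that bad_iff show ?thesis
      by (auto simp: outer_list_def outer_insert)
  qed
  moreover have "?K \<union> (nb v - S) = set (P @ [v]) \<union> outer (set (P @ [v]))"
    by (auto simp: outer_insert)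
  ultimately show ?thesis
    unfolding visited_def using state bad_iff len by (intro exI[of _ "L @ L'"]) simp
qed

lemma exec_visit_code:
  assumes "stores_instance M" "R r_one = 1"
    and "M a_vertex (R r_path) = v" "v \<in> V"
  obtains R' where "exec_block visit_code (R, M) = (R', M(a_mark := (M a_mark)(v := R r_stamp)))"
    and "R' r_bad = R r_bad + (1 - (R r_stamp - M a_mark v)) + (1 - of_bool (v \<in> S))"
    and "R' r_len = R r_len + 1" "R' r_path = M a_parent (R r_path)"
    and "R' r_pos = M a_offset v" "R' r_stop = M a_offset v + length (adj ! v)"
    and "R' r_one = 1" "R' r_stamp = R r_stamp" "R' r_list = R r_list"
proof -
  obtain R' M' where code: "exec_block visit_code (R, M) = (R', M')"
    by (cases "exec_block visit_code (R, M)")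
  with assms have "M' = M(a_mark := (M a_mark)(v := R r_stamp))"
    by (auto simp: visit_code_def load_adj_def)
  with assms code show thesis
    by (intro that[of R']) (auto simp: visit_code_def load_adj_def represents_instance_def)
qed

lemma wp_visit:
  assumes input: "stores_instance M" and one: "R r_one = 1"
    and visited: "visited P R M" and v: "M a_vertex (R r_path) = v" "v \<in> V"
  shows "wp visit_com (17 * D)
    (\<lambda>R' M'. visited (P @ [v]) R' M' \<and> R' r_path = M a_parent (R r_path)) R M"
    (is "wp _ _ ?Q _ _")
proof -
  let ?K = "insert v (set P \<union> outer (set P))"
  from visited obtain L where state: "scan_state (set P \<union> outer (set P)) L R M"
      and len: "R r_len = length P"
      and bad: "R r_bad = 0 \<longleftrightarrow> distinct P \<and> set P \<subseteq> S \<and> independent (set P)"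
      and L: "R r_bad = 0 \<Longrightarrow> outer_list P L"
    unfolding visited_def by metis
  let ?M = "M(a_mark := (M a_mark)(v := R r_stamp))"
  let ?b = "R r_bad + (1 - (R r_stamp - M a_mark v)) + (1 - of_bool (v \<in> S))"
  from input one v obtain R1 where code: "exec_block visit_code (R, M) = (R1, ?M)"
      and R1: "R1 r_bad = ?b" "R1 r_len = R r_len + 1" "R1 r_path = M a_parent (R r_path)"
        "R1 r_pos = M a_offset v" "R1 r_stop = M a_offset v + length (adj ! v)"
        "R1 r_one = 1" "R1 r_stamp = R r_stamp" "R1 r_list = R r_list"
    by (rule exec_visit_code)
  have start: "scan_state ?K L R1 ?M"
    using state v R1 by (auto simp: scan_state_def)
  have "wp scan_com (17 * length (adj ! v) + 2) (scanned (adj ! v) ?K L ?b) R1 ?M"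
    unfolding R1(1)[symmetric]
    by (rule wp_scan[OF _ _ start])
      (use input R1 v adj_subset_V in \<open>simp_all add: represents_instance_def\<close>)
  then have scan: "wp scan_com (17 * length (adj ! v) + 2) ?Q R1 ?M"
  proof (rule wp_mono)
    fix R' M'
    assume scanned: "scanned (adj ! v) ?K L ?b R' M'" and frame: "frame scan_com R1 ?M R' M'"
    have fresh: "R r_stamp - M a_mark v = 0 \<longleftrightarrow> v \<in> set P \<union> outer (set P)"
      using state v(2) unfolding scan_state_def by (metis diff_is_0_eq le_antisym order_refl)
    have "visited (P @ [v]) R' M'"
    proof (rule visited_snoc[OF _ v(2) scanned])
      show "?b = 0 \<longleftrightarrow> distinct P \<and> set P \<subseteq> S \<and> independent (set P) \<and>
          v \<notin> set P \<union> outer (set P) \<and> v \<in> S"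
        using bad fresh by auto
    qed (use L bad frame R1 len in \<open>simp_all add: frame_def\<close>)
    then show "visited (P @ [v]) R' M' \<and> R' r_path = M a_parent (R r_path)"
      using frame R1 by (simp add: frame_def)
  qed simp
  show ?thesis
    unfolding visit_com_def
    by (rule wp_Block_Seq[where T = "17 * length (adj ! v) + 2"])
      (use code scan length_adj_less[OF v(2)] in \<open>auto simp: visit_code_def load_adj_def\<close>)
qed

definition evaluated :: "nat list \<Rightarrow> assertion" where
  "evaluated P R M \<longleftrightarrow> R r_len = length P \<and> (R r_bad = 0 \<longleftrightarrow> admissible P) \<and>
     (admissible P \<longrightarrow> (\<exists>L. outer_list P L \<and> R r_list = length L \<and> segment (M a_list) 0 L))"

lemma evaluated_list: "evaluated P R M \<Longrightarrow> admissible P \<Longrightarrow> R r_list = card (outer (set P))"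
  using length_outer_list by (auto simp: evaluated_def)

lemma evaluated_of_visited:
  assumes "visited P R M"
  shows "evaluated P (R(r_test := x, r_bad := R r_bad + (R r_list - B))) M"
proof -
  from assms obtain L where L: "R r_list = length L" "segment (M a_list) 0 L"
      and len: "R r_len = length P"
      and bad: "R r_bad = 0 \<longleftrightarrow> distinct P \<and> set P \<subseteq> S \<and> independent (set P)"
      and outer: "R r_bad = 0 \<Longrightarrow> outer_list P L"
    unfolding visited_def scan_state_def by metis
  have "R r_bad + (R r_list - B) = 0 \<longleftrightarrow> admissible P"
    using L(1) bad length_outer_list[OF outer] by (auto simp: admissible_def feasible_def)
  then show ?thesis
    unfolding evaluated_def using L len outer by auto
qed

lemma wp_visit_path:
  assumes globals: "globals R M" and path: "path (M a_parent) (M a_vertex) (R r_path) P" "set P \<subseteq> V"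
    and start: "visited [] R M"
  shows "wp (While [] r_path visit_com) (20 * D * length P + 1)
    (\<lambda>R' M'. globals R' M' \<and> visited P R' M') R M"
proof (rule wp_foreach[where xs = P and c = "\<lambda>_. 17 * D" and
      Inv = "\<lambda>vs R' M'. visited vs R' M' \<and>
        path (M a_parent) (M a_vertex) (R' r_path) (drop (length vs) P)"])
  fix vs v ws R' M'
  assume P: "P = vs @ v # ws"
    and inv: "visited vs R' M' \<and> path (M a_parent) (M a_vertex) (R' r_path) (drop (length vs) P)"
    and frame: "frame (While [] r_path visit_com) R M R' M'"
  have same: "R' r_one = 1" "stores_instance M'"
      "M' a_vertex = M a_vertex" "M' a_parent = M a_parent"
    using frame globals
    by (simp_all add: frame_def visit_com_def visit_code_def load_adj_def globals_def)
  have "wp visit_com (17 * D)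
      (\<lambda>S' N'. visited (vs @ [v]) S' N' \<and> S' r_path = M a_parent (R' r_path)) R' M'"
    using wp_visit[of M' R' vs v] same inv path P by simp
  then have "wp visit_com (17 * D) (\<lambda>S' N'. visited (vs @ [v]) S' N' \<and>
      path (M a_parent) (M a_vertex) (S' r_path) (drop (length (vs @ [v])) P)) R' M'"
    by (rule wp_mono) (use inv P in auto)
  then show "case exec_block [] (R', M') of (R'', M'') \<Rightarrow> R'' r_path \<noteq> 0 \<and>
      wp visit_com (17 * D) (\<lambda>S' N'. visited (vs @ [v]) S' N' \<and>
        path (M a_parent) (M a_vertex) (S' r_path) (drop (length (vs @ [v])) P)) R'' M''"
    using inv P by simp
next
  fix R' M'
  assume "visited P R' M' \<and> path (M a_parent) (M a_vertex) (R' r_path) (drop (length P) P)"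
    and "frame (While [] r_path visit_com) R M R' M'"
  with globals show "case exec_block [] (R', M') of (R'', M'') \<Rightarrow> R'' r_path = 0 \<and>
      globals R'' M'' \<and> visited P R'' M''"
    by (auto simp: frame_def visit_com_def visit_code_def load_adj_def globals_def visited_def
      scan_state_def)
qed (use start path D_pos in \<open>simp_all add: sum_list_triv\<close>)

lemma wp_eval:
  assumes globals: "globals R M" and path: "path (M a_parent) (M a_vertex) (R r_node) P" "set P \<subseteq> V"
  shows "wp eval_com (20 * (length P + 1) * D) (\<lambda>R' M'. globals R' M' \<and> evaluated P R' M') R M"
  unfolding eval_com_def
proof (rule wp_Block_Seq[where T = "20 * D * length P + 3"])
  let ?R = "R(r_stamp := R r_stamp + 1, r_len := 0, r_list := 0, r_bad := 0, r_path := R r_node)"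
  have "M a_mark u \<le> R r_stamp" for u
    using globals by (simp add: globals_def)
  then have fresh: "M a_mark u \<le> R r_stamp + 1" "M a_mark u \<noteq> R r_stamp + 1" for u
    by (metis le_add1 le_trans, metis Suc_eq_plus1 not_less_eq_eq order_refl)
  have "wp (While [] r_path visit_com) (20 * D * length P + 1)
      (\<lambda>R' M'. globals R' M' \<and> visited P R' M') ?R M"
    by (rule wp_visit_path)
      (use globals path fresh in \<open>simp_all add: globals_def visited_def scan_state_def segment_def
        outer_empty independent_def outer_list_def\<close>)
  then have "wp (While [] r_path visit_com ;; Block [Sub r_test r_list r_B, Add r_bad r_bad r_test])
      (20 * D * length P + 3) (\<lambda>R' M'. globals R' M' \<and> evaluated P R' M') ?R M"
  proof (rule wp_Seq)
    fix R' M'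
    assume visited: "globals R' M' \<and> visited P R' M'"
    show "wp (Block [Sub r_test r_list r_B, Add r_bad r_bad r_test]) 2
        (\<lambda>R' M'. globals R' M' \<and> evaluated P R' M') R' M'"
      using visited evaluated_of_visited[of P R' M' "R' r_list - R' r_B"]
      by (intro wp_Block) (simp_all add: globals_def)
  qed simp
  then show "case_prod (wp (While [] r_path visit_com ;;
        Block [Sub r_test r_list r_B, Add r_bad r_bad r_test])
      (20 * D * length P + 3) (\<lambda>R' M'. globals R' M' \<and> evaluated P R' M'))
      (exec_block [Add r_stamp r_stamp r_one, Const r_len 0, Const r_list 0, Const r_bad 0,
        Copy r_path r_node] (R, M))"
    using globals by (simp add: globals_def)
qed (use D_pos in \<open>auto simp: algebra_simps\<close>)

end

section \<open>Extending the search tree\<close>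

definition push_vertex :: "instr list" where
  "push_vertex = [Store a_parent r_count r_parent, Store a_vertex r_count r_vertex,
     Store a_label r_count r_label, Add r_count r_count r_one]"

definition push_adj_com :: com where
  "push_adj_com = While [Sub r_test r_stop r_pos] r_test
     (Block ([Load r_vertex a_adj r_pos, Add r_pos r_pos r_one] @ push_vertex))"

definition expand_vertex_com :: com where
  "expand_vertex_com =
     Block ([Load r_vertex a_list r_index, Add r_index r_index r_one] @ push_vertex @ load_adj) ;;
     push_adj_com"

definition expand_com :: com where
  "expand_com =
     Block [Const r_index 0] ;; While [Sub r_test r_list r_index] r_test expand_vertex_com"

definition push_all_com :: com where
  "push_all_com =
     Block [Const r_vertex 0] ;;
     While [Sub r_test r_n r_vertex] r_test (Block (push_vertex @ [Add r_vertex r_vertex r_one]))"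

lemma written_push_adj_com [simp]:
  "written_regs push_adj_com = {r_count, r_pos, r_vertex, r_test}"
  "written_arrays push_adj_com = {a_parent, a_vertex, a_label}"
  by (auto simp: push_adj_com_def push_vertex_def)

lemma written_expand_com [simp]:
  "written_regs expand_com = {r_count, r_index, r_pos, r_stop, r_vertex, r_test}"
  "written_arrays expand_com = {a_parent, a_vertex, a_label}"
  by (auto simp: expand_com_def expand_vertex_com_def push_vertex_def load_adj_def)

lemma written_push_all_com [simp]:
  "written_regs push_all_com = {r_count, r_vertex, r_test}"
  "written_arrays push_all_com = {a_parent, a_vertex, a_label}"
  by (auto simp: push_all_com_def push_vertex_def)

text \<open>\<open>ns ! x\<close> is the list of vertices and the label of the node with number \<open>x\<close>. Node 0 is the
  root, and array entries from \<open>length ns\<close> on are irrelevant.\<close>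
definition tree :: "node list \<Rightarrow> (nat \<Rightarrow> nat) \<Rightarrow> (nat \<Rightarrow> nat) \<Rightarrow> (nat \<Rightarrow> nat) \<Rightarrow> bool" where
  "tree ns par vert lab \<longleftrightarrow> ns \<noteq> [] \<and>
     (\<forall>x<length ns. path par vert x (fst (ns ! x)) \<and> lab x = snd (ns ! x))"

definition node_at :: "node list \<Rightarrow> nat \<Rightarrow> nat list \<Rightarrow> bool" where
  "node_at ns x P \<longleftrightarrow> x < length ns \<and> fst (ns ! x) = P"

lemma node_at_append: "node_at ns x P \<Longrightarrow> node_at (ns @ zs) x P"
  by (simp add: node_at_def nth_append)

lemma node_at_middle: "node_at (ns @ (P, h) # qs) (length ns) P"
  by (simp add: node_at_def)

lemma tree_snoc:
  assumes "tree ns par vert lab" "node_at ns p P"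
  shows "tree (ns @ [(w # P, h)])
    (par(length ns := p)) (vert(length ns := w)) (lab(length ns := h))"
    (is "tree _ ?par ?vert ?lab")
proof -
  have old: "path ?par ?vert x (fst (ns ! x))" if "x < length ns" for x
    by (rule path_cong[of par vert]) (use assms(1) that in \<open>auto simp: tree_def\<close>)
  moreover have "path ?par ?vert (length ns) (w # P)"
    using old[of p] assms by (simp add: tree_def node_at_def)
  ultimately show ?thesis
    using assms(1) by (auto simp: tree_def nth_append less_Suc_eq)
qed

lemma tree_prefix: "tree (ns @ zs) par vert lab \<Longrightarrow> ns \<noteq> [] \<Longrightarrow> tree ns par vert lab"
  unfolding tree_def by (metis length_append nth_append trans_less_add1)

lemma tree_nth:
  assumes "tree (ns @ (P, h) # qs) par vert lab"
  shows "path par vert (length ns) P" "lab (length ns) = h"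
  using assms by (auto simp: tree_def dest!: spec[of _ "length ns"])

definition stores_tree :: "node list \<Rightarrow> assertion" where
  "stores_tree ns R M \<longleftrightarrow> tree ns (M a_parent) (M a_vertex) (M a_label) \<and> R r_count = length ns"

lemma stores_tree_push:
  assumes "stores_tree ns R M" "node_at ns p P" "R' r_count = R r_count + 1"
  shows "stores_tree (ns @ [(w # P, h)]) R' (M(a_parent := (M a_parent)(R r_count := p),
    a_vertex := (M a_vertex)(R r_count := w), a_label := (M a_label)(R r_count := h)))"
  using assms tree_snoc by (simp add: stores_tree_def)

context search_instance
begin

lemma wp_push_adj:
  assumes tree: "stores_tree ns R M" and one: "R r_one = 1"
    and parent: "node_at ns (R r_parent) P"
    and us: "R r_stop = R r_pos + length us" "segment (M a_adj) (R r_pos) us"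
  shows "wp push_adj_com (9 * length us + 2) (stores_tree (ns @ children P (R r_label) us)) R M"
  unfolding push_adj_com_def
proof (rule wp_foreach[where xs = us and c = "\<lambda>_. 6" and
      Inv = "\<lambda>vs R' M'. stores_tree (ns @ children P (R r_label) vs) R' M' \<and>
        R' r_pos = R r_pos + length vs"],
    goal_cases straight init time body exit)
  case (body vs u ws R' M')
  have same: "R' r_one = 1" "R' r_parent = R r_parent" "R' r_label = R r_label"
    "R' r_stop = R r_stop" "M' a_adj = M a_adj"
    using body(3) one by (simp_all add: frame_def push_vertex_def)
  have u: "M a_adj (R' r_pos) = u"
    using us body by (simp add: segment_nth)
  have "stores_tree ((ns @ children P (R r_label) vs) @ [(u # P, R r_label)]) R'' (M'(
      a_parent := (M' a_parent)(R' r_count := R r_parent),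
      a_vertex := (M' a_vertex)(R' r_count := u),
      a_label := (M' a_label)(R' r_count := R r_label)))" if "R'' r_count = R' r_count + 1" for R''
    using body(2) parent that by (intro stores_tree_push) (auto simp: node_at_append)
  with body same u us show ?case
    by (auto intro!: wp_Block simp: push_vertex_def)
qed (use tree us in \<open>auto simp: frame_def push_vertex_def stores_tree_def sum_list_triv\<close>)

lemma wp_push_all:
  assumes tree: "stores_tree ns R M" and globals: "R r_n = n" "R r_one = 1"
    and parent: "node_at ns (R r_parent) P"
  shows "wp push_all_com (8 * n + 3) (stores_tree (ns @ children P (R r_label) [0..<n])) R M"
  unfolding push_all_com_def
proof (rule wp_Block_Seq[where T = "8 * n + 2"], goal_cases straight time loop)
  case loop
  have "wp (While [Sub r_test r_n r_vertex] r_test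
      (Block (push_vertex @ [Add r_vertex r_vertex r_one])))
    (8 * n + 2) (stores_tree (ns @ children P (R r_label) [0..<n])) (R(r_vertex := 0)) M"
  proof (rule wp_foreach[where xs = "[0..<n]" and c = "\<lambda>_. 5" and
        Inv = "\<lambda>vs R' M'. stores_tree (ns @ children P (R r_label) vs) R' M' \<and>
          R' r_vertex = length vs"],
      goal_cases straight init time body exit)
    case (body vs v ws R' M')
    have same: "R' r_n = n" "R' r_one = 1" "R' r_parent = R r_parent" "R' r_label = R r_label"
      using body(3) globals by (simp_all add: frame_def push_vertex_def)
    have v: "length vs < n" "v = length vs"
    proof -
      have "n = length (vs @ v # ws)"
        using body(1) by (metis length_upt diff_zero)
      then show "length vs < n"
        by simp
      then show "v = length vs"
        using body(1) by (metis add_0 nth_append_length nth_upt)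
    qed
    have "stores_tree ((ns @ children P (R r_label) vs) @ [(v # P, R r_label)]) R'' (M'(
        a_parent := (M' a_parent)(R' r_count := R r_parent),
        a_vertex := (M' a_vertex)(R' r_count := v),
        a_label := (M' a_label)(R' r_count := R r_label)))"
      if "R'' r_count = R' r_count + 1" for R''
      using body(2) parent that by (intro stores_tree_push) (auto simp: node_at_append)
    with body(2) same v show ?case
      by (auto intro!: wp_Block simp: push_vertex_def)
  qed (use tree globals in \<open>auto simp: frame_def push_vertex_def stores_tree_def sum_list_triv\<close>)
  then show ?case
    by simp
qed auto

lemma wp_expand_vertex:
  assumes input: "stores_instance M" and one: "R r_one = 1"
    and tree: "stores_tree ns R M" and parent: "node_at ns (R r_parent) P"
    and u: "M a_list (R r_index) = u" "u \<in> V"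
  shows "wp expand_vertex_com (9 * length (adj ! u) + 11)
    (\<lambda>R' M'. stores_tree (ns @ children P (R r_label) (u # adj ! u)) R' M' \<and>
      R' r_index = R r_index + 1) R M"
    (is "wp _ _ ?Q _ _")
proof -
  let ?M = "M(a_parent := (M a_parent)(R r_count := R r_parent),
      a_vertex := (M a_vertex)(R r_count := u), a_label := (M a_label)(R r_count := R r_label))"
  have "wp push_adj_com (9 * length (adj ! u) + 2) ?Q R' ?M"
    if R': "R' r_count = R r_count + 1" "R' r_one = 1" "R' r_parent = R r_parent"
      "R' r_label = R r_label" "R' r_index = R r_index + 1" "R' r_pos = M a_offset u"
      "R' r_stop = R' r_pos + length (adj ! u)" for R'
  proof -
    let ?ns = "ns @ [(u # P, R r_label)]"
    have "stores_tree ?ns R' ?M"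
      using tree parent R'(1) by (intro stores_tree_push)
    then have "wp push_adj_com (9 * length (adj ! u) + 2)
        (stores_tree (?ns @ children P (R' r_label) (adj ! u))) R' ?M"
      by (rule wp_push_adj)
        (use R' parent input u(2) in \<open>auto simp: represents_instance_def node_at_append\<close>)
    then show ?thesis
      by (rule wp_mono) (use R' in \<open>auto simp: frame_def\<close>)
  qed
  then show ?thesis
    unfolding expand_vertex_com_def using one u input
    by (intro wp_Block_Seq[where T = "9 * length (adj ! u) + 2"])
      (auto simp: push_vertex_def load_adj_def represents_instance_def)
qed

lemma wp_expand:
  assumes input: "stores_instance M" and one: "R r_one = 1"
    and tree: "stores_tree ns R M" and parent: "node_at ns (R r_parent) P"
    and L: "R r_list = length L" "segment (M a_list) 0 L" "set L \<subseteq> V"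
  shows "wp expand_com (14 * D * length L + 3)
    (stores_tree (ns @ children P (R r_label) (closed_nbs L))) R M"
  unfolding expand_com_def
proof (rule wp_Block_Seq[where T = "14 * D * length L + 2"], goal_cases straight time loop)
  case loop
  have "wp (While [Sub r_test r_list r_index] r_test expand_vertex_com) (14 * D * length L + 2)
      (stores_tree (ns @ children P (R r_label) (closed_nbs L))) (R(r_index := 0)) M"
  proof (rule wp_foreach[where xs = L and c = "\<lambda>_. 14 * D - 3" and
        Inv = "\<lambda>vs R' M'. stores_tree (ns @ children P (R r_label) (closed_nbs vs)) R' M' \<and>
          R' r_index = length vs"],
      goal_cases straight init time body exit)
    case (body vs u ws R' M')
    let ?ns = "ns @ children P (R r_label) (closed_nbs vs)"
      and ?R = "R'(r_test := R' r_list - R' r_index)"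
    have same: "R' r_one = 1" "R' r_parent = R r_parent" "R' r_label = R r_label"
      "R' r_list = R r_list" "M' a_list = M a_list" "stores_instance M'"
      using body(3) one input
      by (simp_all add: frame_def expand_vertex_com_def push_vertex_def load_adj_def)
    have u: "u \<in> V" "M a_list (length vs) = u"
      using L body(1) segment_nth[of "M a_list" 0 vs u ws] by auto
    have "wp expand_vertex_com (9 * length (adj ! u) + 11) (\<lambda>S' N'.
        stores_tree (?ns @ children P (?R r_label) (u # adj ! u)) S' N' \<and>
          S' r_index = ?R r_index + 1) ?R M'"
      by (rule wp_expand_vertex)
        (use body(2) same parent u in \<open>auto simp: node_at_append stores_tree_def\<close>)
    then have "wp expand_vertex_com (14 * D - 3)
        (\<lambda>S' N'. stores_tree (ns @ children P (R r_label) (closed_nbs (vs @ [u]))) S' N' \<and>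
          S' r_index = length (vs @ [u])) ?R M'"
      by (rule wp_mono)
        (use length_adj_less[OF u(1)] body(2) same in \<open>auto simp: closed_nbs_snoc\<close>)
    then show ?case
      using body L(1) same by simp
  next
    case time
    have "14 * D - 3 + length [Sub r_test r_list r_index] + 2 = 14 * D"
      using D_pos by simp
    then show ?case
      by (simp only: sum_list_triv) simp
  qed (use tree L in \<open>auto simp: frame_def expand_vertex_com_def push_vertex_def load_adj_def
    stores_tree_def closed_nbs_Nil\<close>)
  then show ?case
    by simp
qed auto

end

section \<open>The search for a new component\<close>

definition bfs_branch_com :: com where
  "bfs_branch_com =
     Cond [] r_bad (Block [])
       (Cond [Add r_test r_base_len r_list, Add r_test r_test r_goal,
              Add r_fresh r_len r_base_outer, Add r_fresh r_fresh r_base_label,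
              Sub r_test r_test r_fresh] r_test
          (Cond [Sub r_test r_A r_len] r_test (Block [Copy r_parent r_node] ;; expand_com)
            (Block []))
          (Block [Copy r_found r_node, Sub r_size r_len r_base_len, Copy r_head r_count]))"

definition bfs_step_com :: com where
  "bfs_step_com = Block [Copy r_node r_head, Add r_head r_head r_one] ;; eval_com ;; bfs_branch_com"

definition bfs_com :: com where
  "bfs_com = While [Sub r_test r_count r_head] r_test bfs_step_com"

definition find_com :: com where
  "find_com =
     Block [Copy r_saved r_count, Copy r_head r_count, Const r_size 0, Copy r_parent r_base] ;;
     push_all_com ;;
     bfs_com"

definition copy_com :: com where
  "copy_com = While [] r_size
     (Block [Load r_vertex a_vertex r_found, Store a_list r_list r_vertex,
       Load r_found a_parent r_found,
             Add r_list r_list r_one, Sub r_size r_size r_one])"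

text \<open>The breadth-first tree is discarded by resetting \<open>r_count\<close> before the vertices close to \<open>X\<close>
  are added to the search tree.\<close>
definition attach_com :: com where
  "attach_com =
     Block [Const r_list 0] ;;
     copy_com ;;
     Block [Copy r_count r_saved, Copy r_parent r_base, Copy r_label r_goal] ;;
     expand_com"

definition search_com :: com where
  "search_com = find_com ;; attach_com"

lemma written_bfs_branch_com [simp]:
  "written_regs bfs_branch_com = {r_count, r_head, r_found, r_size, r_parent, r_index, r_pos,
     r_stop, r_vertex, r_fresh, r_test}"
  "written_arrays bfs_branch_com = {a_parent, a_vertex, a_label}"
  by (auto simp: bfs_branch_com_def)

lemma written_bfs_step_com [simp]:
  "written_regs bfs_step_com = {r_stamp, r_count, r_head, r_found, r_size, r_parent, r_node,
     r_len, r_list, r_bad, r_path, r_index, r_pos, r_stop, r_vertex, r_fresh, r_cover, r_test}"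
  "written_arrays bfs_step_com = {a_parent, a_vertex, a_label, a_mark, a_list}"
  by (auto simp: bfs_step_com_def)

lemma written_bfs_com [simp]:
  "written_regs bfs_com = written_regs bfs_step_com"
  "written_arrays bfs_com = written_arrays bfs_step_com"
  by (auto simp: bfs_com_def)

lemma written_find_com [simp]:
  "written_regs find_com = insert r_saved (written_regs bfs_com)"
  "written_arrays find_com = written_arrays bfs_com"
  by (auto simp: find_com_def)

lemma written_copy_com [simp]:
  "written_regs copy_com = {r_found, r_size, r_list, r_vertex}"
  "written_arrays copy_com = {a_list}"
  by (auto simp: copy_com_def)

lemma written_search_com [simp]:
  "written_regs search_com = {r_saved, r_label} \<union> written_regs bfs_com"
  "written_arrays search_com = written_arrays bfs_com"
  by (auto simp: search_com_def attach_com_def)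

context search_instance
begin

lemma globals_frame:
  assumes "globals R M" "frame c R M R' M'"
    and "written_regs c \<inter> {r_n, r_one, r_A, r_B, r_d, r_limit, r_stamp} = {}"
    and "written_arrays c \<inter> {a_offset, a_adj, a_cover, a_mark} = {}"
  shows "globals R' M'"
  using assms by (simp add: globals_def frame_def)

definition base :: "nat list \<Rightarrow> nat \<Rightarrow> regs \<Rightarrow> bool" where
  "base P g R \<longleftrightarrow> R r_base_len = length P \<and> R r_base_outer = card (outer (set P)) \<and>
     R r_goal = R r_base_label + g"

definition bfs_running :: "node list \<Rightarrow> nat list \<Rightarrow> int \<Rightarrow> node list \<Rightarrow> assertion" where
  "bfs_running ns P t qs R M \<longleftrightarrow> (\<exists>ds. stores_tree (ns @ ds @ qs) R M \<and>
     R r_head = length (ns @ ds) \<and> R r_size = 0 \<and> queue P t (map fst qs))"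

definition bfs_popped :: "node list \<Rightarrow> nat list \<Rightarrow> int \<Rightarrow> nat list \<Rightarrow> node list \<Rightarrow> assertion" where
  "bfs_popped ns P t p qs R M \<longleftrightarrow> (\<exists>ds h. stores_tree (ns @ ds @ (p, h) # qs) R M \<and>
     R r_node = length (ns @ ds) \<and> R r_head = length (ns @ ds) + 1 \<and> R r_size = 0 \<and>
     queue P t (p # map fst qs))"

definition bfs_result :: "node list \<Rightarrow> nat list \<Rightarrow> int \<Rightarrow> nat list \<Rightarrow> assertion" where
  "bfs_result ns P t X R M \<longleftrightarrow> (\<exists>zs. stores_tree (ns @ zs) R M) \<and> search_result P t X \<and>
     R r_size = length X \<and> (X \<noteq> [] \<longrightarrow> path (M a_parent) (M a_vertex) (R r_found) (X @ P))"

definition bfs_inv :: "node list \<Rightarrow> nat list \<Rightarrow> int \<Rightarrow> nat \<Rightarrow> assertion" where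
  "bfs_inv ns P t m R M \<longleftrightarrow> globals R M \<and>
     ((\<exists>X. bfs_result ns P t X R M \<and> R r_head = R r_count) \<or>
      (\<exists>qs. bfs_running ns P t qs R M \<and> bfs_potential (map fst qs) \<le> m))"

lemma admissible_subset_V: "admissible P \<Longrightarrow> set P \<subseteq> V"
  using S_subset by (auto simp: admissible_def feasible_def)

lemma queue_head_subset_V: "queue P t (p # ps) \<Longrightarrow> admissible P \<Longrightarrow> set p \<subseteq> V"
  using admissible_subset_V[of P] by (auto simp: queue_def candidate_def)

lemma bfs_inv_skip:
  assumes "bfs_popped ns P t p qs R M" "globals R M" "queue P t (map fst qs)"
    and "node_bound + m = bfs_potential (p # map fst qs)"
  shows "bfs_inv ns P t m R M"
proof -
  obtain ds h where ds: "stores_tree (ns @ ds @ (p, h) # qs) R M"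
    "R r_head = length (ns @ ds) + 1" "R r_size = 0"
    using assms(1) by (auto simp: bfs_popped_def)
  then have "bfs_running ns P t qs R M"
    using assms(3) unfolding bfs_running_def by (intro exI[of _ "ds @ [(p, h)]"]) simp
  moreover have "bfs_potential (map fst qs) \<le> m"
    using assms(4) bfs_potential_tl[of "map fst qs" p] by simp
  ultimately show ?thesis
    using assms(2) unfolding bfs_inv_def by blast
qed

lemma wp_bfs_expand:
  assumes popped: "bfs_popped ns P t p qs R M" and globals: "globals R M"
    and p: "evaluated p R M" "admissible p" "gap (set p) < t" "length p < A"
    and potential: "node_bound + m = bfs_potential (p # map fst qs)"
  shows "wp (Block [Copy r_parent r_node] ;; expand_com) (14 * D * B + 4) (bfs_inv ns P t m) R M"
proof (rule wp_Block_Seq[where T = "14 * D * B + 3"], goal_cases straight time expand)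
  case expand
  let ?R = "R(r_parent := R r_node)"
  from popped obtain ds h where tree: "stores_tree (ns @ ds @ (p, h) # qs) R M"
      and R: "R r_node = length (ns @ ds)" "R r_head = length (ns @ ds) + 1" "R r_size = 0"
      and queue: "queue P t (p # map fst qs)"
    unfolding bfs_popped_def by metis
  from p obtain L where L: "outer_list p L" "R r_list = length L" "segment (M a_list) 0 L"
    unfolding evaluated_def by metis
  let ?ws = "closed_nbs L"
  have "node_at (ns @ ds @ (p, h) # qs) (R r_node) p"
    using node_at_middle[of "ns @ ds"] R(1) by simp
  then have "wp expand_com (14 * D * length L + 3)
      (stores_tree ((ns @ ds @ (p, h) # qs) @ children p (?R r_label) ?ws)) ?R M"
    by (intro wp_expand)
      (use globals tree L outer_list_subset_V in \<open>auto simp: globals_def stores_tree_def\<close>)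
  then have "wp expand_com (14 * D * B + 3) (bfs_inv ns P t m) ?R M"
  proof (rule wp_mono)
    fix R' M'
    let ?qs = "qs @ children p (R r_label) ?ws"
    have fst: "map fst ?qs = map fst qs @ extensions p ?ws"
      by simp
    assume "stores_tree ((ns @ ds @ (p, h) # qs) @ children p (?R r_label) ?ws) R' M'"
      and frame: "frame expand_com ?R M R' M'"
    moreover have "queue P t (map fst ?qs)"
      unfolding fst using queue p(2-4)
      by (rule queue_expand)
        (use L(1) outer_list_subset_V set_closed_nbs in \<open>simp add: outer_list_def\<close>)
    ultimately have "bfs_running ns P t ?qs R' M'"
      using R unfolding bfs_running_def by (intro exI[of _ "ds @ [(p, h)]"]) (simp add: frame_def)
    moreover have "bfs_potential (map fst ?qs) \<le> m"
      unfolding fst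
      using bfs_potential_expand[OF p(4), of ?ws "map fst qs"]
        length_closed_nbs_outer_list[OF p(2) L(1)] potential
      by (simp add: branching_def)
    moreover have "globals R' M'"
      using globals_frame[OF _ frame] globals by (simp add: globals_def)
    ultimately show "bfs_inv ns P t m R' M'"
      unfolding bfs_inv_def by blast
  qed (use length_outer_list_le[OF p(2) L(1)] in simp)
  then show ?case
    by simp
qed auto

lemma bfs_inv_found:
  assumes popped: "bfs_popped ns P t p qs R M" and globals: "globals R M"
    and p: "admissible p" "t \<le> gap (set p)"
  shows "bfs_inv ns P t m (R(r_found := R r_node, r_size := length p - length P,
    r_head := R r_count)) M"
proof -
  from popped obtain ds h where tree: "stores_tree (ns @ ds @ (p, h) # qs) R M"
      and node: "R r_node = length (ns @ ds)" and queue: "queue P t (p # map fst qs)"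
    unfolding bfs_popped_def by metis
  then obtain X where X: "p = X @ P"
    by (auto simp: queue_def candidate_def)
  have "smallest_target (set P) t (set (X @ P))"
    using queue_smallest_target[OF queue p] by (simp add: X)
  moreover from this have "\<exists>Y. target (set P) t Y"
    by (auto simp: is_arg_min_def)
  ultimately have "search_result P t X"
    using p(1) by (simp add: search_result_def X admissible_def)
  moreover have "tree ((ns @ ds) @ (p, h) # qs) (M a_parent) (M a_vertex) (M a_label)"
    using tree by (simp add: stores_tree_def)
  then have "path (M a_parent) (M a_vertex) (length (ns @ ds)) p"
    by (rule tree_nth)
  moreover have "\<exists>zs. stores_tree (ns @ zs) R M"
    using tree by blast
  ultimately show ?thesis
    using globals node X
    by (auto simp: bfs_inv_def bfs_result_def globals_def stores_tree_def intro!: exI[of _ X])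
qed

lemma wp_bfs_branch:
  assumes popped: "bfs_popped ns P t p qs R M" and globals: "globals R M" and p: "evaluated p R M"
    and base: "base P g R" "admissible P" "t = gap (set P) + int g"
    and potential: "node_bound + m = bfs_potential (p # map fst qs)"
  shows "wp bfs_branch_com (14 * D * B + 20) (bfs_inv ns P t m) R M"
proof -
  have queue: "queue P t (p # map fst qs)"
    using popped by (auto simp: bfs_popped_def)
  have len: "R r_len = length p" and bad: "R r_bad = 0 \<longleftrightarrow> admissible p" and depth: "R r_A = A"
    using p globals by (auto simp: evaluated_def globals_def)
  have unaffected: "bfs_popped ns P t p qs R' M" "globals R' M" "evaluated p R' M"
    if "\<And>r. r \<notin> {r_test, r_fresh} \<Longrightarrow> R' r = R r" for R'
    using popped globals p that
    by (simp_all add: bfs_popped_def globals_def evaluated_def stores_tree_def)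
  have test: "gap (set p) < t \<longleftrightarrow>
      length p + R r_base_outer + R r_base_label < length P + R r_list + R r_goal" if "admissible p"
    using base gap_less_iff[OF that base(2)] evaluated_list[OF p that]
    by (simp add: base_def add.assoc)
  consider (skip) "queue P t (map fst qs)" "\<not> admissible p \<or> gap (set p) < t \<and> \<not> length p < A"
    | (expand) "admissible p" "gap (set p) < t" "length p < A"
    | (found) "admissible p" "t \<le> gap (set p)"
    using queue_inadmissible[OF queue] queue_full[OF queue] by force
  then show ?thesis
  proof cases
    case skip
    then have "wp (Block []) T (bfs_inv ns P t m) R' M"
      if "\<And>r. r \<notin> {r_test, r_fresh} \<Longrightarrow> R' r = R r" for R' T
      using bfs_inv_skip[OF unaffected(1,2)[OF that] skip(1) potential] by (intro wp_Block) auto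
    with skip bad test base(1) len depth show ?thesis
      unfolding bfs_branch_com_def
      by (cases "admissible p") (auto simp: base_def intro!: wp_Cond)
  next
    case expand
    have "wp (Block [Copy r_parent r_node] ;; expand_com) T (bfs_inv ns P t m) R' M"
      if "\<And>r. r \<notin> {r_test, r_fresh} \<Longrightarrow> R' r = R r" "14 * D * B + 4 \<le> T" for R' T
      using wp_mono[OF wp_bfs_expand[OF unaffected[OF that(1)] expand potential] that(2)] by blast
    with expand bad test base(1) len depth show ?thesis
      unfolding bfs_branch_com_def
      by (auto simp: base_def intro!: wp_Cond)
  next
    case found
    have "bfs_inv ns P t m (R'(r_found := R' r_node, r_size := length p - length P,
      r_head := R' r_count)) M"
      if "\<And>r. r \<notin> {r_test, r_fresh} \<Longrightarrow> R' r = R r" for R'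
      using bfs_inv_found[OF unaffected(1,2)[OF that] found] .
    with found bad test base(1) len depth show ?thesis
      unfolding bfs_branch_com_def
      by (auto simp: base_def intro!: wp_Cond wp_Block)
  qed
qed

lemma node_bound_ge:
  assumes "l \<le> A"
  shows "20 * (l + 1) * D + 14 * D * B + 26 \<le> node_bound" "14 * D * l + 7 * l + 17 \<le> node_bound"
proof -
  let ?u = "(A + 1) * D"
  have l: "(l + 1) * D \<le> ?u" "D * l \<le> ?u" "l \<le> ?u" and B: "D * B \<le> ?u" and one: "1 \<le> ?u"
    using assms D_pos mult_le_mono[of l "A + 1" 1 D] mult_le_mono[of 1 "A + 1" 1 D]
      mult_le_mono1[of l "A + 1" D] mult_le_mono1[of B "A + 1" D]
    by (simp_all add: A_def mult.commute[of D])
  have bound: "20 * x + 14 * y + 26 * z \<le> node_bound" if "x \<le> ?u" "y \<le> ?u" "z \<le> ?u" for x y z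
    using that by (simp add: node_bound_def)
  show "20 * (l + 1) * D + 14 * D * B + 26 \<le> node_bound"
    using bound[OF l(1) B one] by (simp add: algebra_simps)
  show "14 * D * l + 7 * l + 17 \<le> node_bound"
    using bound[OF l(3,2) one] by (simp add: algebra_simps)
qed

lemma wp_bfs_step:
  assumes running: "bfs_running ns P t (z # qs) R M" and globals: "globals R M"
    and P: "base P g R" "admissible P" "t = gap (set P) + int g"
    and potential: "node_bound + m = bfs_potential (map fst (z # qs))"
  shows "wp bfs_step_com (node_bound - 3) (bfs_inv ns P t m) R M"
  unfolding bfs_step_com_def
proof -
  obtain p h where z: "z = (p, h)"
    by (cases z)
  from running obtain ds where tree: "stores_tree (ns @ ds @ (p, h) # qs) R M"
      and R: "R r_head = length (ns @ ds)" "R r_size = 0" and queue: "queue P t (p # map fst qs)"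
    unfolding bfs_running_def z by auto
  have p: "set p \<subseteq> V" "length p \<le> A"
    using queue_head_subset_V[OF queue P(2)] queue by (simp_all add: queue_def)
  let ?R = "R(r_node := R r_head, r_head := R r_head + 1)"
  have "tree ((ns @ ds) @ (p, h) # qs) (M a_parent) (M a_vertex) (M a_label)"
    using tree by (simp add: stores_tree_def)
  then have path: "path (M a_parent) (M a_vertex) (R r_head) p"
    unfolding R(1) by (rule tree_nth)
  have "wp eval_com (20 * (length p + 1) * D) (\<lambda>R' M'. globals R' M' \<and> evaluated p R' M') ?R M"
    by (rule wp_eval) (use globals path p in \<open>auto simp: globals_def\<close>)
  then have "wp (eval_com ;; bfs_branch_com) (20 * (length p + 1) * D + (14 * D * B + 20))
    (bfs_inv ns P t m) ?R M"
  proof (rule wp_Seq)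
    fix R' M'
    assume eval: "globals R' M' \<and> evaluated p R' M'" and frame: "frame eval_com ?R M R' M'"
    have "stores_tree (ns @ ds @ (p, h) # qs) R' M'"
      using tree frame by (simp add: stores_tree_def frame_def)
    then have "bfs_popped ns P t p qs R' M'"
      using R queue frame unfolding bfs_popped_def
      by (intro exI[of _ ds] exI[of _ h]) (simp add: frame_def)
    then show "wp bfs_branch_com (14 * D * B + 20) (bfs_inv ns P t m) R' M'"
      by (rule wp_bfs_branch) (use eval P potential z frame in \<open>auto simp: base_def frame_def\<close>)
  qed simp
  then show "wp (Block [Copy r_node r_head, Add r_head r_head r_one] ;; eval_com ;; bfs_branch_com)
      (node_bound - 3) (bfs_inv ns P t m) R M"
    using node_bound_ge(1)[OF p(2)] globals
    by (intro wp_Block_Seq[where T = "20 * (length p + 1) * D + (14 * D * B + 20)"])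
      (auto simp: globals_def)
qed

lemma bfs_result_exhausted:
  assumes "bfs_running ns P t [] R M" "admissible P"
  shows "bfs_result ns P t [] R M" "R r_head = R r_count"
  using assms queue_Nil
  by (auto simp: bfs_running_def bfs_result_def search_result_def stores_tree_def admissible_def)

lemma wp_bfs:
  assumes running: "bfs_running ns P t qs R M" and globals: "globals R M"
    and P: "base P g R" "admissible P" "t = gap (set P) + int g"
  shows "wp bfs_com (bfs_potential (map fst qs) + 2)
    (\<lambda>R' M'. globals R' M' \<and> (\<exists>X. bfs_result ns P t X R' M')) R M"
  unfolding bfs_com_def
proof (rule wp_While[where Inv = "bfs_inv ns P t" and m = "bfs_potential (map fst qs)"],
    goal_cases straight init time body)
  case (body m R' M')
  let ?R = "R'(r_test := R' r_count - R' r_head)"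
  have base: "base P g R'"
    using P(1) body(2) by (simp add: base_def frame_def)
  from body(1) have "(\<exists>X. bfs_result ns P t X R' M' \<and> R' r_head = R' r_count) \<or>
      (\<exists>qs. bfs_running ns P t qs R' M' \<and> bfs_potential (map fst qs) \<le> m)"
    by (simp add: bfs_inv_def)
  then consider (result) X where "bfs_result ns P t X R' M'" "R' r_head = R' r_count"
    | (running) z qs where "bfs_running ns P t (z # qs) R' M'"
      "bfs_potential (map fst (z # qs)) \<le> m"
    using bfs_result_exhausted[OF _ P(2)] by (metis neq_Nil_conv)
  then show ?case
  proof cases
    case result
    then show ?thesis
      using body(1) by (auto simp: bfs_inv_def globals_def bfs_result_def stores_tree_def)
  next
    case (running z qs)
    have "node_bound \<le> bfs_potential (map fst (z # qs))"
      using bfs_potential_tl[of "map fst qs" "fst z"] by simp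
    then obtain l where potential: "node_bound + l = bfs_potential (map fst (z # qs))"
      by (metis le_Suc_ex)
    have "wp bfs_step_com (node_bound - 3) (bfs_inv ns P t l) ?R M'"
      by (rule wp_bfs_step[OF _ _ _ P(2,3) potential])
        (use running(1) body(1) base in \<open>auto simp: bfs_running_def bfs_inv_def globals_def base_def
          stores_tree_def\<close>)
    moreover have "length [Sub r_test r_count r_head] + 2 + (node_bound - 3) + l \<le> m"
      using potential running(2) node_bound_ge(2)[of 0] by simp
    moreover have "?R r_test \<noteq> 0"
      using running(1) by (auto simp: bfs_running_def stores_tree_def)
    ultimately show ?thesis
      by auto
  qed
qed (use running globals in \<open>auto simp: bfs_inv_def\<close>)

lemma wp_find:
  assumes globals: "globals R M" and P: "base P g R" "admissible P" "length P < A"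
    and tree: "stores_tree ns R M" "node_at ns (R r_base) P"
  shows "wp find_com (8 * n + n * bfs_bound (A - Suc (length P)) + 9)
    (\<lambda>R' M'. globals R' M' \<and> R' r_saved = length ns \<and>
      (\<exists>X. bfs_result ns P (gap (set P) + int g) X R' M')) R M"
  unfolding find_com_def
proof (rule wp_Block_Seq[where T = "8 * n + n * bfs_bound (A - Suc (length P)) + 5"],
    goal_cases straight time search)
  case search
  let ?R = "R(r_saved := R r_count, r_head := R r_count, r_size := 0, r_parent := R r_base)"
  let ?t = "gap (set P) + int g" and ?qs = "children P (R r_label) [0..<n]"
  have "wp push_all_com (8 * n + 3) (stores_tree (ns @ children P (?R r_label) [0..<n])) ?R M"
    by (rule wp_push_all) (use globals tree in \<open>auto simp: globals_def stores_tree_def\<close>)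
  then have "wp (push_all_com ;; bfs_com) (8 * n + n * bfs_bound (A - Suc (length P)) + 5)
      (\<lambda>R' M'. globals R' M' \<and> R' r_saved = length ns \<and> (\<exists>X. bfs_result ns P ?t X R' M')) ?R M"
  proof (rule wp_Seq)
    fix R' M'
    assume tree': "stores_tree (ns @ children P (?R r_label) [0..<n]) R' M'"
      and frame: "frame push_all_com ?R M R' M'"
    have "queue P ?t (extensions P [0..<n])"
      using P(2,3) by (intro queue_start) (auto simp: admissible_def V_eq)
    then have running: "bfs_running ns P ?t ?qs R' M'"
      using tree tree' frame unfolding bfs_running_def
      by (intro exI[of _ "[]"]) (simp add: stores_tree_def frame_def comp_def)
    have "globals R' M'"
      using globals_frame[OF _ frame] globals by (simp add: globals_def)
    moreover have "base P g R'"
      using P(1) frame by (simp add: base_def frame_def)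
    ultimately have "wp bfs_com (bfs_potential (map fst ?qs) + 2)
        (\<lambda>R' M'. globals R' M' \<and> (\<exists>X. bfs_result ns P ?t X R' M')) R' M'"
      using wp_bfs[OF running] P(2) by blast
    moreover have "bfs_potential (map fst ?qs) = n * bfs_bound (A - Suc (length P))"
      using bfs_potential_extensions[of P "[0..<n]"] by (simp add: comp_def)
    ultimately show "wp bfs_com (n * bfs_bound (A - Suc (length P)) + 2)
        (\<lambda>R' M'. globals R' M' \<and> R' r_saved = length ns \<and> (\<exists>X. bfs_result ns P ?t X R' M')) R' M'"
      using tree(1) frame
      by (auto elim!: wp_mono simp: stores_tree_def frame_def)
  qed simp
  then show ?case
    by simp
qed auto

lemma wp_copy:
  assumes one: "R r_one = 1" and X: "R r_list = 0" "R r_size = length X"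
    and path: "X \<noteq> [] \<Longrightarrow> path (M a_parent) (M a_vertex) (R r_found) (X @ P)"
  shows "wp copy_com (7 * length X + 1)
    (\<lambda>R' M'. R' r_list = length X \<and> segment (M' a_list) 0 X) R M"
  unfolding copy_com_def
proof (rule wp_foreach[where xs = X and c = "\<lambda>_. 5" and
      Inv = "\<lambda>vs R' M'. R' r_list = length vs \<and> segment (M' a_list) 0 vs \<and>
        R' r_size = length X - length vs \<and>
        (length vs < length X \<longrightarrow> path (M a_parent) (M a_vertex) (R' r_found)
          (drop (length vs) X @ P))"],
    goal_cases straight init time body exit)
  case (body vs v ws R' M')
  have "R' r_one = 1" "M' a_parent = M a_parent" "M' a_vertex = M a_vertex"
    using body(3) one by (simp_all add: frame_def)
  with body(1,2) segment_snoc[of "M' a_list" vs v] show ?case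
    by (auto intro!: wp_Block)
qed (use X path in \<open>auto simp: segment_def sum_list_triv\<close>)

lemma wp_attach:
  assumes globals: "globals R M" and result: "bfs_result ns P t X R M"
    and tree: "R r_saved = length ns" "node_at ns (R r_base) P"
  shows "wp attach_com (14 * D * length X + 7 * length X + 8)
    (\<lambda>R' M'. globals R' M' \<and> stores_tree (ns @ children P (R r_goal) (closed_nbs X)) R' M') R M"
  unfolding attach_com_def
proof (rule wp_Block_Seq[where T = "14 * D * length X + 7 * length X + 7"],
  goal_cases straight time attach)
  case attach
  let ?R = "R(r_list := 0)"
  let ?expand = "Block [Copy r_count r_saved, Copy r_parent r_base, Copy r_label r_goal] ;;
    expand_com"
  let ?Q = "\<lambda>R' M'. globals R' M' \<and> stores_tree (ns @ children P (R r_goal) (closed_nbs X)) R' M'"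
  have "wp copy_com (7 * length X + 1)
    (\<lambda>R' M'. R' r_list = length X \<and> segment (M' a_list) 0 X) ?R M"
    by (rule wp_copy[where P = P]) (use globals result in \<open>auto simp: globals_def bfs_result_def\<close>)
  then have "wp (copy_com ;; ?expand) (14 * D * length X + 7 * length X + 7) ?Q ?R M"
  proof (rule wp_Seq)
    fix R' M'
    assume X: "R' r_list = length X \<and> segment (M' a_list) 0 X"
      and frame: "frame copy_com ?R M R' M'"
    let ?R' = "R'(r_count := R' r_saved, r_parent := R' r_base, r_label := R' r_goal)"
    have globals': "globals R' M'"
      using globals_frame[OF _ frame] globals by (simp add: globals_def)
    obtain zs where "tree (ns @ zs) (M a_parent) (M a_vertex) (M a_label)"
      using result by (auto simp: bfs_result_def stores_tree_def)
    then have "tree ns (M a_parent) (M a_vertex) (M a_label)"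
      by (rule tree_prefix) (use tree(2) in \<open>auto simp: node_at_def\<close>)
    then have stored: "stores_tree ns ?R' M'"
      using frame tree(1) by (simp add: stores_tree_def frame_def)
    have "set X \<subseteq> V"
      using result search_result_subset_V[of P t X] by (simp add: bfs_result_def)
    then have "wp expand_com (14 * D * length X + 3)
        (stores_tree (ns @ children P (?R' r_label) (closed_nbs X))) ?R' M'"
      using globals' tree(2) frame X
      by (intro wp_expand[OF _ _ stored]) (simp_all add: globals_def frame_def)
    then have "wp expand_com (14 * D * length X + 3) ?Q ?R' M'"
    proof (rule wp_mono)
      fix R'' M''
      assume "stores_tree (ns @ children P (?R' r_label) (closed_nbs X)) R'' M''"
        and "frame expand_com ?R' M' R'' M''"
      with globals' frame globals_frame[of ?R' M' expand_com R'' M''] show "?Q R'' M''"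
        by (simp add: globals_def frame_def)
    qed simp
    then show "wp ?expand (14 * D * length X + 6) ?Q R' M'"
      by (intro wp_Block_Seq[where T = "14 * D * length X + 3"]) auto
  qed simp
  then show ?case
    by simp
qed auto

lemma wp_search:
  assumes globals: "globals R M" and P: "base P g R" "admissible P" "length P < A"
    and tree: "stores_tree ns R M" "node_at ns (R r_base) P"
  shows "wp search_com (search_bound (A - Suc (length P)))
    (\<lambda>R' M'. globals R' M' \<and> (\<exists>X. search_result P (gap (set P) + int g) X \<and>
      stores_tree (ns @ children P (R r_goal) (closed_nbs X)) R' M')) R M"
  unfolding search_com_def
proof (rule wp_Seq[OF wp_find[OF assms]])
  fix R' M'
  assume found: "globals R' M' \<and> R' r_saved = length ns \<and>
    (\<exists>X. bfs_result ns P (gap (set P) + int g) X R' M')"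
    and frame: "frame find_com R M R' M'"
  then obtain X where result: "bfs_result ns P (gap (set P) + int g) X R' M'"
    by blast
  have same: "R' r_base = R r_base" "R' r_goal = R r_goal"
    using frame by (simp_all add: frame_def)
  have X: "search_result P (gap (set P) + int g) X"
    using result by (simp add: bfs_result_def)
  have "wp attach_com (14 * D * length X + 7 * length X + 8)
      (\<lambda>R' M'. globals R' M' \<and> stores_tree (ns @ children P (R r_goal) (closed_nbs X)) R' M') R' M'"
    using wp_attach[OF _ result] found tree(2) same by simp
  then show "wp attach_com (node_bound - 9) (\<lambda>R' M'. globals R' M' \<and>
      (\<exists>X. search_result P (gap (set P) + int g) X \<and>
        stores_tree (ns @ children P (R r_goal) (closed_nbs X)) R' M')) R' M'"
    by (rule wp_mono) (use node_bound_ge(2)[OF length_search_result_le_A[OF X]] X in auto)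
qed (use node_bound_ge(2)[of 0] in \<open>simp add: search_bound_def\<close>)

end

section \<open>The algorithm\<close>

definition starts_com :: com where
  "starts_com =
     While [Sub r_test r_limit r_goal] r_test (search_com ;; Block [Add r_goal r_goal r_one])"

definition grow_com :: com where
  "grow_com =
     Block [Copy r_base_len r_len, Copy r_base_outer r_list, Copy r_parent r_base,
            Copy r_label r_base_label] ;;
     expand_com ;;
     Block [Add r_goal r_base_label r_one] ;;
     starts_com"

definition decide_com :: com where
  "decide_com =
     Cond [] r_bad (Block [])
       (Cond [Add r_test r_d r_list, Sub r_test r_test r_len] r_test
          (Cond [Sub r_test r_A r_len] r_test grow_com (Block []))
          (Block [Const r_result 1, Copy r_current r_count]))"

definition node_com :: com where
  "node_com =
     Block [Copy r_base r_current, Copy r_node r_current, Load r_base_label a_label r_current,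
            Add r_current r_current r_one] ;;
     eval_com ;;
     decide_com"

definition main_com :: com where
  "main_com = While [Sub r_test r_count r_current] r_test node_com"

definition half_com :: com where
  "half_com = While [Sub r_test r_fresh r_one] r_test
     (Block [Add r_B r_B r_one, Sub r_fresh r_fresh r_one, Sub r_fresh r_fresh r_one])"

definition prog :: com where
  "prog =
     Block [Const r_one 1, Sub r_fresh r_k r_d, Const r_B 0] ;;
     half_com ;;
     Block [Add r_A r_B r_d, Const r_count 1, Add r_limit r_d r_one] ;;
     main_com ;;
     Block [Copy 0 r_result]"

lemma written_starts_com [simp]:
  "written_regs starts_com = insert r_goal (written_regs search_com)"
  "written_arrays starts_com = written_arrays search_com"
  by (auto simp: starts_com_def)

lemma written_half_com [simp]:
  "written_regs half_com = {r_B, r_fresh, r_test}" "written_arrays half_com = {}"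
  by (auto simp: half_com_def)

lemma wp_half:
  assumes "R r_one = 1" "R r_B = 0"
  shows "wp half_com (6 * (R r_fresh div 2) + 2) (\<lambda>R' M'. R' r_B = R r_fresh div 2) R M"
  unfolding half_com_def
proof (rule wp_foreach[where xs = "[0..<R r_fresh div 2]" and c = "\<lambda>_. 3" and
      Inv = "\<lambda>vs R' M'. R' r_B = length vs \<and> R' r_fresh = R r_fresh - 2 * length vs"],
    goal_cases straight init time body exit)
  case (body vs v ws R' M')
  have "R r_fresh div 2 = length (vs @ v # ws)"
    using body(1) by (metis length_upt diff_zero)
  moreover have "R' r_one = 1"
    using body(3) assms(1) by (simp add: frame_def)
  ultimately show ?case
    using body(2) by (auto intro!: wp_Block)
next
  case (exit R' M')
  then have "R' r_one = 1"
    using assms(1) by (simp add: frame_def)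
  with exit show ?case
    by simp
qed (use assms in \<open>auto simp: sum_list_triv\<close>)

context search_instance
begin

subsection \<open>Trying all gaps\<close>

definition searched :: "nat list \<Rightarrow> nat \<Rightarrow> nat \<Rightarrow> node list \<Rightarrow> bool" where
  "searched P h j zs \<longleftrightarrow> (\<forall>z\<in>set zs. valid_node z) \<and>
     tree_potential zs \<le>
       (\<Sum>g\<leftarrow>[1..<j + 1]. (g + B) * D * tree_bound (A - Suc (length P)) (d - h - g)) \<and>
     (\<forall>g. 1 \<le> g \<longrightarrow> g \<le> j \<longrightarrow> gap_tried P h g (set zs))"

lemma searched_0: "searched P h 0 []"
  by (simp add: searched_def tree_potential_def)

lemma searched_Suc:
  assumes searched: "searched P h j zs" and P: "admissible P" "length P < A" "h + Suc j \<le> d"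
    and X: "search_result P (gap (set P) + int (Suc j)) X"
  shows "searched P h (Suc j) (zs @ children P (h + Suc j) (closed_nbs X))"
proof -
  let ?new = "children P (h + Suc j) (closed_nbs X)"
  have V: "set X \<subseteq> V"
    using search_result_subset_V[OF X] .
  have "length (closed_nbs X) \<le> length X * D"
    using length_closed_nbs[OF V] .
  also have "\<dots> \<le> (Suc j + B) * D"
    using length_search_result_le[OF X] by (intro mult_le_mono1) simp
  finally have "tree_potential ?new \<le>
    (Suc j + B) * D * tree_bound (A - Suc (length P)) (d - h - Suc j)"
    unfolding tree_potential_children by (simp only: diff_diff_left mult_le_mono1)
  then have "tree_potential (zs @ ?new) \<le>
      (\<Sum>g\<leftarrow>[1..<Suc j + 1]. (g + B) * D * tree_bound (A - Suc (length P)) (d - h - g))"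
    using searched by (simp add: searched_def tree_potential_append)
  moreover have "\<forall>z\<in>set ?new. valid_node z"
    using P closed_nbs_subset_V[OF V] admissible_subset_V by (auto simp: valid_node_def)
  moreover have "gap_tried P h g (set (zs @ ?new))" if "1 \<le> g" "g \<le> Suc j" for g
  proof (cases "g = Suc j")
    case True
    with X show ?thesis
      unfolding gap_tried_def by (intro exI[of _ X]) auto
  next
    case False
    with that have "gap_tried P h g (set zs)"
      using searched by (simp add: searched_def)
    then show ?thesis
      by (rule gap_tried_mono) simp
  qed
  ultimately show ?thesis
    using searched by (auto simp: searched_def)
qed

definition starts_inv :: "node list \<Rightarrow> nat list \<Rightarrow> nat \<Rightarrow> nat \<Rightarrow> assertion" where
  "starts_inv ns P h j R M \<longleftrightarrow> globals R M \<and> R r_goal = h + 1 + j \<and>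
     (\<exists>zs. stores_tree (ns @ zs) R M \<and> searched P h j zs)"

lemma wp_starts_step:
  assumes inv: "starts_inv ns P h j R M" and P: "admissible P" "length P < A"
    and less: "h + Suc j \<le> d"
    and base: "base P (Suc j) R" "node_at ns (R r_base) P"
  shows "wp (search_com ;; Block [Add r_goal r_goal r_one]) (search_bound (A - Suc (length P)) + 1)
    (starts_inv ns P h (Suc j)) R M"
proof -
  obtain zs where globals: "globals R M" and goal: "R r_goal = h + Suc j"
      and zs: "stores_tree (ns @ zs) R M" "searched P h j zs"
    using inv by (auto simp: starts_inv_def)
  have "wp search_com (search_bound (A - Suc (length P))) (\<lambda>R' M'. globals R' M' \<and>
      (\<exists>X. search_result P (gap (set P) + int (Suc j)) X \<and>
        stores_tree ((ns @ zs) @ children P (R r_goal) (closed_nbs X)) R' M')) R M"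
    by (rule wp_search[OF globals base(1) P zs(1) node_at_append[OF base(2)]])
  then show ?thesis
  proof (rule wp_Seq)
    fix R' M'
    assume "globals R' M' \<and> (\<exists>X. search_result P (gap (set P) + int (Suc j)) X \<and>
        stores_tree ((ns @ zs) @ children P (R r_goal) (closed_nbs X)) R' M')"
      and frame: "frame search_com R M R' M'"
    then obtain X where X: "search_result P (gap (set P) + int (Suc j)) X"
        "stores_tree (ns @ zs @ children P (h + Suc j) (closed_nbs X)) R' M'" and "globals R' M'"
      using goal by auto
    moreover have "R' r_goal = h + Suc j"
      using frame goal by (simp add: frame_def)
    ultimately show "wp (Block [Add r_goal r_goal r_one]) 1 (starts_inv ns P h (Suc j)) R' M'"
      using searched_Suc[OF zs(2) P less X(1)]
      by (intro wp_Block) (auto simp: starts_inv_def globals_def stores_tree_def)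
  qed simp
qed

lemma wp_starts:
  assumes globals: "globals R M" and P: "admissible P" "length P < A" and h: "h \<le> d"
    and base: "base P 1 R" "R r_base_label = h" "node_at ns (R r_base) P"
    and tree: "stores_tree ns R M"
  shows "wp starts_com ((d - h) * (search_bound (A - Suc (length P)) + 4) + 2)
    (\<lambda>R' M'. globals R' M' \<and> (\<exists>zs. stores_tree (ns @ zs) R' M' \<and> searched P h (d - h) zs)) R M"
  unfolding starts_com_def
proof (rule wp_foreach[where xs = "[0..<d - h]" and
      c = "\<lambda>_. search_bound (A - Suc (length P)) + 1" and
      Inv = "\<lambda>vs. starts_inv ns P h (length vs)"],
    goal_cases straight init time body exit)
  case init
  show ?case
    using globals base(1,2) tree searched_0[of P h] unfolding starts_inv_def base_def
    by (intro conjI exI[of _ "[]"]) simp_all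
next
  case (body vs v ws R' M')
  let ?R = "R'(r_test := R' r_limit - R' r_goal)"
  have "d - h = length (vs @ v # ws)"
    using body(1) by (metis length_upt diff_zero)
  then have less: "h + Suc (length vs) \<le> d"
    by simp
  have inv: "globals R' M'" "R' r_goal = h + 1 + length vs"
    using body(2) by (simp_all add: starts_inv_def)
  have start: "starts_inv ns P h (length vs) ?R M'" "base P (Suc (length vs)) ?R"
    "node_at ns (?R r_base) P"
    using body(2,3) inv base
    by (simp_all add: starts_inv_def globals_def stores_tree_def frame_def base_def)
  have "wp (search_com ;; Block [Add r_goal r_goal r_one]) (search_bound (A - Suc (length P)) + 1)
      (starts_inv ns P h (Suc (length vs))) ?R M'"
    by (rule wp_starts_step[OF start(1) P less start(2,3)])
  then show ?case
    using inv less by (simp add: globals_def)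
next
  case (exit R' M')
  then show ?case
    using h by (auto simp: starts_inv_def globals_def stores_tree_def)
qed (auto simp: sum_list_triv add_mult_distrib2)

subsection \<open>Processing a node\<close>

definition pending :: "node list \<Rightarrow> node list \<Rightarrow> assertion" where
  "pending ds qs R M \<longleftrightarrow> stores_tree (ds @ qs) R M \<and> R r_result = 0 \<and> (\<forall>z\<in>set qs. valid_node z) \<and>
     ((\<exists>J. solution J) \<longrightarrow> (\<exists>z\<in>set qs. promising_node z))"

definition main_inv :: "nat \<Rightarrow> assertion" where
  "main_inv m R M \<longleftrightarrow> globals R M \<and>
     (R r_result = 1 \<and> R r_current = R r_count \<and> (\<exists>J. solution J) \<or>
      (\<exists>ds qs. pending ds qs R M \<and> R r_current = length ds \<and> tree_potential qs \<le> m))"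

definition popped :: "nat list \<Rightarrow> nat \<Rightarrow> node list \<Rightarrow> assertion" where
  "popped P h qs R M \<longleftrightarrow> (\<exists>ds. pending ds ((P, h) # qs) R M \<and> R r_base = length ds \<and>
     R r_current = length ds + 1 \<and> R r_base_label = h)"

definition start_bound :: "nat list \<Rightarrow> nat \<Rightarrow> nat" where
  "start_bound P h =
     (if length P < A then (d - h) * (search_bound (A - Suc (length P)) + 6) else 0)"

lemma tree_potential_Cons:
  "tree_potential ((P, h) # qs) = tree_bound (A - length P) (d - h) + tree_potential qs"
  by (simp add: tree_potential_def)

lemma node_bound_start_bound_le: "node_bound + start_bound P h \<le> tree_bound (A - length P) (d - h)"
proof (cases "length P < A")
  case True
  then show ?thesis
    using tree_potential_expand[of P "[]" "[]" h] by (simp add: start_bound_def tree_potential_def)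
next
  case False
  then show ?thesis
    using node_bound_le_tree_bound by (simp add: start_bound_def)
qed

lemma main_inv_skip:
  assumes popped: "popped P h qs R M" and globals: "globals R M" and "\<not> promising_node (P, h)"
    and potential: "node_bound + start_bound P h + m = tree_potential ((P, h) # qs)"
  shows "main_inv m R M"
proof -
  obtain ds where ds: "pending ds ((P, h) # qs) R M" "R r_current = length ds + 1"
    using popped by (auto simp: popped_def)
  then have "pending (ds @ [(P, h)]) qs R M"
    using assms(3) by (auto simp: pending_def)
  moreover have "tree_potential qs \<le> m"
    using potential node_bound_start_bound_le[of P h] by (simp add: tree_potential_Cons)
  ultimately show ?thesis
    using globals ds(2) unfolding main_inv_def by (metis length_append_singleton Suc_eq_plus1)
qed

lemma pending_children:
  assumes pending: "pending ds ((P, h) # qs) R M"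
    and P: "admissible P" "gap (set P) < int d" "length P < A" "h \<le> d"
    and L: "outer_list P L" and searched: "searched P h (d - h) zs"
    and tree: "stores_tree (ds @ (P, h) # qs @ children P h (closed_nbs L) @ zs) R' M'"
    and result: "R' r_result = 0"
  shows "pending (ds @ [(P, h)]) (qs @ children P h (closed_nbs L) @ zs) R' M'"
proof -
  let ?new = "children P h (closed_nbs L) @ zs"
  have valid: "\<forall>z\<in>set ?new. valid_node z"
    using searched closed_nbs_subset_V[OF outer_list_subset_V[OF L]]
      admissible_subset_V[OF P(1)] P(3,4)
    by (auto simp: searched_def valid_node_def)
  have "\<exists>z\<in>set ?new. promising_node z" if node: "promising_node (P, h)"
  proof (rule promising_child[OF node P(2) L])
    show "gap_tried P h g (set ?new)" if g: "1 \<le> g" "h + g \<le> d" for g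
    proof -
      have "gap_tried P h g (set zs)"
        using g searched by (simp add: searched_def)
      then show ?thesis
        by (rule gap_tried_mono) simp
    qed
  qed simp
  then show ?thesis
    using pending valid tree result unfolding pending_def by auto
qed

lemma main_inv_children:
  assumes pending: "pending ds ((P, h) # qs) R M"
    and P: "admissible P" "gap (set P) < int d" "length P < A" "h \<le> d"
    and L: "outer_list P L" and searched: "searched P h (d - h) zs"
    and tree: "stores_tree (ds @ (P, h) # qs @ children P h (closed_nbs L) @ zs) R' M'"
    and R': "R' r_result = 0" "R' r_current = length ds + 1" "globals R' M'"
    and potential: "node_bound + start_bound P h + m = tree_potential ((P, h) # qs)"
  shows "main_inv m R' M'"
proof -
  let ?new = "children P h (closed_nbs L) @ zs"
  have "length (closed_nbs L) \<le> branching"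
    using length_closed_nbs_outer_list[OF P(1) L] by (simp add: branching_def)
  then have "node_bound + start_bound P h + tree_potential ?new \<le> tree_bound (A - length P) (d - h)"
    using tree_potential_expand[OF P(3), of "closed_nbs L" zs h] searched P(3)
    by (simp add: searched_def start_bound_def)
  then have "tree_potential (qs @ ?new) \<le> m"
    using potential by (simp add: tree_potential_append tree_potential_Cons)
  moreover have "pending (ds @ [(P, h)]) (qs @ ?new) R' M'"
    by (rule pending_children[OF pending P L searched tree R'(1)])
  ultimately show ?thesis
    unfolding main_inv_def using R'(2,3) by (metis length_append_singleton Suc_eq_plus1)
qed

lemma wp_grow_starts:
  assumes pending: "pending ds ((P, h) # qs) R0 M0"
    and P: "admissible P" "gap (set P) < int d" "length P < A" "h \<le> d" and L: "outer_list P L"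
    and tree: "stores_tree (ds @ (P, h) # qs @ children P h (closed_nbs L)) R M"
    and globals: "globals R M"
    and R: "R r_base = length ds" "R r_current = length ds + 1" "R r_base_label = h"
      "R r_result = 0" "R r_base_len = length P" "R r_base_outer = card (outer (set P))"
    and potential: "node_bound + start_bound P h + m = tree_potential ((P, h) # qs)"
  shows "wp (Block [Add r_goal r_base_label r_one] ;; starts_com) (start_bound P h + 3)
    (main_inv m) R M"
proof (rule wp_Block_Seq[where T = "start_bound P h + 2"], goal_cases straight time starts)
  case starts
  let ?ns = "ds @ (P, h) # qs @ children P h (closed_nbs L)" and ?R = "R(r_goal := h + 1)"
  have node: "node_at ?ns (?R r_base) P"
    using node_at_middle R(1) by simp
  have start: "globals ?R M" "base P 1 ?R" "?R r_base_label = h" "stores_tree ?ns ?R M"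
    using globals R tree by (simp_all add: globals_def base_def stores_tree_def)
  have "wp starts_com ((d - h) * (search_bound (A - Suc (length P)) + 4) + 2)
    (\<lambda>R' M'. globals R' M' \<and>
      (\<exists>zs. stores_tree (?ns @ zs) R' M' \<and> searched P h (d - h) zs)) ?R M"
    by (rule wp_starts[OF start(1) P(1,3,4) start(2,3) node start(4)])
  then have "wp starts_com (start_bound P h + 2) (main_inv m) ?R M"
  proof (rule wp_mono)
    fix R' M'
    assume "globals R' M' \<and> (\<exists>zs. stores_tree (?ns @ zs) R' M' \<and> searched P h (d - h) zs)"
      and "frame starts_com ?R M R' M'"
    with R(2,4) show "main_inv m R' M'"
      using main_inv_children[OF pending P L _ _ _ _ _ potential] by (auto simp: frame_def)
  qed (simp add: start_bound_def P(3))
  then show ?case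
    using globals R(3) by (simp add: globals_def)
qed auto

lemma wp_grow:
  assumes popped: "popped P h qs R M" and globals: "globals R M" and eval: "evaluated P R M"
    and P: "admissible P" "gap (set P) < int d" "length P < A" and h: "h \<le> d"
    and potential: "node_bound + start_bound P h + m = tree_potential ((P, h) # qs)"
  shows "wp grow_com (14 * D * B + start_bound P h + 10) (main_inv m) R M"
proof -
  from popped obtain ds where pending: "pending ds ((P, h) # qs) R M"
      and R: "R r_base = length ds" "R r_current = length ds + 1" "R r_base_label = h"
    unfolding popped_def by metis
  from P eval obtain L where L: "outer_list P L" "R r_list = length L" "segment (M a_list) 0 L"
      and len: "R r_len = length P"
    unfolding evaluated_def by metis
  let ?ns = "ds @ (P, h) # qs"
  let ?R = "R(r_base_len := R r_len, r_base_outer := R r_list, r_parent := R r_base,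
    r_label := R r_base_label)"
  let ?starts = "Block [Add r_goal r_base_label r_one] ;; starts_com"
  have "node_at ?ns (R r_base) P"
    unfolding R(1) by (rule node_at_middle)
  then have "wp expand_com (14 * D * length L + 3)
      (stores_tree (?ns @ children P (?R r_label) (closed_nbs L))) ?R M"
    by (intro wp_expand) (use globals pending L outer_list_subset_V in
      \<open>auto simp: globals_def pending_def stores_tree_def\<close>)
  then have "wp (expand_com ;; ?starts) (14 * D * B + start_bound P h + 6) (main_inv m) ?R M"
  proof (rule wp_Seq)
    fix R' M'
    assume tree: "stores_tree (?ns @ children P (?R r_label) (closed_nbs L)) R' M'"
      and frame: "frame expand_com ?R M R' M'"
    have "globals R' M'"
      using globals_frame[OF _ frame] globals by (simp add: globals_def)
    then show "wp ?starts (start_bound P h + 3) (main_inv m) R' M'"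
      using tree frame R len L(2) pending length_outer_list[OF L(1)]
      by (intro wp_grow_starts[OF pending P h L(1) _ _ _ _ _ _ _ _ potential])
        (simp_all add: frame_def pending_def)
  qed (use length_outer_list_le[OF P(1) L(1)] in simp)
  then show ?thesis
    unfolding grow_com_def
    by (intro wp_Block_Seq[where T = "14 * D * B + start_bound P h + 6"]) auto
qed

lemma wp_decide:
  assumes popped: "popped P h qs R M" and globals: "globals R M" and eval: "evaluated P R M"
    and node: "length P \<le> A" "h \<le> d"
    and potential: "node_bound + start_bound P h + m = tree_potential ((P, h) # qs)"
  shows "wp decide_com (14 * D * B + start_bound P h + 19) (main_inv m) R M"
proof -
  have len: "R r_len = length P" and bad: "R r_bad = 0 \<longleftrightarrow> admissible P"
    and params: "R r_A = A" "R r_d = d"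
    using eval globals by (auto simp: evaluated_def globals_def)
  have unaffected: "popped P h qs R' M" "globals R' M" "evaluated P R' M"
    if "\<And>r. r \<noteq> r_test \<Longrightarrow> R' r = R r" for R'
    using popped globals eval that
    by (simp_all add: popped_def pending_def globals_def evaluated_def stores_tree_def)
  have test: "gap (set P) < int d \<longleftrightarrow> length P < d + R r_list" if "admissible P"
    using admissible_gap[OF that] evaluated_list[OF eval that] by auto
  consider (skip) "\<not> promising_node (P, h)" "\<not> admissible P \<or> gap (set P) < int d \<and> \<not> length P < A"
    | (grow) "admissible P" "gap (set P) < int d" "length P < A"
    | (solved) "admissible P" "int d \<le> gap (set P)"
    using promising_node_admissible promising_node_length_less by force
  then show ?thesis
  proof cases
    case skip
    then have "wp (Block []) T (main_inv m) R' M" if "\<And>r. r \<noteq> r_test \<Longrightarrow> R' r = R r" for R' T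
      using main_inv_skip[OF unaffected(1,2)[OF that] skip(1) potential] by (intro wp_Block) auto
    with skip bad test len params show ?thesis
      unfolding decide_com_def by (cases "admissible P") (auto intro!: wp_Cond)
  next
    case grow
    have "wp grow_com T (main_inv m) R' M"
      if "\<And>r. r \<noteq> r_test \<Longrightarrow> R' r = R r" "14 * D * B + start_bound P h + 10 \<le> T" for R' T
      using wp_mono[OF wp_grow[OF unaffected[OF that(1)] grow node(2) potential] that(2)] by blast
    with grow bad test len params show ?thesis
      unfolding decide_com_def by (auto intro!: wp_Cond)
  next
    case solved
    have "solution (set P)"
      using solution_of_admissible[OF solved(1) node(1) solved(2)] .
    then have "main_inv m (R'(r_result := 1, r_current := R' r_count)) M"
      if "\<And>r. r \<noteq> r_test \<Longrightarrow> R' r = R r" for R'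
      using unaffected(2)[OF that] by (auto simp: main_inv_def globals_def)
    with solved bad test len params show ?thesis
      unfolding decide_com_def by (auto intro!: wp_Cond wp_Block)
  qed
qed

lemma wp_node:
  assumes pending: "pending ds ((P, h) # qs) R M" and current: "R r_current = length ds"
    and globals: "globals R M"
    and potential: "node_bound + start_bound P h + m = tree_potential ((P, h) # qs)"
  shows "wp node_com (node_bound + start_bound P h - 3) (main_inv m) R M"
proof -
  let ?R = "R(r_base := length ds, r_node := length ds, r_base_label := h,
    r_current := length ds + 1)"
  have tree: "tree (ds @ (P, h) # qs) (M a_parent) (M a_vertex) (M a_label)"
    and P: "set P \<subseteq> V" "length P \<le> A" "h \<le> d"
    using pending by (auto simp: pending_def stores_tree_def valid_node_def)
  have "wp eval_com (20 * (length P + 1) * D) (\<lambda>R' M'. globals R' M' \<and> evaluated P R' M') ?R M"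
    by (rule wp_eval) (use globals tree_nth(1)[OF tree] P in \<open>auto simp: globals_def\<close>)
  then have "wp (eval_com ;; decide_com)
      (20 * (length P + 1) * D + (14 * D * B + start_bound P h + 19)) (main_inv m) ?R M"
  proof (rule wp_Seq)
    fix R' M'
    assume eval: "globals R' M' \<and> evaluated P R' M'" and frame: "frame eval_com ?R M R' M'"
    have "popped P h qs R' M'"
      using pending frame unfolding popped_def pending_def
      by (intro exI[of _ ds]) (simp add: frame_def stores_tree_def)
    then show "wp decide_com (14 * D * B + start_bound P h + 19) (main_inv m) R' M'"
      using eval P potential by (intro wp_decide) auto
  qed simp
  then show ?thesis
    unfolding node_com_def
    using node_bound_ge(1)[OF P(2)] tree_nth(2)[OF tree] current globals
    by (intro wp_Block_Seq[where
        T = "20 * (length P + 1) * D + (14 * D * B + start_bound P h + 19)"])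
      (auto simp: globals_def)
qed

lemma wp_main:
  assumes globals: "globals R M" and tree: "stores_tree [([], 0)] R M"
    and R: "R r_current = 0" "R r_result = 0"
  shows "wp main_com (tree_bound A d + 2) (\<lambda>R' M'. R' r_result = of_bool (\<exists>J. solution J)) R M"
  unfolding main_com_def
proof (rule wp_While[where Inv = main_inv and m = "tree_bound A d"],
  goal_cases straight init time body)
  case init
  have "pending [] [([], 0)] R M"
    using tree R(2) promising_empty_iff by (simp add: pending_def valid_node_def promising_node_def)
  then have "\<exists>ds qs. pending ds qs R M \<and> R r_current = length ds \<and>
    tree_potential qs \<le> tree_bound A d"
    using R(1) by (intro exI[of _ "[]"] exI[of _ "[([], 0)]"]) (simp add: tree_potential_def)
  then show ?case
    using globals unfolding main_inv_def by blast
next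
  case (body m R' M')
  let ?R = "R'(r_test := R' r_count - R' r_current)"
  have globals': "globals ?R M'"
    using body(1) by (simp add: main_inv_def globals_def)
  from body(1) consider (solved) "R' r_result = 1" "R' r_current = R' r_count" "\<exists>J. solution J"
    | (exhausted) ds where "pending ds [] R' M'" "R' r_current = length ds"
    | (node) ds P h qs where "pending ds ((P, h) # qs) R' M'" "R' r_current = length ds"
        "tree_potential ((P, h) # qs) \<le> m"
    unfolding main_inv_def by (metis list.exhaust surj_pair)
  then show ?case
  proof cases
    case (node ds P h qs)
    have "node_bound + start_bound P h \<le> tree_potential ((P, h) # qs)"
      using node_bound_start_bound_le[of P h] by (simp add: tree_potential_Cons)
    then obtain l where potential: "node_bound + start_bound P h + l = tree_potential ((P, h) # qs)"
      by (metis le_Suc_ex)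
    have "wp node_com (node_bound + start_bound P h - 3) (main_inv l) ?R M'"
      by (rule wp_node[OF _ _ globals' potential])
        (use node in \<open>simp_all add: pending_def stores_tree_def\<close>)
    moreover have "length [Sub r_test r_count r_current] + 2 +
      (node_bound + start_bound P h - 3) + l \<le> m"
      using potential node(3) node_bound_ge(2)[of 0] by simp
    moreover have "?R r_test \<noteq> 0"
      using node(1,2) by (simp add: pending_def stores_tree_def)
    ultimately show ?thesis
      by auto
  qed (auto simp: pending_def stores_tree_def)
qed auto

lemma wp_prog:
  assumes B: "B = (k - d) div 2"
  shows "wp prog (tree_bound A d + 6 * k + 11) (\<lambda>R M. R 0 = of_bool (\<exists>J. solution J))
    (input_registers n k d) (input_arrays adj S)"
proof -
  let ?in = "input_registers n k d" and ?M = "input_arrays adj S"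
  let ?R = "?in(r_one := 1, r_fresh := k - d, r_B := 0)"
  let ?main = "main_com ;; Block [Copy 0 r_result]"
  let ?Q = "\<lambda>R M. R 0 = of_bool (\<exists>J. solution J)"
  have regs: "?in r_n = n" "?in r_k = k" "?in r_d = d" "\<And>r. 3 \<le> r \<Longrightarrow> ?in r = 0"
    by (auto simp: input_registers_def nth_default_def nth_Cons' numeral_2_eq_2)
  have arrays: "?M a = (\<lambda>_. 0)" if "3 \<le> a" for a
    using that by (auto simp: input_arrays_def nth_default_def fun_eq_iff)
  have "wp half_com (6 * k + 2) (\<lambda>R' M'. R' r_B = B) ?R ?M"
    using wp_half[of ?R ?M] by (rule wp_mono) (use B in auto)
  then have "wp (half_com ;; Block [Add r_A r_B r_d, Const r_count 1, Add r_limit r_d r_one] ;;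
      ?main) (tree_bound A d + 6 * k + 8) ?Q ?R ?M"
  proof (rule wp_Seq)
    fix R' M'
    assume half: "R' r_B = B" and frame: "frame half_com ?R ?M R' M'"
    let ?R' = "R'(r_A := A, r_count := 1, r_limit := d + 1)"
    have same: "M' = ?M" "\<And>r. r \<notin> {r_B, r_fresh, r_test} \<Longrightarrow> R' r = ?R r"
      using frame by (auto simp: frame_def)
    have "globals ?R' M'"
      using half regs arrays stores_instance_input_arrays by (simp add: globals_def same)
    moreover have "stores_tree [([], 0)] ?R' M'"
      using arrays by (simp add: stores_tree_def tree_def same)
    ultimately have "wp main_com (tree_bound A d + 2)
      (\<lambda>R' M'. R' r_result = of_bool (\<exists>J. solution J)) ?R' M'"
      by (rule wp_main) (use regs in \<open>simp_all add: same\<close>)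
    then have "wp ?main (tree_bound A d + 3) ?Q ?R' M'"
      by (rule wp_Seq[where T' = 1]) (simp_all add: wp_Block)
    then show "wp (Block [Add r_A r_B r_d, Const r_count 1, Add r_limit r_d r_one] ;; ?main)
        (tree_bound A d + 6) ?Q R' M'"
      using half same regs
      by (intro wp_Block_Seq[where T = "tree_bound A d + 3"]) (auto simp: A_def)
  qed simp
  then show ?thesis
    unfolding prog_def using regs
    by (intro wp_Block_Seq[where T = "tree_bound A d + 6 * k + 8"]) auto
qed

end

section \<open>Estimating the running time\<close>

lemma power_le_fact_exp:
  fixes x :: real
  assumes "0 \<le> x"
  shows "x ^ m \<le> fact m * exp x"
proof -
  have "(\<lambda>n. x ^ n / fact n) sums exp x"
    using exp_converges[of x] by (simp add: scaleR_conv_of_real divide_inverse mult.commute)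
  then have "sum (\<lambda>n. x ^ n / fact n) {m} \<le> exp x"
    using sum_le_suminf[of "\<lambda>n. x ^ n / fact n" "{m}"] assms by (simp add: sums_iff)
  then show ?thesis
    by (simp add: field_simps)
qed

lemma fact_mult_fact_le: "fact a * fact b \<le> (fact (a + b) :: real)"
proof -
  have "fact a * fact b \<le> (fact (a + b) :: nat)"
    using dvd_imp_le[OF fact_fact_dvd_fact[of a b]] by simp
  then show ?thesis
    by (metis (mono_tags) of_nat_fact of_nat_le_iff of_nat_mult)
qed

text \<open>Since \<open>b \<le> a\<close>, the factor \<open>(c\<^sup>2) ^ a\<close> gained by applying \<open>x ^ m \<le> fact m * exp x\<close> to
  \<open>x = c\<^sup>2 * (b + 1)\<close> absorbs \<open>c ^ k\<close>, and what remains is \<open>fact a\<close> times an exponential in \<open>b\<close>,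
  which is at most a constant times \<open>fact b\<close>.\<close>
lemma power_mult_power_le_fact:
  fixes c :: real
  assumes "1 \<le> c" "b \<le> a" "a + b \<le> k" "k \<le> a + b + 1"
  shows "c ^ k * (real b + 1) ^ a \<le> c * exp (c\<^sup>2) * exp (exp (c\<^sup>2)) * fact k"
proof -
  have "c ^ k \<le> c ^ (2 * a + 1)"
    using assms by (intro power_increasing) auto
  then have "c ^ k * (real b + 1) ^ a \<le> c ^ (2 * a + 1) * (real b + 1) ^ a"
    by (intro mult_right_mono) auto
  also have "\<dots> = c * (c\<^sup>2 * (real b + 1)) ^ a"
    by (simp add: power_mult_distrib power_mult)
  also have "\<dots> \<le> c * (fact a * exp (c\<^sup>2 * (real b + 1)))"
    using assms by (intro mult_left_mono power_le_fact_exp) auto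
  also have "exp (c\<^sup>2 * (real b + 1)) = exp (c\<^sup>2) * exp (c\<^sup>2) ^ b"
    by (simp add: algebra_simps exp_add flip: exp_of_nat_mult)
  also have "c * (fact a * (exp (c\<^sup>2) * exp (c\<^sup>2) ^ b))
      \<le> c * (fact a * (exp (c\<^sup>2) * (fact b * exp (exp (c\<^sup>2)))))"
    using assms by (intro mult_left_mono power_le_fact_exp) auto
  also have "\<dots> = c * exp (c\<^sup>2) * exp (exp (c\<^sup>2)) * (fact a * fact b)"
    by simp
  also have "\<dots> \<le> c * exp (c\<^sup>2) * exp (exp (c\<^sup>2)) * fact k"
  proof (intro mult_left_mono)
    have "fact a * fact b \<le> (fact (a + b) :: real)"
      by (rule fact_mult_fact_le)
    also have "\<dots> \<le> fact k"
      using assms(3) by (rule fact_mono)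
    finally show "fact a * fact b \<le> (fact k :: real)" .
  qed (use assms in auto)
  finally show ?thesis .
qed

context search_instance
begin

lemma tree_bound_le:
  assumes "A \<le> k" "d \<le> k"
  shows "tree_bound A d \<le> 536 * (max 1 n * (96 ^ k * (B + 1) ^ A * max 1 (max_degree V E - 1) ^ A))"
proof -
  let ?x = "max 1 (max_degree V E - 1)"
  have "A + 1 \<le> 2 ^ A"
    using Suc_leI[OF less_exp] by (simp only: Suc_eq_plus1)
  then have "(A + 1)\<^sup>2 \<le> (2 ^ A)\<^sup>2"
    by (intro power_mono) auto
  also have "\<dots> = 4 ^ A"
    by (simp add: power2_eq_square flip: power_mult_distrib)
  finally have A: "(A + 1)\<^sup>2 \<le> 4 ^ A" .
  have power24: "(24 :: nat) ^ A = 4 ^ A * 6 ^ A"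
    by (simp flip: power_mult_distrib)
  have "D \<le> 3 * ?x"
    by (auto simp: D_def)
  then have "2 * ((B + 1) * D) \<le> 2 * ((B + 1) * (3 * ?x))"
    by (intro mult_le_mono2)
  then have "2 * branching \<le> (6 * (B + 1)) * ?x"
    by (simp add: branching_def algebra_simps)
  then have "(2 * branching) ^ A \<le> ((6 * (B + 1)) * ?x) ^ A"
    by (rule power_mono) simp
  then have "tree_bound A d \<le> 536 * (max 1 n * 4 ^ A) * ((6 * (B + 1)) * ?x) ^ A * 4 ^ d"
    unfolding tree_bound_def scale_def using A by (simp add: mult_le_mono)
  also have "\<dots> = 536 * (max 1 n * (24 ^ A * 4 ^ d * (B + 1) ^ A * ?x ^ A))"
    unfolding power24 power_mult_distrib by (simp only: mult_ac)
  also have "\<dots> \<le> 536 * (max 1 n * (24 ^ k * 4 ^ k * (B + 1) ^ A * ?x ^ A))"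
    using assms by (intro mult_le_mono power_increasing) auto
  finally show ?thesis
    by (simp flip: power_mult_distrib)
qed

lemma time_le:
  assumes k: "1 \<le> k" "d \<le> k" "A \<le> k"
  shows "tree_bound A d + 6 * k + 11
    \<le> 553 * (max 1 n * (96 ^ k * (B + 1) ^ A * max 1 (max_degree V E - 1) ^ A))"
proof -
  let ?x = "max 1 (max_degree V E - 1)"
  let ?Y = "max 1 n * (96 ^ k * (B + 1) ^ A * ?x ^ A)"
  have "k \<le> 1 * (96 ^ k * 1 * 1)"
    using power_gt_expt[of 96 k] by simp
  also have "\<dots> \<le> ?Y"
    by (intro mult_le_mono) (auto simp: Suc_leI)
  finally have "k \<le> ?Y" .
  then show ?thesis
    using tree_bound_le[OF k(3,2)] k(1) by linarith
qed

lemma real_time_le: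
  assumes k: "1 \<le> d" "d \<le> k" and B: "B = (k - d) div 2"
  shows "real (tree_bound A d + 6 * k + 11) \<le> 553 * (96 * exp (96\<^sup>2) * exp (exp (96\<^sup>2))) * fact k *
    max 1 (real (max_degree V E) - 1) powr (real (k + d) / 2) * max 1 (real (card V))"
proof -
  let ?x = "max 1 (real (max_degree V E) - 1)" and ?N = "max 1 (real (card V))"
  let ?c = "96 * exp (96\<^sup>2) * exp (exp (96\<^sup>2)) :: real"
  have A: "B \<le> A" "A + B \<le> k" "k \<le> A + B + 1" "2 * A \<le> k + d" "A \<le> k"
    using k B unfolding A_def by presburger+
  have real_max: "real (max 1 n) = ?N" "real (max 1 (max_degree V E - 1)) = ?x"
    by (auto simp: card_V max_def)
  have base: "96 ^ k * (real B + 1) ^ A \<le> ?c * fact k"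
    using A by (intro power_mult_power_le_fact) auto
  have "?x ^ A = ?x powr real A"
    by (simp add: powr_realpow)
  also have "\<dots> \<le> ?x powr (real (k + d) / 2)"
    using A(4) by (intro powr_mono) auto
  finally have exponent: "?x ^ A \<le> ?x powr (real (k + d) / 2)" .
  have "real (tree_bound A d + 6 * k + 11)
      \<le> real (553 * (max 1 n * (96 ^ k * (B + 1) ^ A * max 1 (max_degree V E - 1) ^ A)))"
    using time_le[of k] k A(5) by (simp only: of_nat_le_iff)
  also have "\<dots> = 553 * (96 ^ k * (real B + 1) ^ A) * ?x ^ A * ?N"
    unfolding of_nat_mult of_nat_power real_max by (simp add: add.commute)
  also have "\<dots> \<le> 553 * (?c * fact k) * ?x powr (real (k + d) / 2) * ?N"
    by (rule mult_right_mono[OF mult_mono[OF mult_left_mono[OF base] exponent]]) auto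
  finally show ?thesis
    by (simp only: mult.assoc)
qed

end

theorem theorem20:
  shows "\<exists>(P :: instr list) (C :: real).
    \<forall>(V :: nat set) (E :: nat set set) (S :: nat set) (k :: nat) (d :: nat) (adj :: nat list list).
      gap_ls_vc_instance V E S k d \<and> adjacency_lists V E adj \<longrightarrow>
      (\<exists>t :: nat.
        real t \<le> C * fact k * max 1 (real (max_degree V E) - 1) powr (real (k + d) / 2)
                   * max 1 (real (card V)) \<and>
        decides_within P (input_registers (card V) k d) (input_arrays adj S) t
          (gap_ls_vc V E S k d))"
proof (intro exI[of _ "compile 0 prog"] exI[of _ "553 * (96 * exp (96\<^sup>2) * exp (exp (96\<^sup>2)))"]
    allI impI, goal_cases)
  case (1 V E S k d adj)
  then interpret search_instance V E S "(k - d) div 2" d adj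
    by unfold_locales (auto simp: gap_ls_vc_instance_def)
  have d: "1 \<le> d" "d \<le> k"
    using 1 by (auto simp: gap_ls_vc_instance_def)
  then have "A = (k + d) div 2"
    unfolding A_def by presburger
  then have "gap_ls_vc V E S k d \<longleftrightarrow> (\<exists>J. solution J)"
    by (simp add: gap_ls_vc_iff_improving_set)
  with wp_decides[OF wp_prog[of k]] obtain t where t: "t \<le> tree_bound A d + 6 * k + 11"
      "decides_within (compile 0 prog) (input_registers (card V) k d) (input_arrays adj S) t
        (gap_ls_vc V E S k d)"
    by (auto simp: card_V)
  then have "real t \<le> real (tree_bound A d + 6 * k + 11)"
    by (simp only: of_nat_le_iff)
  with real_time_le[OF d refl] t(2) show ?case
    by (meson order_trans)
qed

end
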